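(* Let $n\ge 2$. In the hyperbolic space $\mathbb{H}^n$, for any constants $\varepsilon>0$ and $D>0$, there is a convex domain $\Omega\subset\mathbb{H}^n$ with diameter $D$ whose fundamental gap satisfies $$\lambda_2(\Omega)-\lambda_1(\Omega)<\frac{\varepsilon\pi^2}{D^2}.$$
   Context: $\mathbb{H}^n$ is the hyperbolic space of constant sectional curvature $-1$. Domains considered are compact and (geodesically) convex. For such a domain $\Omega$, $\lambda_1(\Omega)<\lambda_2(\Omega)\le\lambda_3(\Omega)\le\cdots$ denote the eigenvalues, in increasing order and with multiplicity, of the Laplace operator $-\Delta$ of $\mathbb{H}^n$ on $\Omega$ with Dirichlet boundary conditions. The fundamental gap of $\Omega$ is $\lambda_2(\Omega)-\lambda_1(\Omega)>0$. The diameter is taken with respect to the hyperbolic distance. *)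

theory Defs
  imports "HOL-Analysis.Analysis" "HOL-Library.Extended_Nat"
begin

text \<open>
  Hyperbolic n-space is the Poincare ball model: the open unit ball of \<open>real ^ 'n\<close>, n = CARD('n),
  with the metric of curvature -1
    g = \<rho>(x)^2 (dx_1^2 + ... + dx_n^2),   \<rho>(x) = 2 / (1 - |x|^2).
  It induces the Euclidean topology of the ball, so \<open>compact\<close>, \<open>interior\<close> and \<open>continuous_on\<close> below
  may be taken in \<open>real ^ 'n\<close>.
\<close>

definition hyp_space :: "(real ^ 'n) set" where
  "hyp_space = ball 0 1"

definition hyp_density :: "real ^ 'n \<Rightarrow> real" where
  "hyp_density x = 2 / (1 - (norm x)\<^sup>2)"

text \<open>The Riemannian distance of g.\<close>

definition hyp_dist :: "real ^ 'n \<Rightarrow> real ^ 'n \<Rightarrow> real" where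
  "hyp_dist x y = arcosh (1 + 2 * (norm (x - y))\<^sup>2 / ((1 - (norm x)\<^sup>2) * (1 - (norm y)\<^sup>2)))"

text \<open>Any two points of hyperbolic space are joined by a unique geodesic, which is minimizing;
  it consists of the points where the triangle inequality is an equality.\<close>

definition hyp_segment :: "real ^ 'n \<Rightarrow> real ^ 'n \<Rightarrow> (real ^ 'n) set" where
  "hyp_segment x y = {z \<in> hyp_space. hyp_dist x z + hyp_dist z y = hyp_dist x y}"

definition hyp_convex :: "(real ^ 'n) set \<Rightarrow> bool" where
  "hyp_convex \<Omega> \<longleftrightarrow> \<Omega> \<subseteq> hyp_space \<and> (\<forall>x\<in>\<Omega>. \<forall>y\<in>\<Omega>. hyp_segment x y \<subseteq> \<Omega>)"

text \<open>Domains are compact; nonempty interior excludes lower-dimensional convex sets, which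
  carry no Dirichlet problem.\<close>

definition convex_domain :: "(real ^ 'n) set \<Rightarrow> bool" where
  "convex_domain \<Omega> \<longleftrightarrow> compact \<Omega> \<and> hyp_convex \<Omega> \<and> interior \<Omega> \<noteq> {}"

definition hyp_diameter :: "(real ^ 'n) set \<Rightarrow> real" where
  "hyp_diameter \<Omega> = (SUP (x, y)\<in>\<Omega> \<times> \<Omega>. hyp_dist x y)"

definition partial_deriv :: "'n \<Rightarrow> (real ^ 'n \<Rightarrow> real) \<Rightarrow> real ^ 'n \<Rightarrow> real" where
  "partial_deriv i u x = deriv (\<lambda>t. u (x + t *\<^sub>R axis i 1)) 0"

text \<open>\<open>Ck_on k u U\<close>: u is k times continuously differentiable on the open set U.\<close>

fun Ck_on :: "nat \<Rightarrow> (real ^ 'n \<Rightarrow> real) \<Rightarrow> (real ^ 'n) set \<Rightarrow> bool" where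
  "Ck_on 0 u U \<longleftrightarrow> continuous_on U u"
| "Ck_on (Suc k) u U \<longleftrightarrow> u differentiable_on U \<and> (\<forall>i. Ck_on k (partial_deriv i u) U)"

text \<open>
  The Laplace-Beltrami operator  (det g)^(-1/2) \<Sum>_ij \<partial>_i ((det g)^(1/2) g^ij \<partial>_j u),
  where (det g)^(1/2) = \<rho>^n and g^ij = \<delta>_ij / \<rho>^2.
\<close>

definition hyp_laplacian :: "(real ^ 'n \<Rightarrow> real) \<Rightarrow> real ^ 'n \<Rightarrow> real" where
  "hyp_laplacian u x =
     (\<Sum>i\<in>UNIV. partial_deriv i
        (\<lambda>y. hyp_density y ^ CARD('n) / (hyp_density y)\<^sup>2 * partial_deriv i u y) x)
     / hyp_density x ^ CARD('n)"

text \<open>Classical solutions of \<open>-\<Delta> u = \<mu> u\<close> in the interior, vanishing continuously on the boundary.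
  Functions are extended by 0 off \<Omega>, so that they are determined by their values on \<Omega>.\<close>

definition dirichlet_eigenspace :: "(real ^ 'n) set \<Rightarrow> real \<Rightarrow> (real ^ 'n \<Rightarrow> real) set" where
  "dirichlet_eigenspace \<Omega> \<mu> =
     {u. continuous_on \<Omega> u \<and> Ck_on 2 u (interior \<Omega>) \<and>
         (\<forall>x\<in>interior \<Omega>. - hyp_laplacian u x = \<mu> * u x) \<and>
         (\<forall>x. x \<notin> interior \<Omega> \<longrightarrow> u x = 0)}"

definition lin_indep_family :: "nat \<Rightarrow> (nat \<Rightarrow> 'a \<Rightarrow> real) \<Rightarrow> bool" where
  "lin_indep_family k u \<longleftrightarrow>
     (\<forall>c. (\<forall>x. (\<Sum>i<k. c i * u i x) = 0) \<longrightarrow> (\<forall>i<k. c i = (0::real)))"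

text \<open>The dimension of the eigenspace; it is positive exactly if \<mu> is an eigenvalue.\<close>

definition dirichlet_multiplicity :: "(real ^ 'n) set \<Rightarrow> real \<Rightarrow> enat" where
  "dirichlet_multiplicity \<Omega> \<mu> =
     (SUP k\<in>{k. \<exists>u. lin_indep_family k u \<and> (\<forall>i<k. u i \<in> dirichlet_eigenspace \<Omega> \<mu>)}. enat k)"

text \<open>The number of eigenvalues in \<open>{..t}\<close>, with multiplicity.\<close>

definition dirichlet_count :: "(real ^ 'n) set \<Rightarrow> real \<Rightarrow> enat" where
  "dirichlet_count \<Omega> t =
     (SUP S\<in>{S. finite S \<and> S \<subseteq> {..t}}. \<Sum>\<mu>\<in>S. dirichlet_multiplicity \<Omega> \<mu>)"

text \<open>The k-th eigenvalue in increasing order with multiplicity, for k = 1, 2, 3, ...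
  The infimum is attained because the spectrum is discrete.\<close>

definition dirichlet_eigenvalue :: "(real ^ 'n) set \<Rightarrow> nat \<Rightarrow> real" where
  "dirichlet_eigenvalue \<Omega> k = Inf {t. enat k \<le> dirichlet_count \<Omega> t}"

definition fundamental_gap :: "(real ^ 'n) set \<Rightarrow> real" where
  "fundamental_gap \<Omega> = dirichlet_eigenvalue \<Omega> 2 - dirichlet_eigenvalue \<Omega> 1"

end

theory Submission
  imports Defs
begin

text \<open>
  In iterated Fermi coordinates \<open>dt\<^sub>0\<^sup>2 + cosh\<^sup>2 t\<^sub>0 (dt\<^sub>1\<^sup>2 + cosh\<^sup>2 t\<^sub>1 (\<dots> + dt\<^sub>n\<^sub>-\<^sub>1\<^sup>2))\<close> every box
  \<open>\<bar>t\<^sub>k\<bar> \<le> T\<^sub>k\<close> is convex, its diameter D satisfies \<open>cosh (D / 2) = \<Prod>k. cosh T\<^sub>k\<close>, and its Dirichlet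
  problem separates. If the box is thin in all directions but \<open>t\<^sub>0\<close>, the equation for \<open>t\<^sub>0\<close> has the
  potential \<open>\<mu> / cosh\<^sup>2 t\<^sub>0\<close> with \<mu> large: a barrier at 0 between two wells at the ends. The first even
  and the first odd solution then have almost the same eigenvalue, by the Wronskian identity.
  The even one gives \<open>\<lambda>\<^sub>1\<close>: products of ground states at slightly smaller parameters are
  supersolutions that are positive up to the boundary. The odd one bounds \<open>\<lambda>\<^sub>2\<close> from above.
\<close>

subsection \<open>Linear systems and Sturm--Liouville problems\<close>

text \<open>Thickness, barrier and length are tied together: the thickness \<delta> determines the
  separation constant \<mu> of the thin directions, and the prescribed diameter D then fixes the
  length T. So the double-well estimate needs one threshold for \<mu> that is valid for all T in a
  compact range, here \<open>[\<sigma> / 2, \<sigma>]\<close> with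
  \<open>\<sigma> = sinh (D / 2)\<close>. Only afterwards is \<delta> taken so small that
  \<open>\<mu> \<ge> 1 / (2 ^ (n - 1) * \<delta>\<^sup>2)\<close> passes the threshold and T stays
  in the range. The Wronskian makes the gap small because, for solutions normalized at 0, it says
  that the gap times the integral of \<open>w * f * h\<close> over \<open>[0, T]\<close> is 1.
  Inside the barrier the even solution f stays above 1 and the odd solution h above a cubic whose
  coefficient is proportional to the excess K of the barrier over the eigenvalue. Hence the gap is
  O(1 / K), a polynomial substitute for the exponential tunnelling estimate, and K is arbitrary once
  \<mu> is large. The variables \<open>y\<^sub>k = sinh t\<^sub>k\<close> replace
  \<open>t\<^sub>k\<close> throughout, since they are algebraic in the hyperboloid
  coordinates.\<close>

lemma ex_antiderivative:
  fixes g :: "real \<Rightarrow> real"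
  assumes "continuous_on UNIV g"
  shows "\<exists>G. G 0 = 0 \<and> (\<forall>t. (G has_real_derivative g t) (at t))"
proof -
  let ?G = "\<lambda>u. LBINT y=ereal 0..ereal u. g y"
  have "(?G has_real_derivative g t) (at t)" for t :: real
  proof -
  let ?a = "- \<bar>t\<bar> - 1" and ?b = "\<bar>t\<bar> + 1"
  have "(?G has_vector_derivative g t) (at t within {?a..?b})"
    by (rule interval_integral_FTC2) (auto intro: continuous_on_subset[OF assms])
  then have "(?G has_vector_derivative g t) (at t)"
    by (subst (asm) at_within_interior) auto
  then show ?thesis
    by (simp add: has_real_derivative_iff_has_vector_derivative)
  qed
  then show ?thesis by (intro exI[of _ ?G]) simp
qed

text \<open>One step of the Picard estimate: integrating from 0 raises the power by one and supplies
  the factor \<open>1 / Suc k\<close> from which the factorial is built. Negative t is reduced to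
  positive t by reflection, the absolute value to a one-sided bound by passing to
  \<open>- G\<close>.\<close>

lemma abs_le_of_deriv_abs_le_power:
  fixes G g :: "real \<Rightarrow> real"
  assumes G: "\<And>t. (G has_real_derivative g t) (at t)" and "G 0 = 0"
    and le: "\<And>s. \<bar>s\<bar> \<le> R \<Longrightarrow> \<bar>g s\<bar> \<le> C * \<bar>s\<bar> ^ k" and t: "\<bar>t\<bar> \<le> R"
  shows "\<bar>G t\<bar> \<le> C * \<bar>t\<bar> ^ Suc k / real (Suc k)"
proof -
  have main: "H x \<le> C * x ^ Suc k / real (Suc k)"
    if H: "\<And>t. (H has_real_derivative h t) (at t)" and "H 0 = 0" and x: "0 \<le> x" "x \<le> R"
      and le: "\<And>s. 0 \<le> s \<Longrightarrow> s \<le> R \<Longrightarrow> h s \<le> C * s ^ k" for H h :: "real \<Rightarrow> real" and x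
  proof -
    have "C * 0 ^ Suc k / real (Suc k) - H 0 \<le> C * x ^ Suc k / real (Suc k) - H x"
    proof (rule DERIV_nonneg_imp_nondecreasing[OF x(1)])
      fix s assume s: "0 \<le> s" "s \<le> x"
      have "((\<lambda>x. C * x ^ Suc k / real (Suc k) - H x) has_real_derivative C * s ^ k - h s) (at s)"
        by (rule derivative_eq_intros H refl | simp)+
      then show "\<exists>y. ((\<lambda>x. C * x ^ Suc k / real (Suc k) - H x) has_real_derivative y) (at s) \<and> 0 \<le> y"
        using le[of s] s x by auto
    qed
    then show ?thesis using \<open>H 0 = 0\<close> by simp
  qed
  have refl_deriv: "((\<lambda>x. G (- x)) has_real_derivative - g (- x)) (at x)" for x
    using DERIV_chain'[of uminus "-1" x UNIV G "g (- x)"] G[of "-x"] DERIV_minus[OF DERIV_ident[of "at x"]]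
    by simp
  have neg: "((\<lambda>x. - G x) has_real_derivative - g x) (at x)"
      "((\<lambda>x. - G (- x)) has_real_derivative g (- x)) (at x)" for x
    using DERIV_minus[OF G[of x]] DERIV_minus[OF refl_deriv[of x]] by simp_all
  have b: "\<bar>g s\<bar> \<le> C * s ^ k" "\<bar>g (- s)\<bar> \<le> C * s ^ k" if "0 \<le> s" "s \<le> R" for s
    using le[of s] le[of "- s"] that by auto
  show ?thesis
  proof (cases "t \<ge> 0")
    case True
    then have "G t \<le> C * t ^ Suc k / real (Suc k)" "- G t \<le> C * t ^ Suc k / real (Suc k)"
      using t b by (intro main[OF G] main[OF neg(1)]; simp add: \<open>G 0 = 0\<close> abs_le_iff)+
    then show ?thesis using True by simp
  next
    case False
    then have "G (- (- t)) \<le> C * (- t) ^ Suc k / real (Suc k)"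
      "- G (- (- t)) \<le> C * (- t) ^ Suc k / real (Suc k)"
      using t b by (intro main[OF refl_deriv] main[OF neg(2)]; simp add: \<open>G 0 = 0\<close> abs_le_iff)+
    then show ?thesis using False by simp
  qed
qed

text \<open>Series of Picard increments: \<open>F (Suc k)\<close> and \<open>G (Suc k)\<close> are
  the antiderivatives, vanishing at 0, of \<alpha> times \<open>G k\<close> and of \<beta> times
  \<open>F k\<close>. On \<open>[-R, R]\<close> the k-th term is at most
  \<open>c * (M * R) ^ k / fact k\<close>, so the series and its termwise derivatives converge
  uniformly there; R is arbitrary, hence the solution is global.\<close>

lemma ex_linear_system_solution:
  fixes \<alpha> \<beta> :: "real \<Rightarrow> real"
  assumes \<alpha>: "continuous_on UNIV \<alpha>" and \<beta>: "continuous_on UNIV \<beta>"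
  shows "\<exists>f g. f 0 = a \<and> g 0 = b \<and>
    (\<forall>t. (f has_real_derivative \<alpha> t * g t) (at t)) \<and>
    (\<forall>t. (g has_real_derivative \<beta> t * f t) (at t))"
proof -
  define I where "I g = (SOME G. G 0 = 0 \<and> (\<forall>t. (G has_real_derivative g t) (at t)))"
    for g :: "real \<Rightarrow> real"
  have I: "I g 0 = 0" "\<And>t. (I g has_real_derivative g t) (at t)" if "continuous_on UNIV g" for g
    using someI_ex[OF ex_antiderivative[OF that]] by (auto simp: I_def)
  have contI: "continuous_on UNIV (I g)" if "continuous_on UNIV g" for g
    using I(2)[OF that] by (meson DERIV_isCont continuous_at_imp_continuous_on)
  define P where "P = rec_nat (\<lambda>t. a, \<lambda>t. b)
    (\<lambda>_ p. (I (\<lambda>t. \<alpha> t * snd p t), I (\<lambda>t. \<beta> t * fst p t)))"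
  define F where "F k = fst (P k)" for k
  define G where "G k = snd (P k)" for k
  have F0: "F 0 = (\<lambda>t. a)" and G0: "G 0 = (\<lambda>t. b)"
    and FS: "F (Suc k) = I (\<lambda>t. \<alpha> t * G k t)" and GS: "G (Suc k) = I (\<lambda>t. \<beta> t * F k t)" for k
    by (auto simp: F_def G_def P_def)
  have cont: "continuous_on UNIV (F k) \<and> continuous_on UNIV (G k)" for k
    by (induction k) (auto simp: F0 G0 FS GS intro!: contI continuous_intros \<alpha> \<beta>)
  have dF: "(F (Suc k) has_real_derivative \<alpha> t * G k t) (at t)"
    and dG: "(G (Suc k) has_real_derivative \<beta> t * F k t) (at t)"
    and z: "F (Suc k) 0 = 0" "G (Suc k) 0 = 0" for k t
    using I[of "\<lambda>t. \<alpha> t * G k t"] I[of "\<lambda>t. \<beta> t * F k t"] cont[of k]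
    by (auto simp: FS GS intro!: continuous_intros \<alpha> \<beta>)
  define c where "c = max \<bar>a\<bar> \<bar>b\<bar>"
  have c: "\<bar>a\<bar> \<le> c" "\<bar>b\<bar> \<le> c" "c \<ge> 0" by (auto simp: c_def)
  have bound: "\<bar>F k t\<bar> \<le> c * M ^ k / fact k * \<bar>t\<bar> ^ k \<and> \<bar>G k t\<bar> \<le> c * M ^ k / fact k * \<bar>t\<bar> ^ k"
    if M: "\<And>s. \<bar>s\<bar> \<le> R \<Longrightarrow> \<bar>\<alpha> s\<bar> \<le> M" "\<And>s. \<bar>s\<bar> \<le> R \<Longrightarrow> \<bar>\<beta> s\<bar> \<le> M" and t: "\<bar>t\<bar> \<le> R"
    for k t M R
    using t
  proof (induction k arbitrary: t)
    case 0
    then show ?case using c by (simp add: F0 G0)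
  next
    case (Suc k)
    have Mnn: "M \<ge> 0" using M(1)[OF Suc.prems] by linarith
    have eq: "M * (c * M ^ k / fact k) * \<bar>t\<bar> ^ Suc k / real (Suc k)
        = c * M ^ Suc k / fact (Suc k) * \<bar>t\<bar> ^ Suc k"
      by (simp add: field_simps del: power_Suc) simp
    have 1: "\<bar>\<alpha> s * G k s\<bar> \<le> M * (c * M ^ k / fact k) * \<bar>s\<bar> ^ k" if "\<bar>s\<bar> \<le> R" for s
      using mult_mono[OF M(1)[OF that] conjunct2[OF Suc.IH[OF that]]] Mnn by (simp add: abs_mult mult.assoc)
    have 2: "\<bar>\<beta> s * F k s\<bar> \<le> M * (c * M ^ k / fact k) * \<bar>s\<bar> ^ k" if "\<bar>s\<bar> \<le> R" for s
      using mult_mono[OF M(2)[OF that] conjunct1[OF Suc.IH[OF that]]] Mnn by (simp add: abs_mult mult.assoc)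
    show ?case
      using abs_le_of_deriv_abs_le_power[OF dF z(1) 1 Suc.prems]
        abs_le_of_deriv_abs_le_power[OF dG z(2) 2 Suc.prems]
      unfolding eq by blast
  qed
  define f where "f t = (\<Sum>k. F k t)" for t
  define g where "g t = (\<Sum>k. G k t)" for t
  have deriv: "(f has_real_derivative \<alpha> t * g t) (at t) \<and> (g has_real_derivative \<beta> t * f t) (at t)" for t
  proof -
    define R where "R = \<bar>t\<bar> + 1"
    have "bounded ((\<lambda>s. (\<alpha> s, \<beta> s)) ` {-R..R})"
      by (intro compact_imp_bounded compact_continuous_image compact_Icc continuous_on_Pair
          continuous_on_subset[OF \<alpha>] continuous_on_subset[OF \<beta>]) auto
    then obtain M where M0: "\<And>s. s \<in> {-R..R} \<Longrightarrow> norm (\<alpha> s, \<beta> s) \<le> M"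
      unfolding bounded_iff by blast
    have M: "\<bar>\<alpha> s\<bar> \<le> M" "\<bar>\<beta> s\<bar> \<le> M" if "\<bar>s\<bar> \<le> R" for s
      using M0[of s] that norm_fst_le[of "\<alpha> s" "\<beta> s"] norm_snd_le[of "\<beta> s" "\<alpha> s"] by (auto simp: abs_le_iff)
    define B where "B k = c * (M * R) ^ k / fact k" for k
    have Mnn: "M \<ge> 0" using M(1)[of 0] by (simp add: R_def) 
    have B: "\<bar>F k s\<bar> \<le> B k" "\<bar>G k s\<bar> \<le> B k" if s: "\<bar>s\<bar> \<le> R" for k s
    proof -
      have "c * M ^ k / fact k * \<bar>s\<bar> ^ k \<le> c * M ^ k / fact k * R ^ k"
        using s c Mnn by (intro mult_left_mono power_mono) auto
      then show "\<bar>F k s\<bar> \<le> B k" "\<bar>G k s\<bar> \<le> B k"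
        using bound[OF M s, of k] by (auto simp: B_def power_mult_distrib)
    qed
    have sB: "summable B"
      unfolding B_def using summable_mult[OF summable_exp_generic[of "M * R"], of c]
      by (simp add: divide_inverse mult_ac)
    \<comment> \<open>Termwise derivatives. The constant term has derivative 0 and term
      \<open>Suc j\<close> differentiates to the other series at j, so splitting off the head turns
      the derivative series into \<alpha> times g and \<beta> times f.\<close>
    define F' where "F' k s = (case k of 0 \<Rightarrow> 0 | Suc j \<Rightarrow> \<alpha> s * G j s)" for k s
    define G' where "G' k s = (case k of 0 \<Rightarrow> 0 | Suc j \<Rightarrow> \<beta> s * F j s)" for k s
    define B' where "B' k = (case k of 0 \<Rightarrow> 0 | Suc j \<Rightarrow> M * B j)" for k
    have "summable (\<lambda>k. B' (Suc k))" unfolding B'_def using summable_mult[OF sB] by simp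
    then have sB': "summable B'" by (simp only: summable_Suc_iff)
    have d: "(F k has_field_derivative F' k s) (at s within {-R..R})"
      "(G k has_field_derivative G' k s) (at s within {-R..R})" for k s
      by (cases k; auto simp: F'_def G'_def F0 G0 intro: DERIV_subset[OF dF] DERIV_subset[OF dG])+
    have bd: "norm (F' k s) \<le> B' k" "norm (G' k s) \<le> B' k" if "s \<in> {-R..R}" for k s
    proof -
      have s: "\<bar>s\<bar> \<le> R" using that by auto
      show "norm (F' k s) \<le> B' k" "norm (G' k s) \<le> B' k"
        using mult_mono[OF M(1)[OF s] B(2)[OF s]] mult_mono[OF M(2)[OF s] B(1)[OF s]] Mnn
        by (auto simp: F'_def G'_def B'_def abs_mult split: nat.split)
    qed
    have sF: "summable (\<lambda>k. F k s)" "summable (\<lambda>k. G k s)" if "\<bar>s\<bar> \<le> R" for s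
      by (rule summable_comparison_test'[OF sB, of 0]; use B[OF that] in simp)+
    have t: "t \<in> interior {-R..R}" and 0: "0 \<in> {-R..R}" by (auto simp: R_def)
    have "(f has_field_derivative (\<Sum>k. F' k t)) (at t)"
      unfolding f_def
      by (rule has_field_derivative_series'(2)[OF _ d(1) Weierstrass_m_test'[OF bd(1) sB'] 0 sF(1) t])
        (auto simp: R_def)
    moreover have "(g has_field_derivative (\<Sum>k. G' k t)) (at t)"
      unfolding g_def
      by (rule has_field_derivative_series'(2)[OF _ d(2) Weierstrass_m_test'[OF bd(2) sB'] 0 sF(2) t])
        (auto simp: R_def)
    moreover have tR: "\<bar>t\<bar> \<le> R" by (simp add: R_def)
    have "(\<Sum>k. F' k t) = (\<Sum>k. F' (Suc k) t)"
    proof -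
      have "summable (\<lambda>k. F' k t)"
        by (rule summable_comparison_test'[OF sB', of 0]) (use bd(1)[of t] tR in \<open>simp add: abs_le_iff\<close>)
      from suminf_split_head[OF this] show ?thesis by (simp add: F'_def)
    qed
    then have "(\<Sum>k. F' k t) = \<alpha> t * g t"
      using suminf_mult[OF sF(2)[OF tR]] by (simp add: F'_def g_def)
    moreover have "(\<Sum>k. G' k t) = (\<Sum>k. G' (Suc k) t)"
    proof -
      have "summable (\<lambda>k. G' k t)"
        by (rule summable_comparison_test'[OF sB', of 0]) (use bd(2)[of t] tR in \<open>simp add: abs_le_iff\<close>)
      from suminf_split_head[OF this] show ?thesis by (simp add: G'_def)
    qed
    then have "(\<Sum>k. G' k t) = \<beta> t * f t"
      using suminf_mult[OF sF(1)[OF tR]] by (simp add: G'_def f_def)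
    ultimately show ?thesis by simp
  qed
  have "F k 0 = 0" "G k 0 = 0" if "k \<notin> {0}" for k
    using that z by (cases k; simp)+
  then have "f 0 = F 0 0" "g 0 = G 0 0"
    unfolding f_def g_def by (subst suminf_finite[of "{0}"]; simp)+
  then show ?thesis using deriv F0 G0 by auto
qed

section \<open>Gronwall inequalities\<close>

lemma gronwall_forward:
  fixes \<Phi> \<Phi>' :: "real \<Rightarrow> real"
  assumes d: "\<And>t. 0 \<le> t \<Longrightarrow> t \<le> T \<Longrightarrow> (\<Phi> has_real_derivative \<Phi>' t) (at t)"
    and le: "\<And>t. 0 \<le> t \<Longrightarrow> t \<le> T \<Longrightarrow> \<Phi>' t \<le> C * \<Phi> t + B"
    and "0 \<le> C" "0 \<le> B" "0 \<le> T"
  shows "\<Phi> T \<le> exp (C * T) * (\<Phi> 0 + B * T)"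
proof -
  have "exp (- C * T) * \<Phi> T - B * T \<le> exp (- C * 0) * \<Phi> 0 - B * 0"
  proof (rule DERIV_nonpos_imp_nonincreasing[OF \<open>0 \<le> T\<close>])
    fix t assume t: "0 \<le> t" "t \<le> T"
    have deriv: "((\<lambda>t. exp (- C * t) * \<Phi> t - B * t) has_real_derivative
        exp (- C * t) * (\<Phi>' t - C * \<Phi> t) - B) (at t)"
      by (rule derivative_eq_intros d t refl | simp add: algebra_simps)+
    have "exp (- C * t) * (\<Phi>' t - C * \<Phi> t) \<le> exp (- C * t) * B"
      using le[OF t] by (intro mult_left_mono) auto
    moreover have "exp (- C * t) * B \<le> 1 * B"
      using assms(3,4) t by (intro mult_right_mono) auto
    ultimately have "exp (- C * t) * (\<Phi>' t - C * \<Phi> t) - B \<le> 0" by (simp only: mult_1)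
    with deriv show "\<exists>y. ((\<lambda>t. exp (- C * t) * \<Phi> t - B * t) has_real_derivative y) (at t) \<and> y \<le> 0"
      by blast
  qed
  then have "exp (C * T) * (exp (- C * T) * \<Phi> T) \<le> exp (C * T) * (\<Phi> 0 + B * T)"
    by (intro mult_left_mono) auto
  then show ?thesis by (simp add: mult.assoc[symmetric] flip: exp_add)
qed

lemma gronwall_backward:
  fixes \<Phi> \<Phi>' :: "real \<Rightarrow> real"
  assumes d: "\<And>t. 0 \<le> t \<Longrightarrow> t \<le> T \<Longrightarrow> (\<Phi> has_real_derivative \<Phi>' t) (at t)"
    and le: "\<And>t. 0 \<le> t \<Longrightarrow> t \<le> T \<Longrightarrow> - C * \<Phi> t \<le> \<Phi>' t" and "0 \<le> T"
  shows "\<Phi> 0 \<le> exp (C * T) * \<Phi> T"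
proof -
  have "exp (C * 0) * \<Phi> 0 \<le> exp (C * T) * \<Phi> T"
  proof (rule DERIV_nonneg_imp_nondecreasing[OF \<open>0 \<le> T\<close>])
    fix t assume t: "0 \<le> t" "t \<le> T"
    have "((\<lambda>t. exp (C * t) * \<Phi> t) has_real_derivative exp (C * t) * (\<Phi>' t + C * \<Phi> t)) (at t)"
      by (rule derivative_eq_intros d t refl | simp add: algebra_simps)+
    moreover have "0 \<le> exp (C * t) * (\<Phi>' t + C * \<Phi> t)"
      using le[OF t] by simp
    ultimately show "\<exists>y. ((\<lambda>t. exp (C * t) * \<Phi> t) has_real_derivative y) (at t) \<and> 0 \<le> y"
      by blast
  qed
  then show ?thesis by simp
qed

lemma two_mult_le_sum_squares: "2 * \<bar>x * y\<bar> \<le> x\<^sup>2 + y\<^sup>2" for x y :: real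
  using sum_squares_bound[of "\<bar>x\<bar>" "\<bar>y\<bar>"] by (simp add: abs_mult)

lemma increment_le:
  fixes f h :: "real \<Rightarrow> real"
  assumes "a \<le> b"
    and "\<And>t. a \<le> t \<Longrightarrow> t \<le> b \<Longrightarrow> (f has_real_derivative f' t) (at t)"
    and "\<And>t. a \<le> t \<Longrightarrow> t \<le> b \<Longrightarrow> (h has_real_derivative h' t) (at t)"
    and "\<And>t. a \<le> t \<Longrightarrow> t \<le> b \<Longrightarrow> f' t \<le> h' t"
  shows "f b - f a \<le> h b - h a"
proof -
  have "h a - f a \<le> h b - f b"
  proof (rule DERIV_nonneg_imp_nondecreasing[OF \<open>a \<le> b\<close>])
    fix t assume t: "a \<le> t" "t \<le> b"
    show "\<exists>y. ((\<lambda>t. h t - f t) has_real_derivative y) (at t) \<and> 0 \<le> y"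
      by (rule exI[of _ "h' t - f' t"]) (use DERIV_diff[OF assms(3)[OF t] assms(2)[OF t]] assms(4)[OF t] in simp)
  qed
  then show ?thesis by simp
qed

text \<open>The equation \<open>(f' / \<alpha>)' = (q - \<kappa>) * w * f\<close>. The second
  unknown g is the flux \<open>f' / \<alpha>\<close>, so the system makes sense for merely
  continuous coefficients. Evenness splits the solutions into even ones, with data (1, 0) at 0, and
  odd ones, with data (0, 1), which reduces everything to \<open>[0, T]\<close>.\<close>

locale even_sturm_liouville =
  fixes \<alpha> w q :: "real \<Rightarrow> real"
  assumes cont: "continuous_on UNIV \<alpha>" "continuous_on UNIV w" "continuous_on UNIV q"
    and alpha_pos: "\<And>t. 0 < \<alpha> t" and w_pos: "\<And>t. 0 < w t" and q_nonneg: "\<And>t. 0 \<le> q t"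
    and even: "\<And>t. \<alpha> (- t) = \<alpha> t" "\<And>t. w (- t) = w t" "\<And>t. q (- t) = q t"
begin

definition is_sol :: "real \<Rightarrow> (real \<Rightarrow> real) \<Rightarrow> (real \<Rightarrow> real) \<Rightarrow> bool" where
  "is_sol \<kappa> f g \<longleftrightarrow> (\<forall>t. (f has_real_derivative \<alpha> t * g t) (at t)) \<and>
     (\<forall>t. (g has_real_derivative (q t - \<kappa>) * w t * f t) (at t))"

lemma is_solD:
  assumes "is_sol \<kappa> f g"
  shows "(f has_real_derivative \<alpha> t * g t) (at t)"
    and "(g has_real_derivative (q t - \<kappa>) * w t * f t) (at t)"
    and "isCont f t" and "isCont g t" and "continuous_on A f" and "continuous_on A g"
proof -
  show "(f has_real_derivative \<alpha> t * g t) (at t)" for t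
    using assms by (auto simp: is_sol_def)
  then show "isCont f t" "continuous_on A f" for t
    by (meson DERIV_isCont continuous_at_imp_continuous_on)+
  show "(g has_real_derivative (q t - \<kappa>) * w t * f t) (at t)" for t
    using assms by (auto simp: is_sol_def)
  then show "isCont g t" "continuous_on A g" for t
    by (meson DERIV_isCont continuous_at_imp_continuous_on)+
qed

lemma ex_sol: "\<exists>f g. f 0 = a \<and> g 0 = b \<and> is_sol \<kappa> f g"
proof -
  have "continuous_on UNIV (\<lambda>t. (q t - \<kappa>) * w t)" by (intro continuous_intros cont)
  from ex_linear_system_solution[OF cont(1) this] show ?thesis unfolding is_sol_def by blast
qed

lemma bounded_on_interval:
  fixes h :: "real \<Rightarrow> real"
  assumes "continuous_on UNIV h"
  obtains M where "M > 0" "\<And>t. 0 \<le> t \<Longrightarrow> t \<le> T \<Longrightarrow> \<bar>h t\<bar> \<le> M"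
proof -
  have "bounded (h ` {0..T})"
    by (intro compact_imp_bounded compact_continuous_image compact_Icc continuous_on_subset[OF assms]) auto
  then obtain M where "M > 0" "\<forall>x\<in>h ` {0..T}. norm x \<le> M"
    unfolding bounded_pos by blast
  then show ?thesis by (intro that[of M]) auto
qed

text \<open>The derivative of \<open>f\<^sup>2 + g\<^sup>2\<close> is bounded by a constant times
  \<open>f\<^sup>2 + g\<^sup>2\<close>. Forward in t this gives uniqueness for given data at 0;
  backward it forbids a double zero of a nontrivial solution.\<close>

lemma sol_zero:
  assumes sol: "is_sol \<kappa> f g"
  shows sol_zero_backward: "0 \<le> T \<Longrightarrow> f T = 0 \<Longrightarrow> g T = 0 \<Longrightarrow> f 0 = 0 \<and> g 0 = 0"
    and sol_zero_forward: "0 \<le> T \<Longrightarrow> f 0 = 0 \<Longrightarrow> g 0 = 0 \<Longrightarrow> f T = 0 \<and> g T = 0"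
proof -
  have "continuous_on UNIV (\<lambda>t. \<alpha> t + (q t - \<kappa>) * w t)" by (intro continuous_intros cont)
  then obtain C where C: "C > 0" "\<And>t. 0 \<le> t \<Longrightarrow> t \<le> T \<Longrightarrow> \<bar>\<alpha> t + (q t - \<kappa>) * w t\<bar> \<le> C"
    by (rule bounded_on_interval[where T = T]) blast
  let ?\<Phi> = "\<lambda>t. (f t)\<^sup>2 + (g t)\<^sup>2"
  let ?\<Phi>' = "\<lambda>t. 2 * (f t * g t) * (\<alpha> t + (q t - \<kappa>) * w t)"
  have d: "(?\<Phi> has_real_derivative ?\<Phi>' t) (at t)" for t
    by (rule derivative_eq_intros is_solD[OF sol] refl | simp add: algebra_simps)+
  have b: "\<bar>?\<Phi>' t\<bar> \<le> C * ?\<Phi> t" if "0 \<le> t" "t \<le> T" for t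
    using mult_mono[OF two_mult_le_sum_squares[of "f t" "g t"] C(2)[OF that]]
    by (simp add: abs_mult mult.commute)
  have b1: "?\<Phi>' t \<le> C * ?\<Phi> t + 0" "- C * ?\<Phi> t \<le> ?\<Phi>' t" if "0 \<le> t" "t \<le> T" for t
    using b[OF that] by (auto simp: abs_le_iff)
  show "f 0 = 0 \<and> g 0 = 0" if "0 \<le> T" "f T = 0" "g T = 0"
  proof -
    have "?\<Phi> 0 \<le> exp (C * T) * ?\<Phi> T" by (rule gronwall_backward[OF d b1(2) that(1)])
    then have "?\<Phi> 0 \<le> 0" using that by simp
    then show ?thesis by (simp only: sum_power2_le_zero_iff)
  qed
  show "f T = 0 \<and> g T = 0" if "0 \<le> T" "f 0 = 0" "g 0 = 0"
  proof -
    have "?\<Phi> T \<le> exp (C * T) * (?\<Phi> 0 + 0 * T)"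
      by (rule gronwall_forward[OF d b1(1) _ _ that(1)]) (use C in auto)
    then have "?\<Phi> T \<le> 0" using that by simp
    then show ?thesis by (simp only: sum_power2_le_zero_iff)
  qed
qed

lemma is_sol_reflect:
  assumes "is_sol \<kappa> f g"
  shows "is_sol \<kappa> (\<lambda>t. s * f (- t)) (\<lambda>t. - s * g (- t))"
proof -
  have m: "(uminus has_real_derivative - 1) (at t)" for t :: real
    by (auto intro!: derivative_eq_intros)
  have "((\<lambda>t. f (- t)) has_real_derivative - 1 * (\<alpha> (- t) * g (- t))) (at t)"
    "((\<lambda>t. g (- t)) has_real_derivative - 1 * ((q (- t) - \<kappa>) * w (- t) * f (- t))) (at t)" for t
    using DERIV_chain'[OF m is_solD(1)[OF assms]] DERIV_chain'[OF m is_solD(2)[OF assms]]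
    by (simp_all add: mult.commute)
  from DERIV_cmult[OF this(1), of s] DERIV_cmult[OF this(2), of "- s"] show ?thesis
    by (simp add: is_sol_def even algebra_simps)
qed

lemma is_sol_diff:
  assumes "is_sol \<kappa> f g" "is_sol \<kappa> f' g'"
  shows "is_sol \<kappa> (\<lambda>t. f t - f' t) (\<lambda>t. g t - g' t)"
  using DERIV_diff[OF is_solD(1)[OF assms(1)] is_solD(1)[OF assms(2)]]
    DERIV_diff[OF is_solD(2)[OF assms(1)] is_solD(2)[OF assms(2)]]
  by (simp add: is_sol_def algebra_simps)

text \<open>The sign s is 1 for even data and -1 for odd data; the reflected solution then has the
  same data at 0 and coincides with f by uniqueness.\<close>

lemma sol_parity:
  assumes sol: "is_sol \<kappa> f g" and init: "s * f 0 = f 0" "- s * g 0 = g 0" and s: "s * s = 1"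
  shows "f (- t) = s * f t"
proof -
  have *: "s * f (- t) = f t" if "0 \<le> t" for t
    using sol_zero_forward[OF is_sol_diff[OF is_sol_reflect[OF sol, of s] sol] that] init
    by auto
  show ?thesis
  proof (cases "0 \<le> t")
    case True
    have "f (- t) = (s * s) * f (- t)" by (simp add: s)
    also have "\<dots> = s * f t" using *[OF True] by (simp add: mult.assoc)
    finally show ?thesis .
  next
    case False
    then show ?thesis using *[of "- t"] by simp
  qed
qed

text \<open>Continuous dependence on the parameter: the difference of two solutions has data 0 and
  solves the same system up to the forcing
  \<open>(\<kappa>\<^sub>0 - \<kappa>) * w * f \<kappa>\<^sub>0\<close>, so Gronwall bounds its
  energy by a multiple of \<open>\<eta>\<^sup>2\<close>.\<close>

lemma sol_close:
  assumes sol: "\<And>\<kappa>. is_sol \<kappa> (f \<kappa>) (g \<kappa>)" and init: "\<And>\<kappa>. f \<kappa> 0 = a" "\<And>\<kappa>. g \<kappa> 0 = b" and e: "e > 0"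
  obtains \<eta> where "\<eta> > 0" "\<And>\<kappa> t. \<bar>\<kappa> - \<kappa>\<^sub>0\<bar> < \<eta> \<Longrightarrow> 0 \<le> t \<Longrightarrow> t \<le> T \<Longrightarrow> \<bar>f \<kappa> t - f \<kappa>\<^sub>0 t\<bar> < e"
    "\<And>\<kappa> t. \<bar>\<kappa> - \<kappa>\<^sub>0\<bar> < \<eta> \<Longrightarrow> 0 \<le> t \<Longrightarrow> t \<le> T \<Longrightarrow> \<bar>g \<kappa> t - g \<kappa>\<^sub>0 t\<bar> < e"
proof -
  \<comment> \<open>The last summand absorbs
    \<open>\<bar>\<kappa> - \<kappa>\<^sub>0\<bar> \<le> 1\<close>, so that one C serves all
    parameters in question; this is why \<eta> is capped at 1.\<close>
  have "continuous_on UNIV (\<lambda>t. \<alpha> t + \<bar>q t - \<kappa>\<^sub>0\<bar> * w t + w t)" by (intro continuous_intros cont)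
  then obtain C where C: "C > 0" "\<And>t. 0 \<le> t \<Longrightarrow> t \<le> T \<Longrightarrow> \<bar>\<alpha> t + \<bar>q t - \<kappa>\<^sub>0\<bar> * w t + w t\<bar> \<le> C"
    by (rule bounded_on_interval[where T = T]) blast
  have "continuous_on UNIV (\<lambda>t. w t * f \<kappa>\<^sub>0 t)" by (intro continuous_intros cont is_solD[OF sol])
  then obtain M where M: "M > 0" "\<And>t. 0 \<le> t \<Longrightarrow> t \<le> T \<Longrightarrow> \<bar>w t * f \<kappa>\<^sub>0 t\<bar> \<le> M"
    by (rule bounded_on_interval[where T = T]) blast
  \<comment> \<open>Gronwall bounds the energy of the difference by
    \<open>\<eta>\<^sup>2 * Z\<close>, so \<eta> has to satisfy
    \<open>\<eta> * sqrt Z < e\<close>.\<close>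
  define Z where "Z = exp ((C + 1) * T) * M\<^sup>2 * \<bar>T\<bar>"
  have Z: "Z \<ge> 0" by (simp add: Z_def)
  define \<eta> where "\<eta> = min 1 (e / (sqrt Z + 1))"
  have sZ: "sqrt Z + 1 > 0" using Z by (simp add: add_nonneg_pos)
  have \<eta>: "\<eta> > 0" "\<eta> \<le> 1" using e sZ by (auto simp: \<eta>_def)
  have "\<eta> * sqrt Z < e"
  proof -
    have "\<eta> * sqrt Z < \<eta> * (sqrt Z + 1)" using \<eta> by simp
    also have "\<dots> \<le> e / (sqrt Z + 1) * (sqrt Z + 1)"
      using sZ by (intro mult_right_mono) (auto simp: \<eta>_def)
    also have "\<dots> = e" using sZ by simp
    finally show ?thesis .
  qed
  then have "(\<eta> * sqrt Z)\<^sup>2 < e\<^sup>2" using \<eta> Z by (intro power_strict_mono) auto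
  then have \<eta>Z: "\<eta>\<^sup>2 * Z < e\<^sup>2" using Z by (simp add: power_mult_distrib)
  have main: "(f \<kappa> t - f \<kappa>\<^sub>0 t)\<^sup>2 + (g \<kappa> t - g \<kappa>\<^sub>0 t)\<^sup>2 < e\<^sup>2"
    if l: "\<bar>\<kappa> - \<kappa>\<^sub>0\<bar> < \<eta>" and t: "0 \<le> t" "t \<le> T" for \<kappa> t
  proof -
    let ?F = "\<lambda>s. f \<kappa> s - f \<kappa>\<^sub>0 s" and ?G = "\<lambda>s. g \<kappa> s - g \<kappa>\<^sub>0 s"
    let ?\<Phi> = "\<lambda>s. (?F s)\<^sup>2 + (?G s)\<^sup>2"
    let ?\<Phi>' = "\<lambda>s. 2 * (?F s * ?G s) * (\<alpha> s + (q s - \<kappa>) * w s) + 2 * (?G s * ((\<kappa>\<^sub>0 - \<kappa>) * (w s * f \<kappa>\<^sub>0 s)))"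
    have d: "(?\<Phi> has_real_derivative ?\<Phi>' s) (at s)" for s
      by (rule derivative_eq_intros is_solD[OF sol] refl | simp add: algebra_simps)+
    have b: "?\<Phi>' s \<le> (C + 1) * ?\<Phi> s + \<eta>\<^sup>2 * M\<^sup>2" if s: "0 \<le> s" "s \<le> t" for s
    proof -
      have sT: "s \<le> T" using s t by simp
      have "\<bar>(q s - \<kappa>) * w s\<bar> \<le> \<bar>q s - \<kappa>\<^sub>0\<bar> * w s + w s"
      proof -
        have "\<bar>(q s - \<kappa>) * w s\<bar> = \<bar>q s - \<kappa>\<bar> * w s" using w_pos[of s] by (simp add: abs_mult)
        also have "\<dots> \<le> (\<bar>q s - \<kappa>\<^sub>0\<bar> + 1) * w s"
          using l \<eta> w_pos[of s] by (intro mult_right_mono) auto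
        finally show ?thesis by (simp add: algebra_simps)
      qed
      then have "\<bar>\<alpha> s + (q s - \<kappa>) * w s\<bar> \<le> C" using C(2)[OF s(1) sT] alpha_pos[of s] by linarith
      then have "2 * \<bar>?F s * ?G s\<bar> * \<bar>\<alpha> s + (q s - \<kappa>) * w s\<bar> \<le> ?\<Phi> s * C"
        by (intro mult_mono two_mult_le_sum_squares) auto
      moreover have "2 * (?F s * ?G s) * (\<alpha> s + (q s - \<kappa>) * w s)
          \<le> 2 * \<bar>?F s * ?G s\<bar> * \<bar>\<alpha> s + (q s - \<kappa>) * w s\<bar>"
        by (simp add: abs_mult[symmetric] mult.assoc)
      ultimately have 1: "2 * (?F s * ?G s) * (\<alpha> s + (q s - \<kappa>) * w s) \<le> ?\<Phi> s * C" by simp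
      have "\<bar>(\<kappa>\<^sub>0 - \<kappa>) * (w s * f \<kappa>\<^sub>0 s)\<bar> \<le> \<eta> * M"
        using M(2)[OF s(1) sT] l \<eta> M(1) unfolding abs_mult[of "\<kappa>\<^sub>0 - \<kappa>"] by (intro mult_mono) auto
      then have "((\<kappa>\<^sub>0 - \<kappa>) * (w s * f \<kappa>\<^sub>0 s))\<^sup>2 \<le> (\<eta> * M)\<^sup>2" by (rule power2_le_iff_abs_le[THEN iffD2, rotated]) (use \<eta> M in auto)
      then have "2 * (?G s * ((\<kappa>\<^sub>0 - \<kappa>) * (w s * f \<kappa>\<^sub>0 s))) \<le> (?G s)\<^sup>2 + \<eta>\<^sup>2 * M\<^sup>2"
        using sum_squares_bound[of "?G s" "(\<kappa>\<^sub>0 - \<kappa>) * (w s * f \<kappa>\<^sub>0 s)"]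
        by (simp only: power_mult_distrib mult.assoc)
      from add_mono[OF 1 this] have "?\<Phi>' s \<le> ?\<Phi> s * C + ((?G s)\<^sup>2 + \<eta>\<^sup>2 * M\<^sup>2)" .
      also have "\<dots> \<le> ?\<Phi> s * C + (?\<Phi> s + \<eta>\<^sup>2 * M\<^sup>2)" by simp
      also have "\<dots> = (C + 1) * ?\<Phi> s + \<eta>\<^sup>2 * M\<^sup>2" by (simp only: distrib_right mult.commute[of C] mult_1 add.assoc)
      finally show ?thesis .
    qed
    have "?\<Phi> t \<le> exp ((C + 1) * t) * (?\<Phi> 0 + \<eta>\<^sup>2 * M\<^sup>2 * t)"
      by (rule gronwall_forward[OF d b]) (use C t in auto)
    also have "\<dots> = exp ((C + 1) * t) * (\<eta>\<^sup>2 * M\<^sup>2 * t)" using init by simp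
    also have "\<dots> \<le> exp ((C + 1) * T) * (\<eta>\<^sup>2 * M\<^sup>2 * T)"
      using t C by (intro mult_mono) auto
    also have "\<dots> = \<eta>\<^sup>2 * Z" using t by (simp add: Z_def)
    finally show ?thesis using \<eta>Z by simp
  qed
  show ?thesis
  proof (rule that[of \<eta>])
    fix \<kappa> t assume "\<bar>\<kappa> - \<kappa>\<^sub>0\<bar> < \<eta>" "0 \<le> t" "t \<le> T"
    from main[OF this] have "(f \<kappa> t - f \<kappa>\<^sub>0 t)\<^sup>2 < e\<^sup>2" "(g \<kappa> t - g \<kappa>\<^sub>0 t)\<^sup>2 < e\<^sup>2"
      using zero_le_power2[of "f \<kappa> t - f \<kappa>\<^sub>0 t"] zero_le_power2[of "g \<kappa> t - g \<kappa>\<^sub>0 t"] by linarith+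
    then show "\<bar>f \<kappa> t - f \<kappa>\<^sub>0 t\<bar> < e" "\<bar>g \<kappa> t - g \<kappa>\<^sub>0 t\<bar> < e"
      using e power_less_imp_less_base[of "\<bar>f \<kappa> t - f \<kappa>\<^sub>0 t\<bar>" 2 e]
        power_less_imp_less_base[of "\<bar>g \<kappa> t - g \<kappa>\<^sub>0 t\<bar>" 2 e] by simp_all
  qed (rule \<eta>)
qed

section \<open>Shooting in the spectral parameter\<close>

definition sol_family :: "real \<Rightarrow> real \<Rightarrow> (real \<Rightarrow> real \<Rightarrow> real) \<Rightarrow> (real \<Rightarrow> real \<Rightarrow> real) \<Rightarrow> bool" where
  "sol_family a b f g \<longleftrightarrow> (\<forall>\<kappa>. is_sol \<kappa> (f \<kappa>) (g \<kappa>) \<and> f \<kappa> 0 = a \<and> g \<kappa> 0 = b)"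

lemma ex_sol_family: "\<exists>f g. sol_family a b f g"
proof -
  have "\<forall>\<kappa>. \<exists>p. is_sol \<kappa> (fst p) (snd p) \<and> fst p 0 = a \<and> snd p 0 = b"
    using ex_sol[of a b] by force
  then obtain p where "\<And>\<kappa>. is_sol \<kappa> (fst (p \<kappa>)) (snd (p \<kappa>)) \<and> fst (p \<kappa>) 0 = a \<and> snd (p \<kappa>) 0 = b"
    by metis
  then show ?thesis unfolding sol_family_def
    by (intro exI[of _ "\<lambda>\<kappa>. fst (p \<kappa>)"] exI[of _ "\<lambda>\<kappa>. snd (p \<kappa>)"]) blast
qed

text \<open>Odd solutions vanish at 0, so closeness of values gives no sign there; positivity comes
  from the flux, which starts at 1, through \<open>f' = \<alpha> * g\<close>. Uniformity in \<kappa>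
  keeps zeros from escaping into 0 when the parameter varies.\<close>

lemma pos_near_0:
  assumes fam: "sol_family a b f g" and init: "a = 1 \<and> b = 0 \<or> a = 0 \<and> b = 1"
  obtains s \<eta> where "s > 0" "\<eta> > 0"
    "\<And>\<kappa> t. \<bar>\<kappa> - \<kappa>\<^sub>0\<bar> < \<eta> \<Longrightarrow> 0 < t \<Longrightarrow> t \<le> s \<Longrightarrow> 0 < f \<kappa> t"
proof -
  have sol: "is_sol \<kappa> (f \<kappa>) (g \<kappa>)" and 0: "f \<kappa> 0 = a" "g \<kappa> 0 = b" for \<kappa>
    using fam by (auto simp: sol_family_def)
  have near: "\<exists>s>0. \<forall>t. 0 \<le> t \<longrightarrow> t \<le> s \<longrightarrow> 1 / 2 < h t" if "isCont h 0" "h 0 = 1" for h :: "real \<Rightarrow> real"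
  proof -
    have half: "(0 :: real) < 1 / 2" by simp
    from mp[OF spec[OF that(1)[unfolded continuous_at_eps_delta], of "1 / 2"] half]
    obtain d where d: "d > 0" "\<forall>t. dist t 0 < d \<longrightarrow> dist (h t) (h 0) < 1 / 2" by blast
    show ?thesis
    proof (intro exI[of _ "d / 2"] conjI allI impI)
      show "1 / 2 < h t" if "0 \<le> t" "t \<le> d / 2" for t
        using d(2)[rule_format, of t] d(1) that \<open>h 0 = 1\<close> by (auto simp: dist_real_def abs_if split: if_splits)
    qed (use d in auto)
  qed
  show ?thesis
  proof (cases "a = 1")
    case True
    then obtain s where s: "s > 0" "\<And>t. 0 \<le> t \<Longrightarrow> t \<le> s \<Longrightarrow> 1 / 2 < f \<kappa>\<^sub>0 t"
      using near[of "f \<kappa>\<^sub>0"] is_solD(3)[OF sol] 0 by metis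
    obtain \<eta> where \<eta>: "\<eta> > 0" "\<And>\<kappa> t. \<bar>\<kappa> - \<kappa>\<^sub>0\<bar> < \<eta> \<Longrightarrow> 0 \<le> t \<Longrightarrow> t \<le> s \<Longrightarrow> \<bar>f \<kappa> t - f \<kappa>\<^sub>0 t\<bar> < 1 / 4"
      by (rule sol_close[of f g a b "1 / 4" \<kappa>\<^sub>0 s]) (use sol 0 in auto)
    show ?thesis
    proof (rule that[of s \<eta>])
      fix \<kappa> t :: real assume "\<bar>\<kappa> - \<kappa>\<^sub>0\<bar> < \<eta>" "0 < t" "t \<le> s"
      then show "0 < f \<kappa> t" using \<eta>(2)[of \<kappa> t] s(2)[of t] by linarith
    qed (use s \<eta> in auto)
  next
    case False
    with init have ab: "a = 0" "b = 1" by auto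
    then obtain s where s: "s > 0" "\<And>t. 0 \<le> t \<Longrightarrow> t \<le> s \<Longrightarrow> 1 / 2 < g \<kappa>\<^sub>0 t"
      using near[of "g \<kappa>\<^sub>0"] is_solD(4)[OF sol] 0 by metis
    obtain \<eta> where \<eta>: "\<eta> > 0" "\<And>\<kappa> t. \<bar>\<kappa> - \<kappa>\<^sub>0\<bar> < \<eta> \<Longrightarrow> 0 \<le> t \<Longrightarrow> t \<le> s \<Longrightarrow> \<bar>g \<kappa> t - g \<kappa>\<^sub>0 t\<bar> < 1 / 4"
      by (rule sol_close[of f g a b "1 / 4" \<kappa>\<^sub>0 s]) (use sol 0 in auto)
    show ?thesis
    proof (rule that[of s \<eta>])
      fix \<kappa> t :: real assume k: "\<bar>\<kappa> - \<kappa>\<^sub>0\<bar> < \<eta>" and t: "0 < t" "t \<le> s"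
      have "f \<kappa> 0 < f \<kappa> t"
      proof (rule DERIV_pos_imp_increasing[OF t(1)])
        fix x assume "0 \<le> x" "x \<le> t"
        then have "0 < g \<kappa> x" using \<eta>(2)[OF k, of x] s(2)[of x] t by linarith
        then show "\<exists>y. (f \<kappa> has_real_derivative y) (at x) \<and> 0 < y"
          using is_solD(1)[OF sol] alpha_pos by (blast intro: mult_pos_pos)
      qed
      then show "0 < f \<kappa> t" using 0 ab by simp
    qed (use s \<eta> in auto)
  qed
qed

text \<open>\<open>(f * g)' = \<alpha> * g\<^sup>2 + (q - \<kappa>) * w * f\<^sup>2\<close> is
  nonnegative and \<open>f * g\<close> starts at 0, so \<open>f\<^sup>2\<close> is nondecreasing and
  no zero can follow the initial positivity. This bounds the shooting parameters from below by
  0.\<close>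

lemma pos_if_nonpos_parameter:
  assumes fam: "sol_family a b f g" and init: "a = 1 \<and> b = 0 \<or> a = 0 \<and> b = 1"
    and "\<kappa> \<le> 0" "0 < t"
  shows "0 < f \<kappa> t"
proof -
  have sol: "is_sol \<kappa> (f \<kappa>) (g \<kappa>)" and 0: "f \<kappa> 0 = a" "g \<kappa> 0 = b"
    using fam by (auto simp: sol_family_def)
  obtain s where s: "s > 0" "\<And>t. 0 < t \<Longrightarrow> t \<le> s \<Longrightarrow> 0 < f \<kappa> t"
    by (rule pos_near_0[OF fam init, of \<kappa>]) auto
  have fg: "0 \<le> f \<kappa> x * g \<kappa> x" if "0 \<le> x" for x
  proof -
    have "f \<kappa> 0 * g \<kappa> 0 \<le> f \<kappa> x * g \<kappa> x"
    proof (rule DERIV_nonneg_imp_nondecreasing[OF that])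
      fix y
      have "((\<lambda>x. f \<kappa> x * g \<kappa> x) has_real_derivative
          \<alpha> y * (g \<kappa> y)\<^sup>2 + (q y - \<kappa>) * w y * (f \<kappa> y)\<^sup>2) (at y)"
        by (rule derivative_eq_intros is_solD[OF sol] refl | simp add: algebra_simps power2_eq_square)+
      moreover have "0 \<le> \<alpha> y * (g \<kappa> y)\<^sup>2 + (q y - \<kappa>) * w y * (f \<kappa> y)\<^sup>2"
        using alpha_pos[of y] w_pos[of y] q_nonneg[of y] \<open>\<kappa> \<le> 0\<close> by simp
      ultimately show "\<exists>z. ((\<lambda>x. f \<kappa> x * g \<kappa> x) has_real_derivative z) (at y) \<and> 0 \<le> z" by blast
    qed
    then show ?thesis using 0 init by auto
  qed
  have mono: "(f \<kappa> x)\<^sup>2 \<le> (f \<kappa> y)\<^sup>2" if "0 \<le> x" "x \<le> y" for x y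
  proof (rule DERIV_nonneg_imp_nondecreasing[OF that(2)])
    fix z assume "x \<le> z" "z \<le> y"
    moreover have "((\<lambda>x. (f \<kappa> x)\<^sup>2) has_real_derivative 2 * \<alpha> z * (f \<kappa> z * g \<kappa> z)) (at z)"
      by (rule derivative_eq_intros is_solD[OF sol] refl | simp add: algebra_simps)+
    moreover have "0 \<le> 2 * \<alpha> z * (f \<kappa> z * g \<kappa> z)"
      using mult_nonneg_nonneg[OF _ fg[of z], of "2 * \<alpha> z"] alpha_pos[of z] that calculation(1) by auto
    ultimately show "\<exists>c. ((\<lambda>x. (f \<kappa> x)\<^sup>2) has_real_derivative c) (at z) \<and> 0 \<le> c" by blast
  qed
  have nz: "f \<kappa> x \<noteq> 0" if "0 < x" for x
    using mono[of "min x s" x] s(2)[of "min x s"] s(1) that by auto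
  show ?thesis
  proof (rule ccontr)
    assume "\<not> 0 < f \<kappa> t"
    then have "f \<kappa> t \<le> 0" "0 \<le> f \<kappa> (min t s)" "min t s \<le> t"
      using s(2)[of "min t s"] s(1) \<open>0 < t\<close> by auto
    then obtain x where "min t s \<le> x" "f \<kappa> x = 0"
      using IVT2'[of "f \<kappa>" t 0 "min t s"] is_solD(5)[OF sol] by blast
    then show False using nz[of x] s(1) \<open>0 < t\<close> by auto
  qed
qed

text \<open>\<kappa> is the infimum of the parameters whose solution is nonpositive somewhere in (0,
  T]. At the infimum the solution is nonnegative, as a limit of positive ones from below; a zero
  inside (0, T) would be a minimum, hence a double zero, so the zero sits at T. A parameter
  \<open>\<kappa>\<^sub>1\<close> with a nonpositive value, as produced by
  \<open>oscillation\<close>, bounds \<kappa> from above.\<close>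

lemma first_eigenvalue:
  assumes fam: "sol_family a b f g" and init: "a = 1 \<and> b = 0 \<or> a = 0 \<and> b = 1"
    and T: "0 < T" and star: "0 < t\<^sub>1" "t\<^sub>1 \<le> T" "f \<kappa>\<^sub>1 t\<^sub>1 \<le> 0"
  obtains \<kappa> where "0 \<le> \<kappa>" "\<kappa> \<le> \<kappa>\<^sub>1" "f \<kappa> T = 0" "\<And>t. 0 < t \<Longrightarrow> t < T \<Longrightarrow> 0 < f \<kappa> t"
    "\<And>\<kappa>' t. \<kappa>' < \<kappa> \<Longrightarrow> 0 < t \<Longrightarrow> t \<le> T \<Longrightarrow> 0 < f \<kappa>' t"
proof -
  have sol: "is_sol \<kappa> (f \<kappa>) (g \<kappa>)" and 0: "f \<kappa> 0 = a" "g \<kappa> 0 = b" for \<kappa>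
    using fam by (auto simp: sol_family_def)
  define B where "B = {\<kappa>. \<exists>t. 0 < t \<and> t \<le> T \<and> f \<kappa> t \<le> 0}"
  have star_in: "\<kappa>\<^sub>1 \<in> B" using star by (auto simp: B_def)
  have B_pos: "0 \<le> \<kappa>" if "\<kappa> \<in> B" for \<kappa>
    using that pos_if_nonpos_parameter[OF fam init, of \<kappa>] by (force simp: B_def)
  then have bdd: "bdd_below B" by (auto simp: bdd_below_def)
  define L where "L = Inf B"
  have less: "0 < f \<kappa> t" if "\<kappa> < L" "0 < t" "t \<le> T" for \<kappa> t
    using that cInf_lower[OF _ bdd, of \<kappa>] unfolding L_def B_def by force
  \<comment> \<open>The infimum is attained: were the solution at L positive on (0, T], so would be
    those for all nearby parameters, by \<open>pos_near_0\<close> close to 0 and by the positive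
    minimum at L on the rest.\<close>
  have "L \<in> B"
  proof (rule ccontr)
    assume "L \<notin> B"
    then have pos: "0 < f L t" if "0 < t" "t \<le> T" for t using that by (force simp: B_def)
    obtain s \<eta> where s: "s > 0" "\<eta> > 0"
      "\<And>\<kappa> t. \<bar>\<kappa> - L\<bar> < \<eta> \<Longrightarrow> 0 < t \<Longrightarrow> t \<le> s \<Longrightarrow> 0 < f \<kappa> t"
      by (rule pos_near_0[OF fam init, of L]) blast
    obtain x where x: "x \<in> {min s T..T}" "\<And>y. y \<in> {min s T..T} \<Longrightarrow> f L x \<le> f L y"
      using continuous_attains_inf[of "{min s T..T}" "f L"] is_solD(5)[OF sol] by auto
    then have fx: "0 < f L x" using pos[of x] s T by auto
    obtain \<eta>' where \<eta>': "\<eta>' > 0" "\<And>\<kappa> t. \<bar>\<kappa> - L\<bar> < \<eta>' \<Longrightarrow> 0 \<le> t \<Longrightarrow> t \<le> T \<Longrightarrow> \<bar>f \<kappa> t - f L t\<bar> < f L x"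
      by (rule sol_close[of f g a b "f L x" L T]) (use sol 0 fx in auto)
    have "\<kappa> \<notin> B" if "\<bar>\<kappa> - L\<bar> < min \<eta> \<eta>'" for \<kappa>
    proof
      assume "\<kappa> \<in> B"
      then obtain t where t: "0 < t" "t \<le> T" "f \<kappa> t \<le> 0" by (auto simp: B_def)
      then have "s < t" using s(3)[of \<kappa> t] that by force
      then show False using \<eta>'(2)[of \<kappa> t] x(2)[of t] t that by auto
    qed
    moreover obtain \<kappa> where "\<kappa> \<in> B" "\<kappa> < L + min \<eta> \<eta>'"
      using cInf_lessD[of B "L + min \<eta> \<eta>'"] star_in s(2) \<eta>'(1) unfolding L_def by force
    ultimately show False using cInf_lower[OF \<open>\<kappa> \<in> B\<close> bdd] unfolding L_def by force
  qed
  then obtain t\<^sub>0 where t0: "0 < t\<^sub>0" "t\<^sub>0 \<le> T" "f L t\<^sub>0 \<le> 0" by (auto simp: B_def)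
  have nonneg: "0 \<le> f L t" if "0 < t" "t \<le> T" for t
  proof (rule ccontr)
    assume n: "\<not> 0 \<le> f L t"
    obtain \<eta> where \<eta>: "\<eta> > 0" "\<And>\<kappa> s. \<bar>\<kappa> - L\<bar> < \<eta> \<Longrightarrow> 0 \<le> s \<Longrightarrow> s \<le> T \<Longrightarrow> \<bar>f \<kappa> s - f L s\<bar> < - f L t"
      by (rule sol_close[of f g a b "- f L t" L T]) (use sol 0 n in auto)
    have "\<bar>f (L - \<eta> / 2) t - f L t\<bar> < - f L t" using \<eta> that by (intro \<eta>(2)) auto
    then show False using less[of "L - \<eta> / 2" t] \<eta>(1) that by auto
  qed
  have nz: "0 < f L t" if t: "0 < t" "t < T" for t
  proof (rule ccontr)
    assume "\<not> 0 < f L t"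
    then have ft: "f L t = 0" using nonneg[of t] t by auto
    have "\<alpha> t * g L t = 0"
    proof (rule DERIV_local_min[OF is_solD(1)[OF sol]])
      show "0 < min t (T - t)" using t by simp
      show "\<forall>y. \<bar>t - y\<bar> < min t (T - t) \<longrightarrow> f L t \<le> f L y"
        using nonneg ft by (auto simp: abs_if split: if_splits)
    qed
    then have "g L t = 0" using alpha_pos[of t] by simp
    then show False using sol_zero_backward[OF sol _ ft] t 0 init by auto
  qed
  have "f L T = 0" using t0 nz[of t\<^sub>0] nonneg[of T] T by (cases "t\<^sub>0 = T") auto
  then show ?thesis
    using that[of L] B_pos[OF \<open>L \<in> B\<close>] cInf_lower[OF star_in bdd] nz less unfolding L_def by auto
qed

text \<open>Riccati: \<open>r = g / f\<close> satisfies \<open>r' \<le> - N - A r\<^sup>2\<close>, so \<open>arctan (r \<surd>(A / N))\<close> loses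
  \<open>\<pi>\<close> on every interval of length \<open>\<pi> / \<surd>(A N)\<close>.\<close>

lemma oscillation:
  assumes sol: "is_sol \<kappa> f g" and ab: "a < b" and A: "A > 0" and N: "N > 0"
    and alpha_ge: "\<And>t. a \<le> t \<Longrightarrow> t \<le> b \<Longrightarrow> A \<le> \<alpha> t"
    and le: "\<And>t. a \<le> t \<Longrightarrow> t \<le> b \<Longrightarrow> (q t - \<kappa>) * w t \<le> - N"
    and long: "pi \<le> sqrt (A * N) * (b - a)"
  shows "\<exists>t. a \<le> t \<and> t \<le> b \<and> f t \<le> 0"
proof (rule ccontr)
  assume "\<not> ?thesis"
  then have pos: "0 < f t" if "a \<le> t" "t \<le> b" for t using that by force
  define c where "c = sqrt (A / N)"
  have "0 < A / N" using A N by (rule divide_pos_pos)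
  then have c: "c > 0" "c\<^sup>2 = A / N" unfolding c_def by (rule real_sqrt_gt_zero, intro real_sqrt_pow2 less_imp_le)
  have "c * N = sqrt (A / N * N\<^sup>2)" using N by (simp only: c_def real_sqrt_mult real_sqrt_abs abs_of_pos)
  also have "A / N * N\<^sup>2 = A * N" using N by (simp add: power2_eq_square)
  finally have cN: "c * N = sqrt (A * N)" .
  let ?\<theta> = "\<lambda>t. arctan (c * (g t / f t)) + sqrt (A * N) * t"
  have "?\<theta> b \<le> ?\<theta> a"
  proof (rule DERIV_nonpos_imp_nonincreasing[of a b ?\<theta>])
    fix t assume t: "a \<le> t" "t \<le> b"
    define r where "r = g t / f t"
    have f: "0 < f t" using pos t by blast
    have d: "(?\<theta> has_real_derivative c * ((q t - \<kappa>) * w t - \<alpha> t * r\<^sup>2) / (1 + (c * r)\<^sup>2) + sqrt (A * N)) (at t)"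
      by (rule derivative_eq_intros is_solD[OF sol] refl
          | use f in \<open>simp add: r_def field_simps power2_eq_square\<close>)+
    have "(q t - \<kappa>) * w t - \<alpha> t * r\<^sup>2 \<le> - N - A * r\<^sup>2"
      using le[OF t] mult_right_mono[OF alpha_ge[OF t], of "r\<^sup>2"] by simp
    also have "\<dots> = - N * (1 + (c * r)\<^sup>2)" using N by (simp add: power_mult_distrib c field_simps)
    finally have "c * ((q t - \<kappa>) * w t - \<alpha> t * r\<^sup>2) \<le> c * (- N * (1 + (c * r)\<^sup>2))"
      using c(1) by (intro mult_left_mono) auto
    also have "\<dots> = - sqrt (A * N) * (1 + (c * r)\<^sup>2)" using cN by (simp add: algebra_simps)
    finally have "c * ((q t - \<kappa>) * w t - \<alpha> t * r\<^sup>2) / (1 + (c * r)\<^sup>2) \<le> - sqrt (A * N)"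
      by (subst pos_divide_le_eq) (auto simp: add_pos_nonneg)
    then show "\<exists>y. (?\<theta> has_real_derivative y) (at t) \<and> y \<le> 0"
      using d by (intro exI conjI) auto
  qed (use ab in simp)
  then have "sqrt (A * N) * (b - a) \<le> arctan (c * (g a / f a)) - arctan (c * (g b / f b))"
    by (simp add: algebra_simps)
  also have "\<dots> < pi / 2 - (- (pi / 2))"
    using arctan_bounded[of "c * (g a / f a)"] arctan_bounded[of "c * (g b / f b)"] by linarith
  finally show False using long by simp
qed

text \<open>Inside the barrier the flux of a nonnegative solution cannot decrease; it starts at 0,
  so f never drops below its initial value.\<close>

lemma even_sol_ge_1:
  assumes sol: "is_sol \<kappa> f g" and init: "f 0 = 1" "g 0 = 0"
    and pos: "\<And>t. 0 \<le> t \<Longrightarrow> t \<le> s \<Longrightarrow> 0 \<le> f t"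
    and le: "\<And>t. 0 \<le> t \<Longrightarrow> t \<le> s \<Longrightarrow> 0 \<le> (q t - \<kappa>) * w t"
    and t: "0 \<le> t" "t \<le> s"
  shows "1 \<le> f t"
proof -
  have g: "0 \<le> g t" if "0 \<le> t" "t \<le> s" for t
    using increment_le[OF that(1), of "\<lambda>_. 0" "\<lambda>_. 0" g, OF _ is_solD(2)[OF sol]] pos le that init
    by force
  show ?thesis
    using increment_le[OF t(1), of "\<lambda>_. 0" "\<lambda>_. 0" f, OF _ is_solD(1)[OF sol]] g t init
      alpha_pos by (force intro: mult_nonneg_nonneg less_imp_le)
qed

text \<open>Two rounds of integration: flux at least 1 gives \<open>f \<ge> A * t\<close>, then the
  equation gives \<open>g \<ge> K * A * t\<^sup>2 / 2\<close>, and this gives the cubic. The second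
  round gains the factor K, the weighted excess of the barrier over the parameter, which will force
  the gap to be small.\<close>

lemma odd_sol_ge_cubic:
  assumes sol: "is_sol \<kappa> f g" and init: "f 0 = 0" "g 0 = 1"
    and pos: "\<And>t. 0 \<le> t \<Longrightarrow> t \<le> s \<Longrightarrow> 0 \<le> f t"
    and le: "\<And>t. 0 \<le> t \<Longrightarrow> t \<le> s \<Longrightarrow> K \<le> (q t - \<kappa>) * w t"
    and A: "\<And>t. 0 \<le> t \<Longrightarrow> t \<le> s \<Longrightarrow> A \<le> \<alpha> t"
    and nn: "0 \<le> K" "0 \<le> A" and t: "0 \<le> t" "t \<le> s"
  shows "K * A\<^sup>2 * t ^ 3 / 6 \<le> f t"
proof -
  have g1: "1 \<le> g t" if "0 \<le> t" "t \<le> s" for t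
    using increment_le[OF that(1), of "\<lambda>_. 0" "\<lambda>_. 0" g, OF _ is_solD(2)[OF sol]]
      order_trans[OF nn(1) le] pos that init by force
  have f1: "A * t \<le> f t" if "0 \<le> t" "t \<le> s" for t
  proof -
    have "A * t - A * 0 \<le> f t - f 0"
    proof (rule increment_le[OF that(1) _ is_solD(1)[OF sol]])
      show "((\<lambda>t. A * t) has_real_derivative A) (at x)" for x
        by (auto intro!: derivative_eq_intros)
      show "A \<le> \<alpha> x * g x" if "0 \<le> x" "x \<le> t" for x
        using mult_mono[OF A[of x] g1[of x]] nn that alpha_pos[of x] \<open>t \<le> s\<close> by force
    qed
    then show ?thesis using init by simp
  qed
  have g2: "K * A * t\<^sup>2 / 2 \<le> g t" if "0 \<le> t" "t \<le> s" for t
  proof -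
    have "K * A * t\<^sup>2 / 2 - K * A * 0\<^sup>2 / 2 \<le> g t - g 0"
    proof (rule increment_le[OF that(1) _ is_solD(2)[OF sol]])
      show "((\<lambda>t. K * A * t\<^sup>2 / 2) has_real_derivative K * (A * x)) (at x)" for x
        by (rule derivative_eq_intros refl | simp)+
      show "K * (A * x) \<le> (q x - \<kappa>) * w x * f x" if "0 \<le> x" "x \<le> t" for x
        using mult_mono[OF le[of x] f1[of x]] order_trans[OF nn(1) le[of x]] nn that \<open>t \<le> s\<close> by simp
    qed
    then show ?thesis using init by simp
  qed
  have "K * A\<^sup>2 * t ^ 3 / 6 - K * A\<^sup>2 * 0 ^ 3 / 6 \<le> f t - f 0"
  proof (rule increment_le[OF t(1) _ is_solD(1)[OF sol]])
    show "((\<lambda>t. K * A\<^sup>2 * t ^ 3 / 6) has_real_derivative A * (K * A * x\<^sup>2 / 2)) (at x)" for x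
      by (rule derivative_eq_intros refl | simp add: power2_eq_square)+
    show "A * (K * A * x\<^sup>2 / 2) \<le> \<alpha> x * g x" if "0 \<le> x" "x \<le> t" for x
      using mult_mono[OF A[of x] g2[of x]] nn that alpha_pos[of x] t by simp
  qed
  then show ?thesis using init by simp
qed

text \<open>The Wronskian \<open>f g\<^sub>o - h g\<^sub>e\<close> falls from 1 to 0 on \<open>[0, T]\<close>, with slope \<open>- (\<kappa>\<^sub>o - \<kappa>\<^sub>e) w f h\<close>.\<close>

lemma even_odd_gap:
  assumes e: "is_sol \<kappa>\<^sub>e f g\<^sub>e" "f 0 = 1" "g\<^sub>e 0 = 0" "f T = 0" "\<And>t. 0 < t \<Longrightarrow> t < T \<Longrightarrow> 0 < f t"
    and o: "is_sol \<kappa>\<^sub>o h g\<^sub>o" "h 0 = 0" "g\<^sub>o 0 = 1" "h T = 0" "\<And>t. 0 < t \<Longrightarrow> t < T \<Longrightarrow> 0 < h t"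
    and s: "0 < s" "s < T"
    and le: "\<And>t. 0 \<le> t \<Longrightarrow> t \<le> s \<Longrightarrow> 0 \<le> (q t - \<kappa>\<^sub>e) * w t"
      "\<And>t. 0 \<le> t \<Longrightarrow> t \<le> s \<Longrightarrow> K \<le> (q t - \<kappa>\<^sub>o) * w t"
    and A: "\<And>t. 0 \<le> t \<Longrightarrow> t \<le> s \<Longrightarrow> A \<le> \<alpha> t"
    and B: "\<And>t. 0 \<le> t \<Longrightarrow> t \<le> s \<Longrightarrow> B \<le> w t"
    and nn: "0 \<le> K" "0 \<le> A" "0 \<le> B"
  shows "\<kappa>\<^sub>e < \<kappa>\<^sub>o" and "(\<kappa>\<^sub>o - \<kappa>\<^sub>e) * (B * K * A\<^sup>2 * s ^ 4 / 24) \<le> 1"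
proof -
  define W where "W t = f t * g\<^sub>o t - h t * g\<^sub>e t" for t
  have dW: "(W has_real_derivative - ((\<kappa>\<^sub>o - \<kappa>\<^sub>e) * (w t * f t * h t))) (at t)" for t
    unfolding W_def
    by (rule derivative_eq_intros is_solD[OF e(1)] is_solD[OF o(1)] refl | simp add: algebra_simps)+
  have W: "W 0 = 1" "W T = 0" using e o by (auto simp: W_def)
  have nonneg: "0 \<le> f t" "0 \<le> h t" if "0 \<le> t" "t \<le> T" for t
    using that e(2,4) e(5)[of t] o(2,4) o(5)[of t]
    by (cases "t = 0"; cases "t = T"; force)+
  \<comment> \<open>The mean slope of W over \<open>[0, T]\<close> is negative while
    \<open>w * f * h\<close> is positive, which decides the sign of
    \<open>\<kappa>\<^sub>o - \<kappa>\<^sub>e\<close>.\<close>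
  obtain z where z: "0 < z" "z < T" "W T - W 0 = (T - 0) * - ((\<kappa>\<^sub>o - \<kappa>\<^sub>e) * (w z * f z * h z))"
    using MVT2[of 0 T W, OF _ dW] s by auto
  have "0 < w z * f z * h z" using w_pos e(5) o(5) z by simp
  moreover have "0 < T * (\<kappa>\<^sub>o - \<kappa>\<^sub>e) * (w z * f z * h z)" using z(3) W by (simp add: algebra_simps)
  ultimately have "0 < T * (\<kappa>\<^sub>o - \<kappa>\<^sub>e)" by (metis zero_less_mult_pos2)
  then show gap: "\<kappa>\<^sub>e < \<kappa>\<^sub>o" using s by (simp add: zero_less_mult_iff)
  have "W T \<le> W s"
  proof (rule DERIV_nonpos_imp_nonincreasing[of s T W])
    fix t assume "s \<le> t" "t \<le> T"
    then have "0 \<le> (\<kappa>\<^sub>o - \<kappa>\<^sub>e) * (w t * f t * h t)"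
      using nonneg[of t] w_pos[of t] gap s by (intro mult_nonneg_nonneg) auto
    then show "\<exists>y. (W has_real_derivative y) (at t) \<and> y \<le> 0"
      using dW by (meson neg_le_0_iff_le)
  qed (use s in simp)
  \<comment> \<open>The lower bounds B, 1 and \<open>K * A\<^sup>2 * t ^ 3 / 6\<close> for the three
    factors integrate to \<open>B * K * A\<^sup>2 * s ^ 4 / 24\<close>.\<close>
  moreover have "W s - W 0 \<le> - ((\<kappa>\<^sub>o - \<kappa>\<^sub>e) * (B * K * A\<^sup>2 * s ^ 4 / 24)) - - ((\<kappa>\<^sub>o - \<kappa>\<^sub>e) * (B * K * A\<^sup>2 * 0 ^ 4 / 24))"
  proof (rule increment_le[OF less_imp_le[OF s(1)] dW])
    show "((\<lambda>t. - ((\<kappa>\<^sub>o - \<kappa>\<^sub>e) * (B * K * A\<^sup>2 * t ^ 4 / 24))) has_real_derivative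
        - ((\<kappa>\<^sub>o - \<kappa>\<^sub>e) * (B * 1 * (K * A\<^sup>2 * t ^ 3 / 6)))) (at t)" for t
      by (rule derivative_eq_intros refl | simp)+
    fix t assume t: "0 \<le> t" "t \<le> s"
    have "1 \<le> f t" using even_sol_ge_1[OF e(1,2,3) _ le(1) t] nonneg s by force
    moreover have "K * A\<^sup>2 * t ^ 3 / 6 \<le> h t"
      using odd_sol_ge_cubic[OF o(1,2,3) _ le(2) A nn(1,2) t] nonneg s by force
    ultimately have "B * 1 * (K * A\<^sup>2 * t ^ 3 / 6) \<le> w t * f t * h t"
      using B[OF t] nn nonneg[of t] t s w_pos[of t] by (intro mult_mono) auto
    then show "- ((\<kappa>\<^sub>o - \<kappa>\<^sub>e) * (w t * f t * h t)) \<le> - ((\<kappa>\<^sub>o - \<kappa>\<^sub>e) * (B * 1 * (K * A\<^sup>2 * t ^ 3 / 6)))"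
      using gap by (simp del: mult_1_right)
  qed
  ultimately show "(\<kappa>\<^sub>o - \<kappa>\<^sub>e) * (B * K * A\<^sup>2 * s ^ 4 / 24) \<le> 1" using W by simp
qed

text \<open>From its maximum at z, where the flux vanishes, f has to fall to 0 within length T. As
  \<open>g' \<ge> - \<kappa> * B * f z\<close>, the flux stays above
  \<open>- \<kappa> * B * f z * T\<close>, so f loses at most
  \<open>\<kappa> * B * f z * T\<^sup>2\<close>. The bound makes the separation constants of thin
  directions large.\<close>

lemma ground_eigenvalue_ge:
  assumes sol: "is_sol \<kappa> f g" and init: "f 0 = 1" "g 0 = 0" and T: "0 < T" "f T = 0"
    and pos: "\<And>t. 0 < t \<Longrightarrow> t < T \<Longrightarrow> 0 < f t" and "0 \<le> \<kappa>"
    and alpha_le: "\<And>t. 0 \<le> t \<Longrightarrow> t \<le> T \<Longrightarrow> \<alpha> t \<le> 1"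
    and w_le: "\<And>t. 0 \<le> t \<Longrightarrow> t \<le> T \<Longrightarrow> w t \<le> B"
  shows "1 \<le> \<kappa> * B * T\<^sup>2"
proof -
  obtain z where z: "z \<in> {0..T}" "\<And>y. y \<in> {0..T} \<Longrightarrow> f y \<le> f z"
    using continuous_attains_sup[of "{0..T}" f] is_solD(5)[OF sol] T by auto
  have fz: "1 \<le> f z" using z(2)[of 0] init T by simp
  have "z < T" using z(1) fz T by (cases "z = T") auto
  have nonneg: "0 \<le> f t" if "0 \<le> t" "t \<le> T" for t
    using that init T pos[of t] by (cases "t = 0"; cases "t = T"; force)
  have Bnn: "0 \<le> B" using w_le[of 0] w_pos[of 0] T by simp
  have gz: "g z = 0"
  proof (cases "z = 0")
    case False
    have "\<alpha> z * g z = 0"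
    proof (rule DERIV_local_max[OF is_solD(1)[OF sol]])
      show "0 < min z (T - z)" using False z(1) \<open>z < T\<close> by simp
      show "\<forall>y. \<bar>z - y\<bar> < min z (T - z) \<longrightarrow> f y \<le> f z"
        using z(2) by (auto simp: abs_if split: if_splits)
    qed
    then show ?thesis using alpha_pos[of z] by simp
  qed (use init in simp)
  have g: "- (\<kappa> * B * f z * T) \<le> g t" if t: "z \<le> t" "t \<le> T" for t
  proof -
    have "- (\<kappa> * B * f z) * t - - (\<kappa> * B * f z) * z \<le> g t - g z"
    proof (rule increment_le[OF t(1) _ is_solD(2)[OF sol]])
      show "((\<lambda>t. - (\<kappa> * B * f z) * t) has_real_derivative - (\<kappa> * B * f z)) (at x)" for x
        by (auto intro!: derivative_eq_intros)
      fix x assume x: "z \<le> x" "x \<le> t"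
      then have x0: "0 \<le> x" "x \<le> T" using z t by auto
      have "\<kappa> * w x * f x \<le> \<kappa> * B * f z"
        using w_le[OF x0] less_imp_le[OF w_pos[of x]] z(2)[of x] x0 \<open>0 \<le> \<kappa>\<close> Bnn nonneg[OF x0] by (intro mult_mono) auto
      moreover have "0 \<le> q x * w x * f x"
        using q_nonneg w_pos[of x] nonneg[OF x0] by (intro mult_nonneg_nonneg) auto
      ultimately show "- (\<kappa> * B * f z) \<le> (q x - \<kappa>) * w x * f x" by (simp add: algebra_simps)
    qed
    moreover have "\<kappa> * B * f z * (t - z) \<le> \<kappa> * B * f z * T"
      using z(1) t fz Bnn \<open>0 \<le> \<kappa>\<close> by (intro mult_left_mono mult_nonneg_nonneg) auto
    ultimately show ?thesis using gz by (simp add: algebra_simps)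
  qed
  have "- (\<kappa> * B * f z * T) * T - - (\<kappa> * B * f z * T) * z \<le> f T - f z"
  proof (rule increment_le[OF _ _ is_solD(1)[OF sol]])
    show "((\<lambda>t. - (\<kappa> * B * f z * T) * t) has_real_derivative - (\<kappa> * B * f z * T)) (at x)" for x
      by (auto intro!: derivative_eq_intros)
    fix x assume x: "z \<le> x" "x \<le> T"
    have C: "0 \<le> \<kappa> * B * f z * T" using fz Bnn \<open>0 \<le> \<kappa>\<close> T by (intro mult_nonneg_nonneg) auto
    have a: "\<alpha> x \<le> 1" "0 \<le> \<alpha> x" using alpha_le x z alpha_pos[of x] by auto
    have "- (\<kappa> * B * f z * T) \<le> \<alpha> x * - (\<kappa> * B * f z * T)"
      using mult_right_mono[OF a(1) C] by simp
    also have "\<dots> \<le> \<alpha> x * g x" using g[OF x] a(2) by (rule mult_left_mono)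
    finally show "- (\<kappa> * B * f z * T) \<le> \<alpha> x * g x" .
  qed (use \<open>z < T\<close> in simp)
  moreover have "0 \<le> \<kappa> * B * f z * T * z" using fz Bnn \<open>0 \<le> \<kappa>\<close> T z(1) by (intro mult_nonneg_nonneg) auto
  ultimately have "f z * 1 \<le> f z * (\<kappa> * B * T\<^sup>2)" using T(2) by (simp add: power2_eq_square algebra_simps)
  then show ?thesis using fz by (subst (asm) mult_le_cancel_left_pos) auto
qed

end

subsection \<open>The separated equations\<close>

text \<open>Written in \<open>t\<close> with \<open>y = sinh t\<close>, this is \<open>f_tt + (d -
  1) * tanh t * f_t = (\<mu> / cosh\<^sup>2 t - \<kappa>) * f\<close>: the equation for the first
  Fermi coordinate of d-dimensional hyperbolic space, where \<mu> is the separation constant of the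
  other d - 1 coordinates.\<close>

definition level_sol :: "nat \<Rightarrow> real \<Rightarrow> real \<Rightarrow> (real \<Rightarrow> real) \<Rightarrow> bool" where
  "level_sol d \<mu> \<kappa> f \<longleftrightarrow> (\<exists>f' f''. (\<forall>y. (f has_real_derivative f' y) (at y)) \<and>
     (\<forall>y. (f' has_real_derivative f'' y) (at y)) \<and> continuous_on UNIV f'' \<and>
     (\<forall>y. (1 + y\<^sup>2) * f'' y + real d * y * f' y = (\<mu> / (1 + y\<^sup>2) - \<kappa>) * f y))"

text \<open>\<kappa> plays the part of the lowest Dirichlet eigenvalue on \<open>[-T, T]\<close>.
  The second conjunct supplies the factors of the supersolutions, which must stay positive at the
  end points too.\<close>

definition ground_level :: "nat \<Rightarrow> real \<Rightarrow> real \<Rightarrow> real \<Rightarrow> bool" where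
  "ground_level d \<mu> T \<kappa> \<longleftrightarrow>
     (\<exists>f. level_sol d \<mu> \<kappa> f \<and> (\<forall>y. \<bar>y\<bar> < T \<longrightarrow> 0 < f y) \<and> f T = 0 \<and> f (- T) = 0) \<and>
     (\<forall>\<kappa>'<\<kappa>. \<exists>f. level_sol d \<mu> \<kappa>' f \<and> (\<forall>y. \<bar>y\<bar> \<le> T \<longrightarrow> 0 < f y))"

text \<open>The integrating factor of the level equation is
  \<open>p = sqrt (1 + y\<^sup>2) ^ d\<close>; here stands \<open>1 / p\<close>, and the weight
  below is \<open>p / (1 + y\<^sup>2)\<close>.\<close>

definition level_alpha :: "nat \<Rightarrow> real \<Rightarrow> real" where
  "level_alpha d y = 1 / sqrt (1 + y\<^sup>2) ^ d"

definition level_weight :: "nat \<Rightarrow> real \<Rightarrow> real" where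
  "level_weight d y = sqrt (1 + y\<^sup>2) ^ d / (1 + y\<^sup>2)"

definition level_potential :: "real \<Rightarrow> real \<Rightarrow> real" where
  "level_potential \<mu> y = \<mu> / (1 + y\<^sup>2)"

lemma one_plus_square_pos: "0 < 1 + y\<^sup>2" for y :: real
  by (simp add: add_pos_nonneg)

lemma even_sturm_liouville_level:
  assumes "0 \<le> \<mu>"
  shows "even_sturm_liouville (level_alpha d) (level_weight d) (level_potential \<mu>)"
proof
  have n: "1 + y\<^sup>2 \<noteq> 0" "sqrt (1 + y\<^sup>2) ^ d \<noteq> 0" for y :: real
    using one_plus_square_pos[of y] by auto
  show "continuous_on UNIV (level_alpha d)" "continuous_on UNIV (level_weight d)"
    "continuous_on UNIV (level_potential \<mu>)"
    unfolding level_alpha_def level_weight_def level_potential_def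
    using n by (intro continuous_intros; simp)+
qed (use assms one_plus_square_pos in \<open>simp_all add: level_alpha_def level_weight_def level_potential_def\<close>)

text \<open>Undoing the integrating factor:
  \<open>\<alpha>' = - d * y / (1 + y\<^sup>2) * \<alpha>\<close> produces the first-order term and
  \<open>\<alpha> * w = 1 / (1 + y\<^sup>2)\<close> the right-hand side.\<close>

lemma level_sol_if_is_sol:
  assumes "0 \<le> \<mu>"
    and sol: "even_sturm_liouville.is_sol (level_alpha d) (level_weight d) (level_potential \<mu>) \<kappa> f g"
  shows "level_sol d \<mu> \<kappa> f"
proof -
  interpret even_sturm_liouville "level_alpha d" "level_weight d" "level_potential \<mu>"
    by (rule even_sturm_liouville_level[OF assms(1)])
  let ?a = "level_alpha d"
  define f' where "f' y = ?a y * g y" for y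
  define f'' where "f'' y = - (real d * y / (1 + y\<^sup>2)) * f' y
    + ?a y * ((level_potential \<mu> y - \<kappa>) * level_weight d y * f y)" for y
  have da: "(?a has_real_derivative - (real d * y / (1 + y\<^sup>2)) * ?a y) (at y)" for y
  proof -
    define c where "c = sqrt (1 + y\<^sup>2)"
    have c: "0 < c" "c\<^sup>2 = 1 + y\<^sup>2" using one_plus_square_pos[of y] by (auto simp: c_def)
    have "((\<lambda>y. sqrt (1 + y\<^sup>2)) has_real_derivative y / c) (at y)"
      using one_plus_square_pos[of y]
      by (auto intro!: derivative_eq_intros simp: c_def field_simps)
    from DERIV_inverse'[OF DERIV_power[OF this, of d]] c
    have "((\<lambda>y. inverse (sqrt (1 + y\<^sup>2) ^ d)) has_real_derivative
      - (inverse (c ^ d) * (real d * (y / c * c ^ (d - 1))) * inverse (c ^ d))) (at y)"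
      by (simp add: c_def)
    moreover have "- (inverse (c ^ d) * (real d * (y / c * c ^ (d - 1))) * inverse (c ^ d))
        = - (real d * y / c\<^sup>2) * (1 / c ^ d)"
      using c(1) by (cases d) (simp_all add: field_simps power2_eq_square)
    ultimately show ?thesis
      unfolding c(2) unfolding c_def level_alpha_def[abs_def] by (simp add: inverse_eq_divide)
  qed
  have df': "(f' has_real_derivative f'' y) (at y)" for y
    unfolding f'_def[abs_def] f''_def
    by (rule derivative_eq_intros da is_solD[OF sol] refl | simp add: algebra_simps)+
  have aw: "?a y * level_weight d y = 1 / (1 + y\<^sup>2)" for y
    using one_plus_square_pos[of y] by (simp add: level_alpha_def level_weight_def)
  have f''_eq: "f'' y = - (real d * y / (1 + y\<^sup>2)) * f' y + (level_potential \<mu> y - \<kappa>) * f y / (1 + y\<^sup>2)" for y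
  proof -
    have "?a y * ((level_potential \<mu> y - \<kappa>) * level_weight d y * f y)
        = (?a y * level_weight d y) * ((level_potential \<mu> y - \<kappa>) * f y)"
      by (simp only: mult_ac)
    then show ?thesis by (simp add: f''_def aw)
  qed
  have n: "1 + y\<^sup>2 \<noteq> 0" for y :: real using one_plus_square_pos[of y] by simp
  have "continuous_on UNIV f'"
    using df' by (meson DERIV_isCont continuous_at_imp_continuous_on)
  then have "continuous_on UNIV f''"
    unfolding f''_eq[abs_def] using n
    by (intro continuous_intros cont is_solD[OF sol]) auto
  moreover have "(1 + y\<^sup>2) * f'' y + real d * y * f' y = (\<mu> / (1 + y\<^sup>2) - \<kappa>) * f y" for y
    using n[of y] by (simp add: f''_eq level_potential_def) (simp add: right_diff_distrib)
  ultimately show ?thesis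
    unfolding level_sol_def using is_solD(1)[OF sol] df'
    by (intro exI[of _ f'] exI[of _ f'']) (auto simp: f'_def)
qed

lemma level_bounds:
  assumes "1 + y\<^sup>2 \<le> C\<^sup>2" "1 \<le> C"
  shows "1 / C ^ d \<le> level_alpha d y" "level_alpha d y \<le> 1"
    "1 / C\<^sup>2 \<le> level_weight d y" "level_weight d y \<le> C ^ d"
proof -
  have 1: "1 \<le> sqrt (1 + y\<^sup>2)" by simp
  have C: "sqrt (1 + y\<^sup>2) \<le> C" using assms by (simp add: real_le_lsqrt)
  have p: "1 \<le> sqrt (1 + y\<^sup>2) ^ d" "sqrt (1 + y\<^sup>2) ^ d \<le> C ^ d"
    using 1 C by (auto intro!: power_mono one_le_power)
  have p0: "0 < sqrt (1 + y\<^sup>2) ^ d" using p by linarith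
  show "1 / C ^ d \<le> level_alpha d y"
    unfolding level_alpha_def using p p0 by (intro divide_left_mono) auto
  show "level_alpha d y \<le> 1"
    unfolding level_alpha_def using p p0 by (simp add: divide_le_eq_1)
  show "1 / C\<^sup>2 \<le> level_weight d y"
    unfolding level_weight_def using p assms one_plus_square_pos[of y] by (intro frac_le) auto
  have "sqrt (1 + y\<^sup>2) ^ d / (1 + y\<^sup>2) \<le> C ^ d / 1"
    using p p0 by (intro frac_le) auto
  then show "level_weight d y \<le> C ^ d" by (simp add: level_weight_def)
qed

lemma times_level_weight_ge:
  assumes "1 + y\<^sup>2 \<le> C\<^sup>2" "1 \<le> C" "0 \<le> N" "N * C\<^sup>2 \<le> x"
  shows "N \<le> x * level_weight d y"
proof -
  have "0 \<le> x" using assms(3,4) by (meson order_trans mult_nonneg_nonneg zero_le_power2)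
  then have "N * C\<^sup>2 * (1 / C\<^sup>2) \<le> x * level_weight d y"
    using assms level_bounds(3)[OF assms(1,2)] by (intro mult_mono) auto
  then show ?thesis using assms(2) by simp
qed

context
  fixes d :: nat and \<mu> T :: real
  assumes mu: "0 \<le> \<mu>" and T: "0 < T"
begin

interpretation even_sturm_liouville "level_alpha d" "level_weight d" "level_potential \<mu>"
  by (rule even_sturm_liouville_level[OF mu])

lemma initial_data: "(1 :: real) = 1 \<and> (0 :: real) = 0 \<or> (1 :: real) = 0 \<and> (0 :: real) = 1"
  "(0 :: real) = 1 \<and> (1 :: real) = 0 \<or> (0 :: real) = 0 \<and> (1 :: real) = 1"
  by auto

lemma ground_levelI:
  assumes fam: "sol_family 1 0 f g" and z: "f \<kappa> T = 0"
    and pos: "\<And>t. 0 < t \<Longrightarrow> t < T \<Longrightarrow> 0 < f \<kappa> t"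
    and below: "\<And>\<kappa>' t. \<kappa>' < \<kappa> \<Longrightarrow> 0 < t \<Longrightarrow> t \<le> T \<Longrightarrow> 0 < f \<kappa>' t"
  shows "ground_level d \<mu> T \<kappa>"
proof -
  have sol: "is_sol \<kappa> (f \<kappa>) (g \<kappa>)" and 0: "f \<kappa> 0 = 1" "g \<kappa> 0 = 0" for \<kappa>
    using fam by (auto simp: sol_family_def)
  have even: "f \<kappa> (- t) = f \<kappa> t" for \<kappa> t
    using sol_parity[OF sol, of 1 \<kappa> t] 0 by simp
  then have abs: "f \<kappa> t = f \<kappa> \<bar>t\<bar>" for \<kappa> t by (simp add: abs_if)
  have "0 < f \<kappa> y" if "\<bar>y\<bar> < T" for y
    using abs[of \<kappa> y] pos[of "\<bar>y\<bar>"] 0 that by (cases "y = 0") auto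
  moreover have "0 < f \<kappa>' y" if "\<bar>y\<bar> \<le> T" "\<kappa>' < \<kappa>" for y \<kappa>'
    using abs[of \<kappa>' y] below[of \<kappa>' "\<bar>y\<bar>"] 0 that by (cases "y = 0") auto
  ultimately show ?thesis
    unfolding ground_level_def using level_sol_if_is_sol[OF mu sol] z even by metis
qed

lemma ex_ground_level:
  "\<exists>\<kappa>\<ge>0. ground_level d \<mu> T \<kappa> \<and> (T \<le> 1 \<longrightarrow> 1 \<le> \<kappa> * 2 ^ d * T\<^sup>2)"
proof -
  obtain f g where fam: "sol_family 1 0 f g" using ex_sol_family by blast
  then have sol: "is_sol \<kappa> (f \<kappa>) (g \<kappa>)" and 0: "f \<kappa> 0 = 1" "g \<kappa> 0 = 0" for \<kappa>
    by (auto simp: sol_family_def)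
  define C where "C = 1 + T"
  have C: "1 \<le> C" "1 + y\<^sup>2 \<le> C\<^sup>2" if "0 \<le> y" "y \<le> T" for y
    using T power_mono[OF that(2,1), of 2] by (auto simp: C_def power2_sum)
  have C1: "1 \<le> C" using T by (simp add: C_def)
  note bounds = level_bounds[OF C(2) C1]
  define A where "A = 1 / C ^ d"
  have A: "0 < A" using C1 by (simp add: A_def)
  \<comment> \<open>Chosen so that \<open>sqrt (A * N) * T = pi\<close>, the length that
    \<open>oscillation\<close> requires on \<open>[0, T]\<close>. The potential is at most \<mu>, so
    at the parameter \<open>\<mu> + N * C\<^sup>2\<close> the excess is large enough everywhere;
    \<open>C\<^sup>2\<close> compensates the weight.\<close>
  define N where "N = (pi / T)\<^sup>2 / A"
  have N: "0 < N" using A T by (simp add: N_def)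
  have AN: "sqrt (A * N) = pi / T" using A T by (simp add: N_def real_sqrt_divide)
  have "\<exists>t. 0 \<le> t \<and> t \<le> T \<and> f (\<mu> + N * C\<^sup>2) t \<le> 0"
  proof (rule oscillation[OF sol T A N])
    fix t assume t: "0 \<le> t" "t \<le> T"
    show "A \<le> level_alpha d t" unfolding A_def by (rule bounds(1)[OF t])
    have "level_potential \<mu> t \<le> \<mu>"
      using mu one_plus_square_pos[of t] by (simp add: level_potential_def divide_le_eq mult_le_cancel_left1)
    then have "N * C\<^sup>2 \<le> \<mu> + N * C\<^sup>2 - level_potential \<mu> t" by simp
    then have "N \<le> (\<mu> + N * C\<^sup>2 - level_potential \<mu> t) * level_weight d t"
      using N by (intro times_level_weight_ge[OF C(2)[OF t] C1]) auto
    then show "(level_potential \<mu> t - (\<mu> + N * C\<^sup>2)) * level_weight d t \<le> - N"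
      by (simp add: algebra_simps)
  qed (use AN T in simp)
  then obtain t where "0 \<le> t" "t \<le> T" "f (\<mu> + N * C\<^sup>2) t \<le> 0" by blast
  then have "0 < t" using 0 by (cases "t = 0") auto
  obtain \<kappa> where k: "0 \<le> \<kappa>" "f \<kappa> T = 0" "\<And>t. 0 < t \<Longrightarrow> t < T \<Longrightarrow> 0 < f \<kappa> t"
    "\<And>\<kappa>' t. \<kappa>' < \<kappa> \<Longrightarrow> 0 < t \<Longrightarrow> t \<le> T \<Longrightarrow> 0 < f \<kappa>' t"
    by (rule first_eigenvalue[OF fam initial_data(1) T \<open>0 < t\<close> \<open>t \<le> T\<close> \<open>f _ t \<le> 0\<close>]) blast
  have "1 \<le> \<kappa> * 2 ^ d * T\<^sup>2" if "T \<le> 1"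
  proof -
    have "1 \<le> \<kappa> * C ^ d * T\<^sup>2"
      by (rule ground_eigenvalue_ge[OF sol 0 T k(2) k(3) k(1)]) (use bounds in auto)
    also have "\<dots> \<le> \<kappa> * 2 ^ d * T\<^sup>2"
      using k(1) T that by (intro mult_right_mono mult_left_mono power_mono) (auto simp: C_def)
    finally show ?thesis .
  qed
  then show ?thesis using ground_levelI[OF fam k(2-4)] k(1) by blast
qed

text \<open>The barrier is \<open>[0, T / 2]\<close>, the well \<open>[3 * T / 4, T]\<close>. The
  trial parameter \<open>\<kappa>\<^sub>1\<close> lies at least \<open>K * C\<^sup>2\<close> below
  the potential on the barrier and, for large \<mu>, at least \<open>N * C\<^sup>2\<close> above it
  on the well. N is such that solutions at \<open>\<kappa>\<^sub>1\<close> lose their sign within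
  the well, of length T / 4, so both first eigenvalues are at most \<open>\<kappa>\<^sub>1\<close>;
  K is such that the Wronskian bounds the gap by \<open>\<epsilon> / 2\<close>. A, B and C control
  the coefficients for all T up to R.\<close>

lemma ground_level_gap:
  assumes r: "0 < r" "r \<le> T" "T \<le> R" and "0 < \<epsilon>"
    and C: "C = 1 + R" and A: "A = 1 / C ^ d" and B: "B = 1 / C\<^sup>2"
    and K: "K = 48 / (\<epsilon> * (B * A\<^sup>2 * (r / 2) ^ 4))" and N: "N = (4 * pi / r)\<^sup>2 / A"
    and large: "(K + N) * C\<^sup>2 * (16 * C ^ 4 / (5 * r\<^sup>2)) \<le> \<mu>"
  shows "\<exists>\<kappa>\<^sub>e \<kappa>\<^sub>o h. ground_level d \<mu> T \<kappa>\<^sub>e \<and> \<kappa>\<^sub>e < \<kappa>\<^sub>o \<and> \<kappa>\<^sub>o - \<kappa>\<^sub>e < \<epsilon> \<and>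
    level_sol d \<mu> \<kappa>\<^sub>o h \<and> h T = 0 \<and> h (- T) = 0 \<and> (\<exists>y. \<bar>y\<bar> < T \<and> h y \<noteq> 0)"
proof -
  have C1: "1 \<le> C" using r C by simp
  have CT: "1 + y\<^sup>2 \<le> C\<^sup>2" if "0 \<le> y" "y \<le> T" for y
  proof -
    have "y\<^sup>2 \<le> R\<^sup>2" using that r by (intro power_mono) auto
    then show ?thesis using r by (auto simp: C power2_sum)
  qed
  note bounds = level_bounds[OF CT C1]
  have A0: "0 < A" and B0: "0 < B" using C1 by (auto simp: A B)
  have K0: "0 < K" using A0 B0 r \<open>0 < \<epsilon>\<close> by (simp add: K)
  have N0: "0 < N" using A0 r by (simp add: N)
  define s where "s = T / 2"
  define a where "a = 3 * T / 4"
  have s: "0 < s" "s < T" "s \<le> T" and a: "0 < a" "a < T" using T by (auto simp: s_def a_def)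
  define \<kappa>\<^sub>1 where "\<kappa>\<^sub>1 = \<mu> / (1 + s\<^sup>2) - K * C\<^sup>2"
  have V: "level_potential \<mu> y \<le> level_potential \<mu> x" if "0 \<le> x" "x \<le> y" for x y
    using mu power_mono[OF that(2,1), of 2] one_plus_square_pos unfolding level_potential_def
    by (intro divide_left_mono) auto
  have near: "K \<le> (level_potential \<mu> t - \<kappa>) * level_weight d t" if "\<kappa> \<le> \<kappa>\<^sub>1" "0 \<le> t" "t \<le> s" for \<kappa> t
  proof -
    have le: "K * C\<^sup>2 \<le> level_potential \<mu> t - \<kappa>"
      using V[OF that(2,3)] that(1) by (simp add: \<kappa>\<^sub>1_def level_potential_def)
    show ?thesis using that s K0 by (intro times_level_weight_ge[OF CT C1 _ le]) auto
  qed
  have far: "(level_potential \<mu> t - \<kappa>\<^sub>1) * level_weight d t \<le> - N" if "a \<le> t" "t \<le> T" for t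
  proof -
    \<comment> \<open>\<open>9 / 16 - 1 / 4 = 5 / 16\<close>. The potential drops from s to a by
      \<mu> times \<open>(a\<^sup>2 - s\<^sup>2) / ((1 + s\<^sup>2) * (1 + a\<^sup>2))\<close>,
      whence the factor \<open>16 * C ^ 4 / (5 * r\<^sup>2)\<close> in \<open>large\<close>.\<close>
    have as: "a\<^sup>2 - s\<^sup>2 = 5 * T\<^sup>2 / 16" by (simp add: a_def s_def power2_eq_square field_simps)
    have sa: "1 + s\<^sup>2 \<noteq> 0" "1 + a\<^sup>2 \<noteq> 0" "0 < (1 + s\<^sup>2) * (1 + a\<^sup>2)"
      using one_plus_square_pos[of s] one_plus_square_pos[of a] by auto
    have "(5 * r\<^sup>2 / 16) / C ^ 4 \<le> (5 * T\<^sup>2 / 16) / ((1 + s\<^sup>2) * (1 + a\<^sup>2))"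
    proof (rule frac_le)
      show "5 * r\<^sup>2 / 16 \<le> 5 * T\<^sup>2 / 16" using power_mono[OF r(2), of 2] r by simp
      have "(1 + s\<^sup>2) * (1 + a\<^sup>2) \<le> C\<^sup>2 * C\<^sup>2"
        using CT[of s] CT[of a] s a one_plus_square_pos[of a] by (intro mult_mono) auto
      then show "(1 + s\<^sup>2) * (1 + a\<^sup>2) \<le> C ^ 4" by (simp flip: power_add)
    qed (use sa in auto)
    also have "\<dots> = 1 / (1 + s\<^sup>2) - 1 / (1 + a\<^sup>2)"
      unfolding as[symmetric] using sa by (simp add: field_simps)
    finally have diff: "5 * r\<^sup>2 / (16 * C ^ 4) \<le> 1 / (1 + s\<^sup>2) - 1 / (1 + a\<^sup>2)" by simp
    have "(K + N) * C\<^sup>2 = (K + N) * C\<^sup>2 * (16 * C ^ 4 / (5 * r\<^sup>2)) * (5 * r\<^sup>2 / (16 * C ^ 4))"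
    proof -
      have "16 * C ^ 4 / (5 * r\<^sup>2) * (5 * r\<^sup>2 / (16 * C ^ 4)) = 1" using C1 r by simp
      then show ?thesis by (simp only: mult.assoc mult_1_right)
    qed
    also have "\<dots> \<le> \<mu> * (1 / (1 + s\<^sup>2) - 1 / (1 + a\<^sup>2))"
      using large mu diff C1 by (intro mult_mono) auto
    finally have "N * C\<^sup>2 \<le> \<kappa>\<^sub>1 - level_potential \<mu> a"
      by (simp add: \<kappa>\<^sub>1_def level_potential_def algebra_simps)
    also have "\<dots> \<le> \<kappa>\<^sub>1 - level_potential \<mu> t" using V[of a t] a that by simp
    finally have le: "N * C\<^sup>2 \<le> \<kappa>\<^sub>1 - level_potential \<mu> t" .
    have "N \<le> (\<kappa>\<^sub>1 - level_potential \<mu> t) * level_weight d t"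
      using that a N0 by (intro times_level_weight_ge[OF CT C1 _ le]) auto
    then show ?thesis by (simp add: algebra_simps)
  qed
  have AN: "pi \<le> sqrt (A * N) * (T - a)"
  proof -
    have "sqrt (A * N) = 4 * pi / r" using A0 r by (simp add: N real_sqrt_divide)
    then have "sqrt (A * N) * (T - a) = pi * (T / r)" by (simp add: a_def)
    moreover have "1 \<le> T / r" using r by simp
    ultimately show ?thesis using mult_left_mono[of 1 "T / r" pi] by simp
  qed
  have osc: "\<exists>t. 0 < t \<and> t \<le> T \<and> f t \<le> 0" if sol: "is_sol \<kappa>\<^sub>1 f g" for f g
  proof -
    have "\<exists>t. a \<le> t \<and> t \<le> T \<and> f t \<le> 0"
      using bounds(1) a by (intro oscillation[OF sol a(2) A0 N0 _ far AN]) (auto simp: A)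
    then obtain t where "a \<le> t" "t \<le> T" "f t \<le> 0" by blast
    then show ?thesis using a by (intro exI[of _ t]) auto
  qed
  obtain f ge where fam_f: "sol_family 1 0 f ge" using ex_sol_family by blast
  obtain h go where fam_h: "sol_family 0 1 h go" using ex_sol_family by blast
  have sol: "is_sol \<kappa> (f \<kappa>) (ge \<kappa>)" "is_sol \<kappa> (h \<kappa>) (go \<kappa>)" "f \<kappa> 0 = 1" "ge \<kappa> 0 = 0" "h \<kappa> 0 = 0" "go \<kappa> 0 = 1" for \<kappa>
    using fam_f fam_h by (auto simp: sol_family_def)
  obtain t where t: "0 < t" "t \<le> T" "f \<kappa>\<^sub>1 t \<le> 0" using osc[OF sol(1)] by blast
  obtain \<kappa>\<^sub>e where e: "0 \<le> \<kappa>\<^sub>e" "\<kappa>\<^sub>e \<le> \<kappa>\<^sub>1" "f \<kappa>\<^sub>e T = 0" "\<And>t. 0 < t \<Longrightarrow> t < T \<Longrightarrow> 0 < f \<kappa>\<^sub>e t"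
    "\<And>\<kappa>' t. \<kappa>' < \<kappa>\<^sub>e \<Longrightarrow> 0 < t \<Longrightarrow> t \<le> T \<Longrightarrow> 0 < f \<kappa>' t"
    by (rule first_eigenvalue[OF fam_f initial_data(1) T t]) blast
  obtain t' where t': "0 < t'" "t' \<le> T" "h \<kappa>\<^sub>1 t' \<le> 0" using osc[OF sol(2)] by blast
  obtain \<kappa>\<^sub>o where o: "\<kappa>\<^sub>o \<le> \<kappa>\<^sub>1" "h \<kappa>\<^sub>o T = 0" "\<And>t. 0 < t \<Longrightarrow> t < T \<Longrightarrow> 0 < h \<kappa>\<^sub>o t"
    by (rule first_eigenvalue[OF fam_h initial_data(2) T t']) blast
  have near_e: "0 \<le> (level_potential \<mu> t - \<kappa>\<^sub>e) * level_weight d t" if "0 \<le> t" "t \<le> s" for t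
    using near[OF e(2) that] K0 by simp
  have AB: "A \<le> level_alpha d t" "B \<le> level_weight d t" if "0 \<le> t" "t \<le> s" for t
    using bounds[of t] that s by (auto simp: A B)
  note gap = even_odd_gap[OF sol(1,3,4) e(3,4) sol(2,5,6) o(2,3) s(1,2) near_e near[OF o(1)] AB
      less_imp_le[OF K0] less_imp_le[OF A0] less_imp_le[OF B0]]
  have "\<kappa>\<^sub>o - \<kappa>\<^sub>e < \<epsilon>"
  proof -
    have P: "0 < B * A\<^sup>2 * (r / 2) ^ 4" using A0 B0 r by simp
    have "2 / \<epsilon> = 48 / (\<epsilon> * Q) * Q / 24" if "0 < Q" for Q using that by simp
    from this[OF P] have "2 / \<epsilon> = K * (B * A\<^sup>2 * (r / 2) ^ 4) / 24" by (simp only: K)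
    also have "\<dots> \<le> K * (B * A\<^sup>2 * s ^ 4) / 24"
      using K0 A0 B0 r by (intro divide_right_mono mult_left_mono power_mono) (auto simp: s_def)
    also have "\<dots> = B * K * A\<^sup>2 * s ^ 4 / 24" by simp
    finally have "(\<kappa>\<^sub>o - \<kappa>\<^sub>e) * (2 / \<epsilon>) \<le> (\<kappa>\<^sub>o - \<kappa>\<^sub>e) * (B * K * A\<^sup>2 * s ^ 4 / 24)"
      using gap(1) by (intro mult_left_mono) auto
    also have "\<dots> \<le> 1" by (rule gap(2))
    finally show ?thesis using \<open>0 < \<epsilon>\<close> gap(1) by (simp add: field_simps)
  qed
  moreover have "h \<kappa>\<^sub>o (- T) = 0" using sol_parity[OF sol(2), of "- 1" \<kappa>\<^sub>o T] sol o(2) by simp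
  moreover have "\<bar>s\<bar> < T \<and> h \<kappa>\<^sub>o s \<noteq> 0" using o(3)[of s] s by simp
  ultimately show ?thesis
    using ground_levelI[OF fam_f e(3-5)] gap(1) level_sol_if_is_sol[OF mu sol(2)] o(2) by blast
qed

end

text \<open>One threshold M for all T in \<open>[r, R]\<close>, because in the application \<mu> and
  T vary together with the thickness of the box.\<close>

lemma ex_ground_level_gap:
  assumes "0 < r" "r \<le> R" "0 < \<epsilon>"
  shows "\<exists>M\<ge>0. \<forall>\<mu> T. M \<le> \<mu> \<longrightarrow> r \<le> T \<longrightarrow> T \<le> R \<longrightarrow>
    (\<exists>\<kappa>\<^sub>e \<kappa>\<^sub>o h. ground_level d \<mu> T \<kappa>\<^sub>e \<and> \<kappa>\<^sub>e < \<kappa>\<^sub>o \<and> \<kappa>\<^sub>o - \<kappa>\<^sub>e < \<epsilon> \<and>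
      level_sol d \<mu> \<kappa>\<^sub>o h \<and> h T = 0 \<and> h (- T) = 0 \<and> (\<exists>y. \<bar>y\<bar> < T \<and> h y \<noteq> 0))"
proof -
  define C where "C = 1 + R"
  define A where "A = 1 / C ^ d"
  define B where "B = 1 / C\<^sup>2"
  define K where "K = 48 / (\<epsilon> * (B * A\<^sup>2 * (r / 2) ^ 4))"
  define N where "N = (4 * pi / r)\<^sup>2 / A"
  let ?M = "(K + N) * C\<^sup>2 * (16 * C ^ 4 / (5 * r\<^sup>2))"
  have M: "0 \<le> ?M" using assms unfolding K_def N_def A_def B_def C_def by simp
  show ?thesis
  proof (rule exI[of _ ?M], intro conjI allI impI)
    fix \<mu> T assume *: "?M \<le> \<mu>" "r \<le> T" "T \<le> R"
    show "\<exists>\<kappa>\<^sub>e \<kappa>\<^sub>o h. ground_level d \<mu> T \<kappa>\<^sub>e \<and> \<kappa>\<^sub>e < \<kappa>\<^sub>o \<and> \<kappa>\<^sub>o - \<kappa>\<^sub>e < \<epsilon> \<and>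
      level_sol d \<mu> \<kappa>\<^sub>o h \<and> h T = 0 \<and> h (- T) = 0 \<and> (\<exists>y. \<bar>y\<bar> < T \<and> h y \<noteq> 0)"
      using * assms M
      by (intro ground_level_gap[OF _ _ assms(1) *(2,3) assms(3) C_def A_def B_def K_def N_def *(1)]) auto
  qed (rule M)
qed

subsection \<open>Hyperbolic gradients and Laplacians\<close>

definition outer :: "real ^ 'n \<Rightarrow> real ^ 'n \<Rightarrow> real ^ 'n ^ 'n" where
  "outer a b = (\<chi> i j. a $ i * b $ j)"

lemma outer_vector_mult: "outer a b *v h = (b \<bullet> h) *\<^sub>R a"
  by (simp add: vec_eq_iff outer_def matrix_vector_mult_def inner_vec_def sum_distrib_left mult_ac)

lemma trace_outer: "trace (outer a b) = a \<bullet> b"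
  by (simp add: trace_def outer_def inner_vec_def)

lemma trace_scaleR: "trace (c *\<^sub>R A) = c * trace A" for A :: "real ^ 'n ^ 'n"
  by (simp add: trace_def sum_distrib_left)

lemma scaleR_matrix_vector_mult: "(c *\<^sub>R A) *v h = c *\<^sub>R (A *v h)" for A :: "real ^ 'n ^ 'n"
  by (simp add: vec_eq_iff matrix_vector_mult_def sum_distrib_left mult_ac)

lemma continuous_on_outer:
  assumes "continuous_on U a" "continuous_on U b"
  shows "continuous_on U (\<lambda>x. outer (a x) (b x))"
  unfolding outer_def using assms
  by (intro continuous_on_vec_lambda continuous_intros)

text \<open>g is the Euclidean gradient of u, H its Hessian and l its hyperbolic Laplacian, expanded in the ball model.\<close>

definition hyp_jet :: "(real ^ 'n \<Rightarrow> real) \<Rightarrow> (real ^ 'n \<Rightarrow> real ^ 'n) \<Rightarrow> (real ^ 'n \<Rightarrow> real) \<Rightarrow> bool" where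
  "hyp_jet u g l \<longleftrightarrow> (\<exists>H. continuous_on hyp_space H \<and> (\<forall>x\<in>hyp_space.
     (u has_derivative (\<lambda>h. g x \<bullet> h)) (at x) \<and> (g has_derivative (\<lambda>h. H x *v h)) (at x) \<and>
     l x = (trace (H x) + (real CARD('n) - 2) * hyp_density x * (x \<bullet> g x)) / (hyp_density x)\<^sup>2))"

text \<open>The arguments are Euclidean gradients, that is covectors, so the inverse metric enters:
  this is the Riemannian inner product of two hyperbolic gradients.\<close>

definition hyp_inner :: "real ^ 'n \<Rightarrow> real ^ 'n \<Rightarrow> real ^ 'n \<Rightarrow> real" where
  "hyp_inner x a b = a \<bullet> b / (hyp_density x)\<^sup>2"

lemma hyp_inner_simps:
  "hyp_inner x (a + b) c = hyp_inner x a c + hyp_inner x b c"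
  "hyp_inner x c (a + b) = hyp_inner x c a + hyp_inner x c b"
  "hyp_inner x (r *\<^sub>R a) c = r * hyp_inner x a c"
  "hyp_inner x c (r *\<^sub>R a) = r * hyp_inner x c a"
  "hyp_inner x 0 c = 0" "hyp_inner x c 0 = 0"
  by (simp_all add: hyp_inner_def inner_add_left inner_add_right add_divide_distrib)

lemma hyp_inner_sum: "hyp_inner x (\<Sum>i\<in>I. f i) c = (\<Sum>i\<in>I. hyp_inner x (f i) c)"
  by (simp add: hyp_inner_def inner_sum_left sum_divide_distrib)

lemma hyp_inner_commute: "hyp_inner x a b = hyp_inner x b a"
  by (simp add: hyp_inner_def inner_commute)

lemma open_hyp_space: "open hyp_space"
  by (simp add: hyp_space_def)

lemma hyp_space_norm: "x \<in> hyp_space \<longleftrightarrow> norm x < 1"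
  by (simp add: hyp_space_def)

lemma hyp_density_pos: "x \<in> hyp_space \<Longrightarrow> 0 < hyp_density x"
  by (simp add: hyp_space_norm hyp_density_def power_less_one_iff abs_square_less_1)

lemma hyp_jet_eq:
  assumes "hyp_jet u g l" "\<And>x. x \<in> hyp_space \<Longrightarrow> u x = u' x"
    "\<And>x. x \<in> hyp_space \<Longrightarrow> g x = g' x" "\<And>x. x \<in> hyp_space \<Longrightarrow> l x = l' x"
  shows "hyp_jet u' g' l'"
proof -
  obtain H where H: "continuous_on hyp_space H" "\<And>x. x \<in> hyp_space \<Longrightarrow>
     (u has_derivative (\<lambda>h. g x \<bullet> h)) (at x) \<and> (g has_derivative (\<lambda>h. H x *v h)) (at x) \<and>
     l x = (trace (H x) + (real CARD('a) - 2) * hyp_density x * (x \<bullet> g x)) / (hyp_density x)\<^sup>2"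
    using assms(1) unfolding hyp_jet_def by blast
  show ?thesis
    unfolding hyp_jet_def
  proof (intro exI[of _ H] conjI ballI H(1))
    fix x :: "real ^ 'a" assume x: "x \<in> hyp_space"
    show "(u' has_derivative (\<lambda>h. g' x \<bullet> h)) (at x)"
      using has_derivative_transform_within_open[OF conjunct1[OF H(2)[OF x]] open_hyp_space x assms(2)] assms(3)[OF x]
      by simp
    show "(g' has_derivative (\<lambda>h. H x *v h)) (at x)"
      using has_derivative_transform_within_open[OF conjunct1[OF conjunct2[OF H(2)[OF x]]] open_hyp_space x assms(3)]
      by simp
    show "l' x = (trace (H x) + (real CARD('a) - 2) * hyp_density x * (x \<bullet> g' x)) / (hyp_density x)\<^sup>2"
      using H(2)[OF x] assms(3,4)[OF x] by simp
  qed
qed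

lemma hyp_jet_continuous:
  assumes "hyp_jet u g l"
  shows "continuous_on hyp_space u" "continuous_on hyp_space g"
  using assms unfolding hyp_jet_def
  by (meson has_derivative_continuous continuous_at_imp_continuous_on)+

lemma hyp_jet_add:
  assumes "hyp_jet u g l" "hyp_jet u' g' l'"
  shows "hyp_jet (\<lambda>x. u x + u' x) (\<lambda>x. g x + g' x) (\<lambda>x. l x + l' x)"
proof -
  obtain H H' where H: "continuous_on hyp_space H" "continuous_on hyp_space H'" "\<And>x. x \<in> hyp_space \<Longrightarrow>
     (u has_derivative (\<lambda>h. g x \<bullet> h)) (at x) \<and> (g has_derivative (\<lambda>h. H x *v h)) (at x) \<and>
     l x = (trace (H x) + (real CARD('a) - 2) * hyp_density x * (x \<bullet> g x)) / (hyp_density x)\<^sup>2"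
    "\<And>x. x \<in> hyp_space \<Longrightarrow>
     (u' has_derivative (\<lambda>h. g' x \<bullet> h)) (at x) \<and> (g' has_derivative (\<lambda>h. H' x *v h)) (at x) \<and>
     l' x = (trace (H' x) + (real CARD('a) - 2) * hyp_density x * (x \<bullet> g' x)) / (hyp_density x)\<^sup>2"
    using assms unfolding hyp_jet_def by blast
  show ?thesis
    unfolding hyp_jet_def
  proof (intro exI[of _ "\<lambda>x. H x + H' x"] conjI ballI continuous_intros H(1,2))
    fix x :: "real ^ 'a" assume x: "x \<in> hyp_space"
    note [derivative_intros] = conjunct1[OF H(3)[OF x]] conjunct1[OF conjunct2[OF H(3)[OF x]]]
      conjunct1[OF H(4)[OF x]] conjunct1[OF conjunct2[OF H(4)[OF x]]]
    show "((\<lambda>x. u x + u' x) has_derivative (\<lambda>h. (g x + g' x) \<bullet> h)) (at x)"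
      by (auto intro!: derivative_eq_intros simp: inner_add_left)
    show "((\<lambda>x. g x + g' x) has_derivative (\<lambda>h. (H x + H' x) *v h)) (at x)"
      by (auto intro!: derivative_eq_intros simp: matrix_vector_mult_add_rdistrib)
    show "l x + l' x = (trace (H x + H' x) + (real CARD('a) - 2) * hyp_density x * (x \<bullet> (g x + g' x))) / (hyp_density x)\<^sup>2"
      using H(3,4)[OF x] by (simp add: trace_add inner_add_right add_divide_distrib ring_distribs)
  qed
qed

lemma hyp_jet_mult:
  assumes "hyp_jet u g l" "hyp_jet u' g' l'"
  shows "hyp_jet (\<lambda>x. u x * u' x) (\<lambda>x. u x *\<^sub>R g' x + u' x *\<^sub>R g x)
    (\<lambda>x. u x * l' x + u' x * l x + 2 * hyp_inner x (g x) (g' x))"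
proof -
  obtain H H' where H: "continuous_on hyp_space H" "continuous_on hyp_space H'" "\<And>x. x \<in> hyp_space \<Longrightarrow>
     (u has_derivative (\<lambda>h. g x \<bullet> h)) (at x) \<and> (g has_derivative (\<lambda>h. H x *v h)) (at x) \<and>
     l x = (trace (H x) + (real CARD('a) - 2) * hyp_density x * (x \<bullet> g x)) / (hyp_density x)\<^sup>2"
    "\<And>x. x \<in> hyp_space \<Longrightarrow>
     (u' has_derivative (\<lambda>h. g' x \<bullet> h)) (at x) \<and> (g' has_derivative (\<lambda>h. H' x *v h)) (at x) \<and>
     l' x = (trace (H' x) + (real CARD('a) - 2) * hyp_density x * (x \<bullet> g' x)) / (hyp_density x)\<^sup>2"
    using assms unfolding hyp_jet_def by blast
  let ?H = "\<lambda>x. u x *\<^sub>R H' x + u' x *\<^sub>R H x + (outer (g x) (g' x) + outer (g' x) (g x))"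
  show ?thesis
    unfolding hyp_jet_def
  proof (intro exI[of _ ?H] conjI ballI)
    show "continuous_on hyp_space ?H"
      by (intro continuous_intros continuous_on_outer H(1,2) hyp_jet_continuous[OF assms(1)] hyp_jet_continuous[OF assms(2)])
    fix x :: "real ^ 'a" assume x: "x \<in> hyp_space"
    note [derivative_intros] = conjunct1[OF H(3)[OF x]] conjunct1[OF conjunct2[OF H(3)[OF x]]]
      conjunct1[OF H(4)[OF x]] conjunct1[OF conjunct2[OF H(4)[OF x]]]
    show "((\<lambda>x. u x * u' x) has_derivative (\<lambda>h. (u x *\<^sub>R g' x + u' x *\<^sub>R g x) \<bullet> h)) (at x)"
      by (auto intro!: derivative_eq_intros simp: inner_add_left)
    show "((\<lambda>x. u x *\<^sub>R g' x + u' x *\<^sub>R g x) has_derivative (\<lambda>h. ?H x *v h)) (at x)"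
      by (auto intro!: derivative_eq_intros
          simp: matrix_vector_mult_add_rdistrib scaleR_matrix_vector_mult outer_vector_mult)
    show "u x * l' x + u' x * l x + 2 * hyp_inner x (g x) (g' x)
      = (trace (?H x) + (real CARD('a) - 2) * hyp_density x * (x \<bullet> (u x *\<^sub>R g' x + u' x *\<^sub>R g x))) / (hyp_density x)\<^sup>2"
      unfolding conjunct2[OF conjunct2[OF H(3)[OF x]]] conjunct2[OF conjunct2[OF H(4)[OF x]]]
      by (simp add: trace_add trace_scaleR trace_outer inner_add_right hyp_inner_def inner_commute)
        (simp add: divide_inverse algebra_simps)
  qed
qed

lemma hyp_jet_compose:
  assumes "hyp_jet u g l"
    and d: "\<And>x. x \<in> hyp_space \<Longrightarrow> (\<phi> has_real_derivative \<phi>' (u x)) (at (u x))"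
    and d': "\<And>x. x \<in> hyp_space \<Longrightarrow> (\<phi>' has_real_derivative \<phi>'' (u x)) (at (u x))"
    and c: "continuous_on (u ` hyp_space) \<phi>''"
  shows "hyp_jet (\<lambda>x. \<phi> (u x)) (\<lambda>x. \<phi>' (u x) *\<^sub>R g x)
    (\<lambda>x. \<phi>' (u x) * l x + \<phi>'' (u x) * hyp_inner x (g x) (g x))"
proof -
  obtain H where H: "continuous_on hyp_space H" "\<And>x. x \<in> hyp_space \<Longrightarrow>
     (u has_derivative (\<lambda>h. g x \<bullet> h)) (at x) \<and> (g has_derivative (\<lambda>h. H x *v h)) (at x) \<and>
     l x = (trace (H x) + (real CARD('a) - 2) * hyp_density x * (x \<bullet> g x)) / (hyp_density x)\<^sup>2"
    using assms unfolding hyp_jet_def by blast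
  let ?H = "\<lambda>x. \<phi>' (u x) *\<^sub>R H x + \<phi>'' (u x) *\<^sub>R outer (g x) (g x)"
  have cu: "continuous_on hyp_space u" "continuous_on hyp_space g" by (rule hyp_jet_continuous[OF assms(1)])+
  have d1: "((\<lambda>x. \<phi> (u x)) has_derivative (\<lambda>h. \<phi>' (u x) * (g x \<bullet> h))) (at x)"
    and d2: "((\<lambda>x. \<phi>' (u x)) has_derivative (\<lambda>h. \<phi>'' (u x) * (g x \<bullet> h))) (at x)" if x: "x \<in> hyp_space" for x
    using has_derivative_compose[OF conjunct1[OF H(2)[OF x]] d[OF x, unfolded has_field_derivative_def]]
      has_derivative_compose[OF conjunct1[OF H(2)[OF x]] d'[OF x, unfolded has_field_derivative_def]]
    by simp_all
  show ?thesis
    unfolding hyp_jet_def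
  proof (intro exI[of _ ?H] conjI ballI)
    have "continuous_on hyp_space (\<lambda>x. \<phi>' (u x))"
      using d2 by (meson has_derivative_continuous continuous_at_imp_continuous_on)
    then show "continuous_on hyp_space ?H"
      by (intro continuous_intros continuous_on_outer H(1) cu continuous_on_compose2[OF c]) auto
    fix x :: "real ^ 'a" assume x: "x \<in> hyp_space"
    note [derivative_intros] = d2[OF x] conjunct1[OF conjunct2[OF H(2)[OF x]]]
    show "((\<lambda>x. \<phi> (u x)) has_derivative (\<lambda>h. (\<phi>' (u x) *\<^sub>R g x) \<bullet> h)) (at x)"
      using d1[OF x] by simp
    show "((\<lambda>x. \<phi>' (u x) *\<^sub>R g x) has_derivative (\<lambda>h. ?H x *v h)) (at x)"
      by (auto intro!: derivative_eq_intros
          simp: matrix_vector_mult_add_rdistrib scaleR_matrix_vector_mult outer_vector_mult)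
    show "\<phi>' (u x) * l x + \<phi>'' (u x) * hyp_inner x (g x) (g x)
      = (trace (?H x) + (real CARD('a) - 2) * hyp_density x * (x \<bullet> (\<phi>' (u x) *\<^sub>R g x))) / (hyp_density x)\<^sup>2"
      unfolding conjunct2[OF conjunct2[OF H(2)[OF x]]]
      by (simp add: trace_add trace_scaleR trace_outer hyp_inner_def)
        (simp add: divide_inverse algebra_simps)
  qed
qed

lemma hyp_jet_const: "hyp_jet (\<lambda>x. c) (\<lambda>x. 0) (\<lambda>x. 0)"
  unfolding hyp_jet_def by (intro exI[of _ "\<lambda>x. 0"]) 
    (auto simp: trace_def fun_eq_iff intro!: has_derivative_eq_rhs[OF has_derivative_const])

section \<open>Hyperboloid coordinates: gradients and Laplacians\<close>

lemma trace_mat: "trace (mat c :: real ^ 'n ^ 'n) = real CARD('n) * c"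
  by (simp add: trace_def mat_def)

lemma mat_vector_mult: "mat c *v h = c *\<^sub>R h" for h :: "real ^ 'n"
  by (simp add: vec_eq_iff matrix_vector_mult_def mat_def if_distrib[of "\<lambda>x. x * _"] cong: if_cong)

text \<open>A space coordinate of the hyperboloid model, \<open>sinh\<close> of the signed distance
  to the hyperplane \<open>x $ i = 0\<close>; the time coordinate is
  \<open>hyp_density x - 1\<close>.\<close>

definition hyp_X :: "'n \<Rightarrow> real ^ 'n \<Rightarrow> real" where
  "hyp_X i x = hyp_density x * x $ i"

definition hyp_grad_X :: "'n \<Rightarrow> real ^ 'n \<Rightarrow> real ^ 'n" where
  "hyp_grad_X i x = hyp_density x *\<^sub>R axis i 1 + ((hyp_density x)\<^sup>2 * x $ i) *\<^sub>R x"

lemma hyp_density_eqs: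
  assumes "x \<in> hyp_space"
  shows "hyp_density x * (1 - x \<bullet> x) = 2" "hyp_density x * (x \<bullet> x) = hyp_density x - 2"
proof -
  define c where "c = 1 - x \<bullet> x"
  have "x \<bullet> x < 1" using assms by (simp add: hyp_space_norm dot_square_norm abs_square_less_1)
  then have "c \<noteq> 0" by (simp add: c_def)
  moreover have "hyp_density x = 2 / c" by (simp add: c_def hyp_density_def dot_square_norm)
  ultimately have "hyp_density x * c = 2" by simp
  then show "hyp_density x * (1 - x \<bullet> x) = 2" by (simp only: c_def)
  then show "hyp_density x * (x \<bullet> x) = hyp_density x - 2" by (simp add: algebra_simps)
qed

text \<open>\<open>hyp_density\<close> is \<open>2 / (1 - s)\<close> at
  \<open>s = x \<bullet> x\<close>. The Laplacian found says that the time coordinate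
  \<open>hyp_density x - 1\<close> of the hyperboloid is reproduced with the factor n.\<close>

lemma hyp_jet_density:
  "hyp_jet hyp_density (\<lambda>x. (hyp_density x)\<^sup>2 *\<^sub>R x) (\<lambda>x :: real ^ 'n. real CARD('n) * (hyp_density x - 1))"
proof -
  have sq: "hyp_jet (\<lambda>x :: real ^ 'n. x \<bullet> x) (\<lambda>x. 2 *\<^sub>R x)
    (\<lambda>x. (2 * real CARD('n) + (real CARD('n) - 2) * hyp_density x * (2 * (x \<bullet> x))) / (hyp_density x)\<^sup>2)"
    unfolding hyp_jet_def
    by (intro exI[of _ "\<lambda>x. mat 2"])
      (auto intro!: derivative_eq_intros simp: trace_mat inner_commute mat_vector_mult)
  let ?\<phi>' = "\<lambda>s :: real. 2 / (1 - s)\<^sup>2" and ?\<phi>'' = "\<lambda>s :: real. 4 / (1 - s) ^ 3"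
  have s: "x \<bullet> x < 1" if "x \<in> hyp_space" for x :: "real ^ 'n"
    using that by (simp add: hyp_space_norm dot_square_norm abs_square_less_1)
  have d: "((\<lambda>s. 2 / (1 - s)) has_real_derivative ?\<phi>' s) (at s)"
    "(?\<phi>' has_real_derivative ?\<phi>'' s) (at s)" if "s < 1" for s
  proof -
    have "((\<lambda>s. inverse (1 - s)) has_real_derivative (inverse (1 - s))\<^sup>2) (at s)"
      using that by (auto intro!: derivative_eq_intros simp: power2_eq_square)
    from DERIV_cmult[OF this, of 2] DERIV_cmult[OF DERIV_power[OF this, of 2], of 2]
    show "((\<lambda>s. 2 / (1 - s)) has_real_derivative ?\<phi>' s) (at s)"
      "(?\<phi>' has_real_derivative ?\<phi>'' s) (at s)"
      by (simp_all add: divide_inverse power_inverse power_numeral_reduce mult.assoc)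
  qed
  have "continuous_on ((\<lambda>x :: real ^ 'n. x \<bullet> x) ` hyp_space) ?\<phi>''"
    using s by (intro continuous_intros) force
  from hyp_jet_compose[OF sq d(1)[OF s] d(2)[OF s] this]
  show ?thesis
  proof (rule hyp_jet_eq)
    fix x :: "real ^ 'n" assume x: "x \<in> hyp_space"
    show "2 / (1 - x \<bullet> x) = hyp_density x" by (simp add: hyp_density_def dot_square_norm)
    have p: "2 / (1 - x \<bullet> x)\<^sup>2 = (hyp_density x)\<^sup>2 / 2" "4 / (1 - x \<bullet> x) ^ 3 = (hyp_density x) ^ 3 / 2"
      by (simp_all add: hyp_density_def dot_square_norm power_divide)
    then show "?\<phi>' (x \<bullet> x) *\<^sub>R 2 *\<^sub>R x = (hyp_density x)\<^sup>2 *\<^sub>R x" by simp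
    have "((hyp_density x)\<^sup>2 / 2 * (2 * n + (n - 2) * hyp_density x * (2 * (x \<bullet> x)))
        + (hyp_density x) ^ 3 / 2 * (4 * (x \<bullet> x))) / (hyp_density x)\<^sup>2 = n * (hyp_density x - 1)" for n
    proof -
      have nz: "(hyp_density x)\<^sup>2 \<noteq> 0" using hyp_density_pos[OF x] by simp
      have eq: "(hyp_density x)\<^sup>2 / 2 * (2 * n + (n - 2) * hyp_density x * (2 * (x \<bullet> x)))
        + (hyp_density x) ^ 3 / 2 * (4 * (x \<bullet> x))
        = (hyp_density x)\<^sup>2 * (n + n * (hyp_density x * (x \<bullet> x)))"
        by (simp add: algebra_simps power2_eq_square power3_eq_cube)
      show ?thesis
        unfolding eq nonzero_mult_div_cancel_left[OF nz] hyp_density_eqs(2)[OF x] by (simp add: algebra_simps)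
    qed
    note this[of "real CARD('n)"]
    moreover have split: "a / 2 * (A / c) + b / 2 * (B / c) = (a / 2 * A + b / 2 * B) / c" for a b c A B :: real
      by (simp add: add_divide_distrib)
    moreover have in4: "hyp_inner x (2 *\<^sub>R x) (2 *\<^sub>R x) = 4 * (x \<bullet> x) / (hyp_density x)\<^sup>2"
      by (simp add: hyp_inner_def)
    ultimately
    show "?\<phi>' (x \<bullet> x) * ((2 * real CARD('n) + (real CARD('n) - 2) * hyp_density x * (2 * (x \<bullet> x))) / (hyp_density x)\<^sup>2)
        + ?\<phi>'' (x \<bullet> x) * hyp_inner x (2 *\<^sub>R x) (2 *\<^sub>R x) = real CARD('n) * (hyp_density x - 1)"
      unfolding p in4 by (simp only: split)
  qed
qed

lemma hyp_jet_X: "hyp_jet (hyp_X i) (hyp_grad_X i) (\<lambda>x :: real ^ 'n. real CARD('n) * hyp_X i x)"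
proof -
  have "hyp_jet (\<lambda>x :: real ^ 'n. x $ i) (\<lambda>x. axis i 1)
    (\<lambda>x. (real CARD('n) - 2) * hyp_density x * x $ i / (hyp_density x)\<^sup>2)"
    unfolding hyp_jet_def
  proof (intro exI[of _ "\<lambda>x. 0"] conjI ballI)
    fix x :: "real ^ 'n"
    have "(\<lambda>h. axis i 1 \<bullet> h) = (\<lambda>h :: real ^ 'n. h $ i)" by (simp add: fun_eq_iff inner_axis')
    then show "((\<lambda>x. x $ i) has_derivative (\<lambda>h. axis i 1 \<bullet> h)) (at x)"
      by (simp add: bounded_linear.has_derivative[OF bounded_linear_vec_nth has_derivative_ident])
    show "((\<lambda>x. axis i 1) has_derivative (\<lambda>h. 0 *v h)) (at x)"
      by (auto simp: fun_eq_iff intro!: has_derivative_eq_rhs[OF has_derivative_const])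
  qed (auto simp: trace_def inner_axis)
  from hyp_jet_mult[OF hyp_jet_density this] show ?thesis
  proof (rule hyp_jet_eq)
    fix x :: "real ^ 'n" assume x: "x \<in> hyp_space"
    show "hyp_density x * x $ i = hyp_X i x" by (simp add: hyp_X_def)
    show "hyp_density x *\<^sub>R axis i 1 + x $ i *\<^sub>R (hyp_density x)\<^sup>2 *\<^sub>R x = hyp_grad_X i x"
      by (simp add: hyp_grad_X_def mult.commute)
    show "hyp_density x * ((real CARD('n) - 2) * hyp_density x * x $ i / (hyp_density x)\<^sup>2) +
       x $ i * (real CARD('n) * (hyp_density x - 1)) +
       2 * hyp_inner x ((hyp_density x)\<^sup>2 *\<^sub>R x) (axis i 1) = real CARD('n) * hyp_X i x"
      using hyp_density_pos[OF x]
      by (simp add: hyp_inner_def inner_axis hyp_X_def field_simps power2_eq_square)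
  qed
qed

text \<open>On the hyperboloid the gradient of a linear coordinate is the tangential part of a
  coordinate vector; the product of the two coordinates is the correction by the normal
  parts.\<close>

lemma hyp_inner_grad_X:
  assumes x: "x \<in> hyp_space"
  shows "hyp_inner x (hyp_grad_X i x) (hyp_grad_X j x) = (if i = j then 1 else 0) + hyp_X i x * hyp_X j x"
proof -
  define r where "r = hyp_density x"
  have r: "0 < r" "r * (x \<bullet> x) = r - 2" using hyp_density_pos[OF x] hyp_density_eqs[OF x] by (auto simp: r_def)
  have "hyp_grad_X i x \<bullet> hyp_grad_X j x
      = r\<^sup>2 * (if i = j then 1 else 0) + r\<^sup>2 * x $ i * x $ j * (r * 2 + r * (r * (x \<bullet> x)))"
    by (simp add: hyp_grad_X_def inner_add_left inner_add_right inner_axis inner_axis' inner_axis_axis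
        flip: r_def) (simp add: algebra_simps power2_eq_square axis_def)
  also have "\<dots> = r\<^sup>2 * ((if i = j then 1 else 0) + hyp_X i x * hyp_X j x)"
    unfolding r(2) by (simp add: hyp_X_def algebra_simps power2_eq_square flip: r_def)
  finally show ?thesis using r(1) by (simp add: hyp_inner_def flip: r_def)
qed

text \<open>With \<open>X\<^sub>i\<close> the hyperboloid coordinates, \<open>Y\<^sub>k = X\<^sub>k / \<surd>S\<^sub>k\<close> where \<open>S\<^sub>k = 1 + \<Sum>j<k. X\<^sub>j\<^sup>2\<close>: this is
  \<open>sinh t\<^sub>k\<close> for the iterated Fermi coordinates \<open>dt\<^sub>0\<^sup>2 + cosh\<^sup>2 t\<^sub>0 (dt\<^sub>1\<^sup>2 + cosh\<^sup>2 t\<^sub>1 (\<dots>))\<close>.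
  The parameter e enumerates the axes.\<close>

definition hyp_S :: "(nat \<Rightarrow> 'n) \<Rightarrow> nat \<Rightarrow> real ^ 'n \<Rightarrow> real" where
  "hyp_S e k x = 1 + (\<Sum>j<k. (hyp_X (e j) x)\<^sup>2)"

definition hyp_Y :: "(nat \<Rightarrow> 'n) \<Rightarrow> nat \<Rightarrow> real ^ 'n \<Rightarrow> real" where
  "hyp_Y e k x = hyp_X (e k) x / sqrt (hyp_S e k x)"

definition hyp_grad_S :: "(nat \<Rightarrow> 'n) \<Rightarrow> nat \<Rightarrow> real ^ 'n \<Rightarrow> real ^ 'n" where
  "hyp_grad_S e k x = (\<Sum>j<k. (2 * hyp_X (e j) x) *\<^sub>R hyp_grad_X (e j) x)"

definition hyp_grad_Y :: "(nat \<Rightarrow> 'n) \<Rightarrow> nat \<Rightarrow> real ^ 'n \<Rightarrow> real ^ 'n" where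
  "hyp_grad_Y e k x = (1 / sqrt (hyp_S e k x)) *\<^sub>R hyp_grad_X (e k) x
     + (- hyp_X (e k) x / (2 * hyp_S e k x * sqrt (hyp_S e k x))) *\<^sub>R hyp_grad_S e k x"

section \<open>Fermi coordinates: gradients, Laplacians and separation of variables\<close>

lemma hyp_S_ge_1: "1 \<le> hyp_S e k x"
  by (simp add: hyp_S_def sum_nonneg)

lemma hyp_S_pos: "0 < hyp_S e k x"
  using hyp_S_ge_1[of e k x] by linarith

lemma hyp_S_Suc: "hyp_S e (Suc k) x = hyp_S e k x + (hyp_X (e k) x)\<^sup>2"
  by (simp add: hyp_S_def)

text \<open>Hence \<open>hyp_S e k\<close> is the product of the
  \<open>cosh\<^sup>2 t\<^sub>j\<close> over j < k, the warping factor in front of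
  \<open>dt\<^sub>k\<^sup>2\<close>.\<close>

lemma hyp_S_Suc_mult: "hyp_S e (Suc k) x = hyp_S e k x * (1 + (hyp_Y e k x)\<^sup>2)"
  using hyp_S_pos[of e k x] by (simp add: hyp_S_Suc hyp_Y_def power_divide distrib_left)

lemma DERIV_inverse_sqrt:
  assumes "0 < s"
  shows "((\<lambda>s. 1 / sqrt s) has_real_derivative - 1 / (2 * s * sqrt s)) (at s)"
    and "((\<lambda>s. - 1 / (2 * s * sqrt s)) has_real_derivative 3 / (4 * s\<^sup>2 * sqrt s)) (at s)"
proof -
  have q: "sqrt s * sqrt s = s" "sqrt s \<noteq> 0" using assms by auto
  have qq: "sqrt s * (sqrt s * z) = s * z" for z by (simp only: mult.assoc[symmetric] q)
  show "((\<lambda>s. 1 / sqrt s) has_real_derivative - 1 / (2 * s * sqrt s)) (at s)"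
    using assms q by (auto intro!: derivative_eq_intros simp: field_simps)
  show "((\<lambda>s. - 1 / (2 * s * sqrt s)) has_real_derivative 3 / (4 * s\<^sup>2 * sqrt s)) (at s)"
    using assms q by (auto intro!: derivative_eq_intros simp: field_simps power2_eq_square qq)
qed

context
  fixes e :: "nat \<Rightarrow> 'n::finite"
  assumes inj_e: "inj_on e {..<CARD('n)}"
begin

lemma e_eq_iff: "j < CARD('n) \<Longrightarrow> k < CARD('n) \<Longrightarrow> e j = e k \<longleftrightarrow> j = k"
  using inj_onD[OF inj_e] by auto

lemma hyp_inner_grad_S_X:
  assumes x: "x \<in> hyp_space" and k: "k \<le> CARD('n)" and j: "j < CARD('n)"
  shows "hyp_inner x (hyp_grad_S e k x) (hyp_grad_X (e j) x)
    = 2 * hyp_X (e j) x * (if j < k then hyp_S e k x else hyp_S e k x - 1)"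
proof -
  have "hyp_inner x (hyp_grad_S e k x) (hyp_grad_X (e j) x)
      = (\<Sum>i<k. 2 * hyp_X (e i) x * ((if i = j then 1 else 0) + hyp_X (e i) x * hyp_X (e j) x))"
    unfolding hyp_grad_S_def hyp_inner_sum
    by (intro sum.cong refl) (use k j in \<open>simp add: hyp_inner_simps hyp_inner_grad_X[OF x] e_eq_iff\<close>)
  also have "\<dots> = (\<Sum>i<k. if i = j then 2 * hyp_X (e i) x else 0) + 2 * hyp_X (e j) x * (hyp_S e k x - 1)"
    unfolding hyp_S_def add_diff_cancel_left' sum_distrib_left sum.distrib[symmetric]
    by (intro sum.cong refl) (simp add: algebra_simps power2_eq_square)
  also have "(\<Sum>i<k. if i = j then 2 * hyp_X (e i) x else 0) = (if j < k then 2 * hyp_X (e j) x else 0)"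
    by simp
  finally show ?thesis by (cases "j < k") (simp_all add: algebra_simps)
qed

lemma hyp_inner_grad_S_S:
  assumes x: "x \<in> hyp_space" and k: "k \<le> CARD('n)" and l: "l \<le> k"
  shows "hyp_inner x (hyp_grad_S e k x) (hyp_grad_S e l x) = 4 * hyp_S e k x * (hyp_S e l x - 1)"
proof -
  have "hyp_inner x (hyp_grad_S e k x) (hyp_grad_S e l x)
      = (\<Sum>j<l. 2 * hyp_X (e j) x * (2 * hyp_X (e j) x * hyp_S e k x))"
    unfolding hyp_inner_commute[of x "hyp_grad_S e k x"] hyp_grad_S_def[of e l] hyp_inner_sum
    by (intro sum.cong refl) (use k l in
        \<open>simp add: hyp_inner_simps hyp_inner_commute[of x _ "hyp_grad_S e k x"] hyp_inner_grad_S_X[OF x]\<close>)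
  also have "\<dots> = 4 * hyp_S e k x * (hyp_S e l x - 1)"
    unfolding hyp_S_def[of e l] by (simp add: sum_distrib_left) (simp add: algebra_simps power2_eq_square)
  finally show ?thesis .
qed

lemma hyp_jet_S:
  "k \<le> CARD('n) \<Longrightarrow> hyp_jet (hyp_S e k) (hyp_grad_S e k)
     (\<lambda>x. 2 * (real CARD('n) + 1) * (hyp_S e k x - 1) + 2 * real k)"
proof (induction k)
  case 0
  show ?case by (rule hyp_jet_eq[OF hyp_jet_const[of 1]]) (auto simp: hyp_S_def hyp_grad_S_def)
next
  case (Suc k)
  show ?case
  proof (rule hyp_jet_eq[OF hyp_jet_add[OF Suc.IH hyp_jet_mult[OF hyp_jet_X[of "e k"] hyp_jet_X[of "e k"]]]])
    fix x :: "real ^ 'n" assume x: "x \<in> hyp_space"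
    show "hyp_S e k x + hyp_X (e k) x * hyp_X (e k) x = hyp_S e (Suc k) x"
      by (simp add: hyp_S_Suc power2_eq_square)
    show "hyp_grad_S e k x + (hyp_X (e k) x *\<^sub>R hyp_grad_X (e k) x + hyp_X (e k) x *\<^sub>R hyp_grad_X (e k) x)
      = hyp_grad_S e (Suc k) x"
      by (simp add: hyp_grad_S_def scaleR_add_left[symmetric])
    show "2 * (real CARD('n) + 1) * (hyp_S e k x - 1) + 2 * real k +
       (hyp_X (e k) x * (real CARD('n) * hyp_X (e k) x) + hyp_X (e k) x * (real CARD('n) * hyp_X (e k) x)
        + 2 * hyp_inner x (hyp_grad_X (e k) x) (hyp_grad_X (e k) x))
      = 2 * (real CARD('n) + 1) * (hyp_S e (Suc k) x - 1) + 2 * real (Suc k)"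
      by (simp add: hyp_inner_grad_X[OF x] hyp_S_Suc algebra_simps power2_eq_square)
  qed (use Suc.prems in simp)
qed

text \<open>On functions of \<open>t\<^sub>k\<close> alone the Laplacian is
  \<open>1 / S\<^sub>k\<close> times that of the (n - k)-dimensional hyperbolic space of the
  remaining coordinates, where \<open>sinh t\<^sub>k\<close> is a hyperboloid coordinate with factor
  n - k. The computation is the product rule for \<open>X\<^sub>k\<close> and
  \<open>1 / sqrt S\<^sub>k\<close>.\<close>

lemma hyp_jet_Y:
  assumes k: "k < CARD('n)"
  shows "hyp_jet (hyp_Y e k) (hyp_grad_Y e k)
    (\<lambda>x. real (CARD('n) - k) * hyp_Y e k x / hyp_S e k x)"
proof -
  have "continuous_on (hyp_S e k ` hyp_space) (\<lambda>s. 3 / (4 * s\<^sup>2 * sqrt s))"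
    using hyp_S_pos[of e k] by (intro continuous_intros) (auto simp: less_le)
  from hyp_jet_mult[OF hyp_jet_X[of "e k"] hyp_jet_compose[OF hyp_jet_S[OF less_imp_le[OF k]] DERIV_inverse_sqrt(1)[OF hyp_S_pos]
      DERIV_inverse_sqrt(2)[OF hyp_S_pos] this]]
  show ?thesis
  proof (rule hyp_jet_eq)
    fix x :: "real ^ 'n" assume x: "x \<in> hyp_space"
    define S where "S = hyp_S e k x"
    define X where "X = hyp_X (e k) x"
    have S: "0 < S" "0 < sqrt S" using hyp_S_pos by (auto simp: S_def)
    show "hyp_X (e k) x * (1 / sqrt (hyp_S e k x)) = hyp_Y e k x"
      by (simp add: hyp_Y_def)
    show "hyp_X (e k) x *\<^sub>R (- 1 / (2 * hyp_S e k x * sqrt (hyp_S e k x))) *\<^sub>R hyp_grad_S e k x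
        + (1 / sqrt (hyp_S e k x)) *\<^sub>R hyp_grad_X (e k) x = hyp_grad_Y e k x"
      by (simp add: hyp_grad_Y_def add.commute)
    have n: "real (CARD('n) - k) = real CARD('n) - real k" using k by simp
    have inner: "hyp_inner x (hyp_grad_X (e k) x) (hyp_grad_S e k x) = 2 * X * (S - 1)"
      "hyp_inner x (hyp_grad_S e k x) (hyp_grad_S e k x) = 4 * S * (S - 1)"
      using hyp_inner_grad_S_X[OF x, of k k] hyp_inner_grad_S_S[OF x, of k k] k
      by (simp_all add: S_def X_def hyp_inner_commute[of x "hyp_grad_X (e k) x"])
    have alg: "X * (- 1 / (2 * S * r) * (2 * (m + 1) * (S - 1) + 2 * l) + 3 / (4 * S\<^sup>2 * r) * (4 * S * (S - 1)))
      + 1 / r * (m * X) + 2 * ((- 1 / (2 * S * r)) * (2 * X * (S - 1)))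
      = (m - l) * (X / r) / S" if "0 < r" for r m l :: real
      using S that by (simp add: field_simps power2_eq_square)
    show "hyp_X (e k) x * (- 1 / (2 * hyp_S e k x * sqrt (hyp_S e k x))
          * (2 * (real CARD('n) + 1) * (hyp_S e k x - 1) + 2 * real k)
        + 3 / (4 * (hyp_S e k x)\<^sup>2 * sqrt (hyp_S e k x)) * hyp_inner x (hyp_grad_S e k x) (hyp_grad_S e k x))
      + 1 / sqrt (hyp_S e k x) * (real CARD('n) * hyp_X (e k) x)
      + 2 * hyp_inner x (hyp_grad_X (e k) x) ((- 1 / (2 * hyp_S e k x * sqrt (hyp_S e k x))) *\<^sub>R hyp_grad_S e k x)
      = real (CARD('n) - k) * hyp_Y e k x / hyp_S e k x"
      unfolding hyp_inner_simps inner n hyp_Y_def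
      unfolding S_def[symmetric] X_def[symmetric]
      by (rule alg[OF S(2)])
  qed
qed

lemma hyp_inner_grad_Y_self:
  assumes x: "x \<in> hyp_space" and k: "k < CARD('n)"
  shows "hyp_inner x (hyp_grad_Y e k x) (hyp_grad_Y e k x) = (1 + (hyp_Y e k x)\<^sup>2) / hyp_S e k x"
proof -
  define S where "S = hyp_S e k x"
  define X where "X = hyp_X (e k) x"
  define r where "r = sqrt S"
  have "0 < S" unfolding S_def by (rule hyp_S_pos)
  then have S: "0 < S" "0 < r" "r * r = S" by (simp_all add: r_def)
  have inner: "hyp_inner x (hyp_grad_S e k x) (hyp_grad_X (e k) x) = 2 * X * (S - 1)"
    "hyp_inner x (hyp_grad_X (e k) x) (hyp_grad_S e k x) = 2 * X * (S - 1)"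
    "hyp_inner x (hyp_grad_S e k x) (hyp_grad_S e k x) = 4 * S * (S - 1)"
    "hyp_inner x (hyp_grad_X (e k) x) (hyp_grad_X (e k) x) = 1 + X\<^sup>2"
    using hyp_inner_grad_S_X[OF x, of k k] hyp_inner_grad_S_S[OF x, of k k] hyp_inner_grad_X[OF x, of "e k" "e k"] k
    by (simp_all add: S_def X_def hyp_inner_commute[of x "hyp_grad_X (e k) x" "hyp_grad_S e k x"] power2_eq_square)
  have "hyp_inner x (hyp_grad_Y e k x) (hyp_grad_Y e k x)
    = ((1 + X\<^sup>2) - 2 * (X / (2 * S)) * (2 * X * (S - 1)) + (X / (2 * S))\<^sup>2 * (4 * S * (S - 1))) / (r * r)"
    unfolding hyp_grad_Y_def hyp_inner_simps inner
    unfolding S_def[symmetric] X_def[symmetric] r_def[symmetric]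
    using S(1,2) by (simp add: field_simps power2_eq_square)
  also have "\<dots> = (1 + X\<^sup>2 / S) / S"
    unfolding S(3) using S(1) by (simp add: field_simps power2_eq_square)
  finally show ?thesis using S by (simp add: hyp_Y_def power_divide S_def X_def)
qed

text \<open>Fermi coordinates are orthogonal; this removes the mixed terms of the product rule and
  lets the Laplacian separate.\<close>

lemma hyp_inner_grad_Y_Y:
  assumes x: "x \<in> hyp_space" and k: "k < CARD('n)" and j: "j < k"
  shows "hyp_inner x (hyp_grad_Y e j x) (hyp_grad_Y e k x) = 0"
proof -
  define S where "S = hyp_S e k x"
  define X where "X = hyp_X (e k) x"
  define r where "r = sqrt S"
  define S' where "S' = hyp_S e j x"
  define X' where "X' = hyp_X (e j) x"
  define r' where "r' = sqrt S'"
  have "0 < S" "0 < S'" unfolding S_def S'_def by (rule hyp_S_pos)+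
  then have S: "0 < S" "0 < r" "0 < S'" "0 < r'" by (simp_all add: r_def r'_def)
  have ne: "e j \<noteq> e k" using j k by (simp add: e_eq_iff)
  have inner: "hyp_inner x (hyp_grad_X (e j) x) (hyp_grad_X (e k) x) = X' * X"
    "hyp_inner x (hyp_grad_X (e j) x) (hyp_grad_S e k x) = 2 * X' * S"
    "hyp_inner x (hyp_grad_S e j x) (hyp_grad_X (e k) x) = 2 * X * (S' - 1)"
    "hyp_inner x (hyp_grad_S e j x) (hyp_grad_S e k x) = 4 * S * (S' - 1)"
    using hyp_inner_grad_X[OF x, of "e j" "e k"] hyp_inner_grad_S_X[OF x, of k j] hyp_inner_grad_S_X[OF x, of j k]
      hyp_inner_grad_S_S[OF x, of k j] j k ne
      hyp_inner_commute[of x "hyp_grad_X (e j) x" "hyp_grad_S e k x"]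
      hyp_inner_commute[of x "hyp_grad_S e j x" "hyp_grad_S e k x"]
    by (simp_all add: S_def X_def S'_def X'_def)
  show ?thesis
    unfolding hyp_grad_Y_def hyp_inner_simps inner
    unfolding S_def[symmetric] X_def[symmetric] r_def[symmetric] S'_def[symmetric] X'_def[symmetric] r'_def[symmetric]
    using S by (simp add: field_simps)
qed

text \<open>The potential \<open>\<mu> / (1 + y\<^sup>2)\<close> of level j, divided by the warping
  factor \<open>S\<^sub>j\<close>, has denominator \<open>S\<^sub>j\<^sub>+\<^sub>1\<close>; this
  prepares a telescoping sum. Orthogonality of the gradient to all later coordinates is carried
  through the induction, since the next factor brings in the gradient of its own coordinate.\<close>

lemma hyp_jet_level_product:
  assumes "\<And>j. j < m \<Longrightarrow> level_sol (CARD('n) - j) (\<mu> (Suc j)) (\<kappa> j) (F j)" and "m \<le> CARD('n)"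
  shows "\<exists>g. hyp_jet (\<lambda>x. \<Prod>j<m. F j (hyp_Y e j x)) g
      (\<lambda>x. (\<Sum>j<m. \<mu> (Suc j) / hyp_S e (Suc j) x - \<kappa> j / hyp_S e j x) * (\<Prod>j<m. F j (hyp_Y e j x))) \<and>
    (\<forall>x\<in>hyp_space. \<forall>k<CARD('n). m \<le> k \<longrightarrow> hyp_inner x (g x) (hyp_grad_Y e k x) = 0)"
  using assms
proof (induction m)
  case 0
  show ?case
    by (intro exI[of _ "\<lambda>_. 0"] conjI hyp_jet_eq[OF hyp_jet_const[of 1]]) (auto simp: hyp_inner_simps)
next
  case (Suc m)
  let ?u = "\<lambda>x. \<Prod>j<m. F j (hyp_Y e j x)"
  let ?c = "\<lambda>x. \<Sum>j<m. \<mu> (Suc j) / hyp_S e (Suc j) x - \<kappa> j / hyp_S e j x"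
  have "m < CARD('n)" using Suc.prems by simp
  obtain g where g: "hyp_jet ?u g (\<lambda>x. ?c x * ?u x)"
    "\<And>x k. x \<in> hyp_space \<Longrightarrow> k < CARD('n) \<Longrightarrow> m \<le> k \<Longrightarrow> hyp_inner x (g x) (hyp_grad_Y e k x) = 0"
    using Suc.IH Suc.prems by force
  obtain f' f'' where f: "\<And>y. (F m has_real_derivative f' y) (at y)" "\<And>y. (f' has_real_derivative f'' y) (at y)"
    "continuous_on UNIV f''"
    "\<And>y. (1 + y\<^sup>2) * f'' y + real (CARD('n) - m) * y * f' y = (\<mu> (Suc m) / (1 + y\<^sup>2) - \<kappa> m) * F m y"
    using Suc.prems(1)[of m] unfolding level_sol_def by auto
  let ?Y = "hyp_Y e m"
  have "hyp_jet (\<lambda>x. F m (?Y x)) (\<lambda>x. f' (?Y x) *\<^sub>R hyp_grad_Y e m x)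
     (\<lambda>x. f' (?Y x) * (real (CARD('n) - m) * ?Y x / hyp_S e m x)
        + f'' (?Y x) * hyp_inner x (hyp_grad_Y e m x) (hyp_grad_Y e m x))"
    by (rule hyp_jet_compose[OF hyp_jet_Y[OF \<open>m < CARD('n)\<close>] f(1,2)]) (auto intro: continuous_on_subset[OF f(3)])
  then have jet: "hyp_jet (\<lambda>x. F m (?Y x)) (\<lambda>x. f' (?Y x) *\<^sub>R hyp_grad_Y e m x)
     (\<lambda>x. (\<mu> (Suc m) / hyp_S e (Suc m) x - \<kappa> m / hyp_S e m x) * F m (?Y x))"
  proof (rule hyp_jet_eq)
    fix x :: "real ^ 'n" assume x: "x \<in> hyp_space"
    define S where "S = hyp_S e m x"
    define y where "y = ?Y x"
    have S: "0 < S" using hyp_S_pos by (simp add: S_def)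
    have "f' y * (real (CARD('n) - m) * y / S) + f'' y * ((1 + y\<^sup>2) / S)
        = ((1 + y\<^sup>2) * f'' y + real (CARD('n) - m) * y * f' y) / S"
      by (simp only: times_divide_eq_right add_divide_distrib[symmetric] mult_ac add.commute)
    also have "\<dots> = (\<mu> (Suc m) / (S * (1 + y\<^sup>2)) - \<kappa> m / S) * F m y"
    proof -
      have "(a / p - b) * c / S = (a / (S * p) - b / S) * c" for a p b c :: real
        by (simp add: divide_inverse algebra_simps)
      then show ?thesis unfolding f(4) .
    qed
    finally show "f' (?Y x) * (real (CARD('n) - m) * ?Y x / hyp_S e m x)
        + f'' (?Y x) * hyp_inner x (hyp_grad_Y e m x) (hyp_grad_Y e m x)
      = (\<mu> (Suc m) / hyp_S e (Suc m) x - \<kappa> m / hyp_S e m x) * F m (?Y x)"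
      unfolding hyp_inner_grad_Y_self[OF x \<open>m < CARD('n)\<close>] hyp_S_Suc_mult by (simp add: S_def y_def)
  qed auto
  let ?g = "\<lambda>x. ?u x *\<^sub>R f' (?Y x) *\<^sub>R hyp_grad_Y e m x + F m (?Y x) *\<^sub>R g x"
  have "hyp_jet (\<lambda>x. \<Prod>j<Suc m. F j (hyp_Y e j x)) ?g
      (\<lambda>x. (\<Sum>j<Suc m. \<mu> (Suc j) / hyp_S e (Suc j) x - \<kappa> j / hyp_S e j x) * (\<Prod>j<Suc m. F j (hyp_Y e j x)))"
  proof (rule hyp_jet_eq[OF hyp_jet_mult[OF g(1) jet]])
    fix x :: "real ^ 'n" assume x: "x \<in> hyp_space"
    show "?u x * ((\<mu> (Suc m) / hyp_S e (Suc m) x - \<kappa> m / hyp_S e m x) * F m (?Y x)) + F m (?Y x) * (?c x * ?u x)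
        + 2 * hyp_inner x (g x) (f' (?Y x) *\<^sub>R hyp_grad_Y e m x)
      = (\<Sum>j<Suc m. \<mu> (Suc j) / hyp_S e (Suc j) x - \<kappa> j / hyp_S e j x) * (\<Prod>j<Suc m. F j (hyp_Y e j x))"
      using g(2)[OF x \<open>m < CARD('n)\<close>] by (simp add: hyp_inner_simps algebra_simps)
  qed auto
  moreover have "hyp_inner x (?g x) (hyp_grad_Y e k x) = 0"
    if "x \<in> hyp_space" "k < CARD('n)" "Suc m \<le> k" for x k
    using g(2)[of x k] hyp_inner_grad_Y_Y[of x k m] that by (simp add: hyp_inner_simps)
  ultimately show ?case by blast
qed

end

subsection \<open>Comparison and counting of eigenvalues\<close>

lemma DERIV_along_axis:
  assumes "(u has_derivative D) (at (x + s *\<^sub>R axis i 1))"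
  shows "((\<lambda>t. u (x + t *\<^sub>R axis i 1)) has_real_derivative D (axis i 1)) (at s)"
proof -
  have "((\<lambda>t. x + t *\<^sub>R axis i 1) has_derivative (\<lambda>t. t *\<^sub>R axis i 1)) (at s)"
    by (auto intro!: derivative_eq_intros)
  from has_derivative_compose[OF this assms]
  have "((\<lambda>t. u (x + t *\<^sub>R axis i 1)) has_derivative (\<lambda>t. D (t *\<^sub>R axis i 1))) (at s)" .
  moreover have "D (t *\<^sub>R axis i 1) = D (axis i 1) * t" for t
    using has_derivative_linear[OF assms] by (simp add: linear_scale)
  ultimately show ?thesis by (simp add: has_field_derivative_def)
qed

lemma DERIV_along_axis_0:
  assumes "(u has_derivative D) (at x)"
  shows "((\<lambda>t. u (x + t *\<^sub>R axis i 1)) has_real_derivative D (axis i 1)) (at 0)"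
  using DERIV_along_axis[of u D x 0] assms by simp

lemma partial_deriv_eq:
  assumes "(u has_derivative D) (at x)"
  shows "partial_deriv i u x = D (axis i 1)"
  unfolding partial_deriv_def
  by (rule DERIV_imp_deriv[OF DERIV_along_axis_0[OF assms]])

text \<open>Product rule for \<open>\<rho> ^ (n - 2)\<close> times a partial derivative, with
  \<open>\<rho>\<^sup>2 * x $ i\<close> as the partial derivative of \<rho>. Only derivatives along
  the axes are assumed, so the formula serves jets as well as eigenfunctions, whose regularity is
  given by iterated partial derivatives.\<close>

lemma hyp_laplacian_eq:
  fixes x :: "real ^ 'n"
  assumes n: "2 \<le> CARD('n)" and x: "x \<in> hyp_space"
    and h: "\<And>i. ((\<lambda>t. partial_deriv i u (x + t *\<^sub>R axis i 1)) has_real_derivative h i) (at 0)"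
  shows "hyp_laplacian u x
    = ((\<Sum>i\<in>UNIV. h i) + (real CARD('n) - 2) * hyp_density x * (\<Sum>i\<in>UNIV. x $ i * partial_deriv i u x)) / (hyp_density x)\<^sup>2"
proof -
  obtain m where m: "CARD('n) = Suc (Suc m)" using n by (metis Suc_le_D numeral_2_eq_2 le_SucE Suc_le_mono)
  define r where "r = hyp_density x"
  have r: "0 < r" using hyp_density_pos[OF x] by (simp add: r_def)
  have d: "(hyp_density has_derivative (\<lambda>h. ((hyp_density x)\<^sup>2 *\<^sub>R x) \<bullet> h)) (at x)"
    using hyp_jet_density x unfolding hyp_jet_def by blast
  have dr: "((\<lambda>t. hyp_density (x + t *\<^sub>R axis i 1)) has_real_derivative r\<^sup>2 * x $ i) (at 0)" for i
    using DERIV_along_axis_0[OF d] by (simp add: inner_axis r_def)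
  have "partial_deriv i (\<lambda>y. hyp_density y ^ CARD('n) / (hyp_density y)\<^sup>2 * partial_deriv i u y) x
      = r ^ m * (h i + real m * r * (x $ i * partial_deriv i u x))" for i
  proof -
    let ?r = "\<lambda>t. hyp_density (x + t *\<^sub>R axis i 1)"
    have q: "((\<lambda>t. ?r t ^ CARD('n) / (?r t)\<^sup>2) has_real_derivative real m * r ^ Suc m * x $ i) (at 0)"
    proof -
      have "((\<lambda>t. ?r t ^ CARD('n) / (?r t)\<^sup>2) has_real_derivative
        (real CARD('n) * (r\<^sup>2 * x $ i * r ^ (CARD('n) - 1)) * r\<^sup>2 - r ^ CARD('n) * (2 * (r\<^sup>2 * x $ i * r)))
          / (r\<^sup>2 * r\<^sup>2)) (at 0)"
        using DERIV_divide[OF DERIV_power[OF dr[of i], of "CARD('n)"] DERIV_power[OF dr[of i], of 2]] r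
        by (simp flip: r_def)
      moreover have "(real CARD('n) * (r\<^sup>2 * x $ i * r ^ (CARD('n) - 1)) * r\<^sup>2 - r ^ CARD('n) * (2 * (r\<^sup>2 * x $ i * r)))
          = (r\<^sup>2 * r\<^sup>2) * (real m * r ^ Suc m * x $ i)"
        unfolding m by (simp add: algebra_simps power2_eq_square)
      ultimately show ?thesis using r by simp
    qed
    have "((\<lambda>t. ?r t ^ CARD('n) / (?r t)\<^sup>2 * partial_deriv i u (x + t *\<^sub>R axis i 1)) has_real_derivative
        real m * r ^ Suc m * x $ i * partial_deriv i u x + h i * (r ^ CARD('n) / r\<^sup>2)) (at 0)"
      using DERIV_mult[OF q h[of i]] by (simp flip: r_def)
    moreover have "r ^ CARD('n) / r\<^sup>2 = r ^ m" unfolding m using r by (simp add: power2_eq_square)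
    ultimately show ?thesis
      unfolding partial_deriv_def[of i "\<lambda>y. _ y * _ y"]
      by (subst DERIV_imp_deriv) (auto simp: algebra_simps partial_deriv_def)
  qed
  then have "hyp_laplacian u x = (\<Sum>i\<in>UNIV. r ^ m * (h i + real m * r * (x $ i * partial_deriv i u x))) / r ^ CARD('n)"
    by (simp add: hyp_laplacian_def r_def)
  also have "(\<Sum>i\<in>UNIV. r ^ m * (h i + real m * r * (x $ i * partial_deriv i u x)))
      = r ^ m * ((\<Sum>i\<in>UNIV. h i) + real m * r * (\<Sum>i\<in>UNIV. x $ i * partial_deriv i u x))"
    by (simp only: sum_distrib_left[symmetric] sum.distrib)
  also have "\<dots> / r ^ CARD('n) = ((\<Sum>i\<in>UNIV. h i) + real m * r * (\<Sum>i\<in>UNIV. x $ i * partial_deriv i u x)) / r\<^sup>2"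
    unfolding m using r by (simp add: power2_eq_square)
  also have "real m = real CARD('n) - 2" unfolding m by simp
  finally show ?thesis by (simp add: r_def)
qed

lemma hyp_jet_partials:
  fixes u :: "real ^ 'n \<Rightarrow> real"
  assumes "hyp_jet u g l" "2 \<le> CARD('n)"
  obtains H where "continuous_on hyp_space H"
    "\<And>x. x \<in> hyp_space \<Longrightarrow> (u has_derivative (\<lambda>h. g x \<bullet> h)) (at x)"
    "\<And>x. x \<in> hyp_space \<Longrightarrow> (g has_derivative (\<lambda>h. H x *v h)) (at x)"
    "\<And>x. x \<in> hyp_space \<Longrightarrow> l x = ((\<Sum>i\<in>UNIV. H x $ i $ i)
       + (real CARD('n) - 2) * hyp_density x * (\<Sum>i\<in>UNIV. x $ i * g x $ i)) / (hyp_density x)\<^sup>2"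
proof -
  obtain H where H: "continuous_on hyp_space H" "\<And>x. x \<in> hyp_space \<Longrightarrow>
     (u has_derivative (\<lambda>h. g x \<bullet> h)) (at x) \<and> (g has_derivative (\<lambda>h. H x *v h)) (at x) \<and>
     l x = (trace (H x) + (real CARD('n) - 2) * hyp_density x * (x \<bullet> g x)) / (hyp_density x)\<^sup>2"
    using assms(1) unfolding hyp_jet_def by blast
  have "x \<bullet> g x = (\<Sum>i\<in>UNIV. x $ i * g x $ i)" for x by (simp add: inner_vec_def)
  then show ?thesis using that[of H] H unfolding trace_def by simp
qed

lemma matrix_axis: "(A *v axis i 1) $ j = A $ j $ i" for A :: "real ^ 'n ^ 'n"
  by (simp add: matrix_vector_mult_basis column_def)

text \<open>The function v agrees with u on the open set only: the eigenfunctions will be products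
  cut off to 0 outside the box.\<close>

lemma
  fixes u :: "real ^ 'n \<Rightarrow> real"
  assumes jet: "hyp_jet u g l" and n: "2 \<le> CARD('n)" and U: "open U" "U \<subseteq> hyp_space"
    and eq: "\<And>x. x \<in> U \<Longrightarrow> u x = v x"
  shows hyp_jet_Ck_on: "Ck_on 2 v U"
    and hyp_jet_laplacian: "x \<in> U \<Longrightarrow> hyp_laplacian v x = l x"
proof -
  obtain H where H: "continuous_on hyp_space H"
    "\<And>x. x \<in> hyp_space \<Longrightarrow> (u has_derivative (\<lambda>h. g x \<bullet> h)) (at x)"
    "\<And>x. x \<in> hyp_space \<Longrightarrow> (g has_derivative (\<lambda>h. H x *v h)) (at x)"
    "\<And>x. x \<in> hyp_space \<Longrightarrow> l x = ((\<Sum>i\<in>UNIV. H x $ i $ i)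
       + (real CARD('n) - 2) * hyp_density x * (\<Sum>i\<in>UNIV. x $ i * g x $ i)) / (hyp_density x)\<^sup>2"
    by (rule hyp_jet_partials[OF jet n]) blast
  have dv: "(v has_derivative (\<lambda>h. g x \<bullet> h)) (at x)" if "x \<in> U" for x
    using has_derivative_transform_within_open[OF H(2) U(1) that eq] U(2) that by blast
  have p: "partial_deriv i v x = g x $ i" if "x \<in> U" for x i
    using partial_deriv_eq[OF dv[OF that]] by (simp add: inner_axis)
  have dg: "((\<lambda>x. g x $ i) has_derivative (\<lambda>h. (H x *v h) $ i)) (at x)" if "x \<in> U" for x i
    using bounded_linear.has_derivative[OF bounded_linear_vec_nth H(3)] U(2) that by blast
  have dp: "(partial_deriv i v has_derivative (\<lambda>h. (H x *v h) $ i)) (at x)" if "x \<in> U" for x i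
    using has_derivative_transform_within_open[OF dg[OF that] U(1) that] p by simp
  have pp: "partial_deriv j (partial_deriv i v) x = H x $ i $ j" if "x \<in> U" for x i j
    using partial_deriv_eq[OF dp[OF that]] by (simp add: matrix_axis)
  have "continuous_on U (\<lambda>x. H x $ i $ j)" for i j
    by (intro continuous_intros continuous_on_subset[OF H(1) U(2)])
  then have "continuous_on U (partial_deriv j (partial_deriv i v))" for i j
    by (rule continuous_on_eq) (simp add: pp)
  moreover have "v differentiable_on U" "partial_deriv i v differentiable_on U" for i
    unfolding differentiable_on_def differentiable_def
    using dv dp has_derivative_at_withinI by blast+
  ultimately show "Ck_on 2 v U"
    by (simp add: numeral_2_eq_2)
  assume x: "x \<in> U"
  have "((\<lambda>t. partial_deriv i v (x + t *\<^sub>R axis i 1)) has_real_derivative H x $ i $ i) (at 0)" for i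
    using DERIV_along_axis_0[OF dp[OF x, of i]] by (simp add: matrix_axis)
  from hyp_laplacian_eq[OF n _ this] show "hyp_laplacian v x = l x"
    using H(4)[of x] x U(2) by (auto simp: p)
qed

lemma second_derivative_at_local_max:
  fixes f :: "real \<Rightarrow> real"
  assumes "0 < d" and f: "\<And>t. \<bar>t\<bar> < d \<Longrightarrow> (f has_real_derivative f' t) (at t)"
    and f': "(f' has_real_derivative c) (at 0)" and max: "\<And>t. \<bar>t\<bar> < d \<Longrightarrow> f t \<le> f 0"
  shows "f' 0 = 0" "c \<le> 0"
proof -
  show 0: "f' 0 = 0"
    by (rule DERIV_local_max[OF f[of 0]]) (use assms in auto)
  show "c \<le> 0"
  proof (rule ccontr)
    assume "\<not> c \<le> 0"
    then obtain e where e: "0 < e" "\<And>h. 0 < h \<Longrightarrow> h < e \<Longrightarrow> 0 < f' h"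
      using DERIV_pos_inc_right[OF f'] 0 by auto
    define t where "t = min d e / 2"
    have t: "0 < t" "t < d" "t < e" using \<open>0 < d\<close> e(1) by (auto simp: t_def)
    obtain z where z: "0 < z" "z < t" "f t - f 0 = (t - 0) * f' z"
      using MVT2[of 0 t f f'] f t by auto
    then have "0 < f t - f 0" using e(2)[of z] t by simp
    then show False using max[of t] t by simp
  qed
qed

text \<open>At an interior maximum of the quotient by a positive supersolution w, the eigenfunction touches a
  multiple of w from below.\<close>

lemma eigenfunction_zero_if_supersolution:
  fixes \<Omega> :: "(real ^ 'n) set"
  assumes n: "2 \<le> CARD('n)" and \<Omega>: "compact \<Omega>" "\<Omega> \<subseteq> hyp_space" and jet: "hyp_jet w g l"
    and pos: "\<And>x. x \<in> \<Omega> \<Longrightarrow> 0 < w x" and super: "\<And>x. x \<in> \<Omega> \<Longrightarrow> l x \<le> - \<kappa> * w x"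
    and v: "v \<in> dirichlet_eigenspace \<Omega> \<mu>" and "\<mu> < \<kappa>"
  shows "v x = 0"
proof (rule ccontr)
  assume x: "v x \<noteq> 0"
  have v_cont: "continuous_on \<Omega> v" and v_C2: "Ck_on 2 v (interior \<Omega>)"
    and v_eq: "\<And>x. x \<in> interior \<Omega> \<Longrightarrow> - hyp_laplacian v x = \<mu> * v x"
    and v_out: "\<And>x. x \<notin> interior \<Omega> \<Longrightarrow> v x = 0"
    using v by (auto simp: dirichlet_eigenspace_def)
  \<comment> \<open>This sign makes the maximum of the quotient positive; since v vanishes off the
    interior, the maximum point z is then interior.\<close>
  define c where "c = sgn (v x)"
  have c: "0 < c * v x" using x by (simp add: c_def sgn_mult_self_eq mult.commute flip: abs_sgn)
  have xO: "x \<in> \<Omega>" using x v_out interior_subset by blast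
  have "continuous_on \<Omega> (\<lambda>y. c * v y / w y)"
    using continuous_on_subset[OF hyp_jet_continuous(1)[OF jet] \<Omega>(2)] v_cont pos
    by (intro continuous_intros) (auto simp: less_le)
  then obtain z where z: "z \<in> \<Omega>" "\<And>y. y \<in> \<Omega> \<Longrightarrow> c * v y / w y \<le> c * v z / w z"
    using continuous_attains_sup[OF \<Omega>(1)] xO by blast
  define q where "q = c * v z / w z"
  have "0 < c * v x / w x" using c pos[OF xO] by simp
  then have q: "0 < q" using z(2)[OF xO] by (simp add: q_def)
  have vz: "c * v z = q * w z" using pos[OF z(1)] by (simp add: q_def)
  have "v z \<noteq> 0" using vz q pos[OF z(1)] by auto
  then have zi: "z \<in> interior \<Omega>" using v_out by blast
  have zh: "z \<in> hyp_space" using z \<Omega> by blast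
  have le: "c * v y - q * w y \<le> 0" if "y \<in> \<Omega>" for y
    using z(2)[OF that] pos[OF that] by (simp add: q_def pos_divide_le_eq)
  obtain H where H: "continuous_on hyp_space H"
    "\<And>x. x \<in> hyp_space \<Longrightarrow> (w has_derivative (\<lambda>h. g x \<bullet> h)) (at x)"
    "\<And>x. x \<in> hyp_space \<Longrightarrow> (g has_derivative (\<lambda>h. H x *v h)) (at x)"
    "\<And>x. x \<in> hyp_space \<Longrightarrow> l x = ((\<Sum>i\<in>UNIV. H x $ i $ i)
       + (real CARD('n) - 2) * hyp_density x * (\<Sum>i\<in>UNIV. x $ i * g x $ i)) / (hyp_density x)\<^sup>2"
    by (rule hyp_jet_partials[OF jet n]) blast
  obtain d where d: "0 < d" "ball z d \<subseteq> interior \<Omega>" using open_contains_ball[of "interior \<Omega>"] zi by auto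
  have near: "z + t *\<^sub>R axis i 1 \<in> interior \<Omega>" if "\<bar>t\<bar> < d" for t i
    using d(2) that by (auto simp: dist_norm norm_axis_1 intro!: subsetD[OF d(2)])
  have sub: "interior \<Omega> \<subseteq> \<Omega>" "interior \<Omega> \<subseteq> hyp_space" using interior_subset \<Omega>(2) by auto
  have diff_at: "\<exists>D. (f has_derivative D) (at y)" if "f differentiable_on interior \<Omega>" "y \<in> interior \<Omega>"
    for f :: "real ^ 'n \<Rightarrow> real" and y
    using that unfolding differentiable_on_def differentiable_def
    by (metis at_within_open open_interior)
  have C2: "v differentiable_on interior \<Omega>" "\<And>i. partial_deriv i v differentiable_on interior \<Omega>"
    using v_C2 by (auto simp: numeral_2_eq_2)
  have dv: "((\<lambda>t. v (z + t *\<^sub>R axis i 1)) has_real_derivative partial_deriv i v (z + t *\<^sub>R axis i 1)) (at t)"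
    if "\<bar>t\<bar> < d" for t i
    using diff_at[OF C2(1) near[OF that]] DERIV_along_axis partial_deriv_eq by metis
  define h where "h i = partial_deriv i (partial_deriv i v) z" for i
  have dpv: "((\<lambda>t. partial_deriv i v (z + t *\<^sub>R axis i 1)) has_real_derivative h i) (at 0)" for i
    using diff_at[OF C2(2) zi] DERIV_along_axis_0 partial_deriv_eq unfolding h_def by metis
  \<comment> \<open>\<open>c * v - q * w\<close> is at most 0 on the domain with equality at z.
    Testing along each axis gives equal first derivatives and ordered pure second derivatives, which
    is all that enters the Laplacian at z.\<close>
  have max: "c * partial_deriv i v z - q * g z $ i = 0" "c * h i - q * H z $ i $ i \<le> 0" for i
  proof -
    let ?f = "\<lambda>t. c * v (z + t *\<^sub>R axis i 1) - q * w (z + t *\<^sub>R axis i 1)"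
    let ?f' = "\<lambda>t. c * partial_deriv i v (z + t *\<^sub>R axis i 1) - q * g (z + t *\<^sub>R axis i 1) $ i"
    have 1: "(?f has_real_derivative ?f' t) (at t)" if "\<bar>t\<bar> < d" for t
      using DERIV_diff[OF DERIV_cmult[OF dv[OF that, of i], of c]
          DERIV_cmult[OF DERIV_along_axis[OF H(2)[OF subsetD[OF sub(2) near[OF that, of i]]]], of q]]
      by (simp add: inner_axis)
    from DERIV_diff[OF DERIV_cmult[OF dpv] DERIV_cmult[OF DERIV_along_axis_0[OF
        bounded_linear.has_derivative[OF bounded_linear_vec_nth H(3)[OF zh]]]]]
    have 2: "(?f' has_real_derivative c * h i - q * H z $ i $ i) (at 0)" by (simp add: matrix_axis)
    have 3: "?f t \<le> ?f 0" if "\<bar>t\<bar> < d" for t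
      using le[of "z + t *\<^sub>R axis i 1"] near[OF that] sub(1) vz by auto
    show "c * partial_deriv i v z - q * g z $ i = 0" "c * h i - q * H z $ i $ i \<le> 0"
      using second_derivative_at_local_max[OF d(1) 1 2 3] by simp_all
  qed
  have "c * (\<Sum>i\<in>UNIV. h i) \<le> q * (\<Sum>i\<in>UNIV. H z $ i $ i)"
    unfolding sum_distrib_left by (rule sum_mono) (use max(2) in simp)
  moreover have "c * (\<Sum>i\<in>UNIV. z $ i * partial_deriv i v z) = q * (\<Sum>i\<in>UNIV. z $ i * g z $ i)"
    unfolding sum_distrib_left by (rule sum.cong) (use max(1) in \<open>auto simp: mult.left_commute[of _ "z $ _"]\<close>)
  ultimately have "c * ((\<Sum>i\<in>UNIV. h i) + (real CARD('n) - 2) * hyp_density z * (\<Sum>i\<in>UNIV. z $ i * partial_deriv i v z))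
      \<le> q * ((\<Sum>i\<in>UNIV. H z $ i $ i) + (real CARD('n) - 2) * hyp_density z * (\<Sum>i\<in>UNIV. z $ i * g z $ i))"
    by (simp add: distrib_left mult.left_commute[of c] mult.left_commute[of q])
  then have "c * hyp_laplacian v z \<le> q * l z"
    unfolding hyp_laplacian_eq[OF n zh dpv] H(4)[OF zh] times_divide_eq_right
    by (rule divide_right_mono) simp
  also have "\<dots> \<le> q * (- \<kappa> * w z)" using super[OF z(1)] q by (intro mult_left_mono) auto
  also have "c * hyp_laplacian v z = - \<mu> * (q * w z)"
  proof -
    have "hyp_laplacian v z = - (\<mu> * v z)" using v_eq[OF zi] by linarith
    then show ?thesis unfolding vz[symmetric] by simp
  qed
  finally have "\<kappa> * (q * w z) \<le> \<mu> * (q * w z)" by (simp add: mult_ac)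
  then show False using q pos[OF z(1)] \<open>\<mu> < \<kappa>\<close> by (simp add: mult_le_cancel_right)
qed

section \<open>Counting eigenvalues\<close>

lemma dirichlet_multiplicity_ge_1:
  assumes "u \<in> dirichlet_eigenspace \<Omega> \<mu>" "u x \<noteq> 0"
  shows "1 \<le> dirichlet_multiplicity \<Omega> \<mu>"
proof -
  have "enat 1 \<le> dirichlet_multiplicity \<Omega> \<mu>"
    unfolding dirichlet_multiplicity_def
    by (rule SUP_upper) (use assms in \<open>auto simp: lin_indep_family_def intro!: exI[of _ "\<lambda>_. u"]\<close>)
  then show ?thesis by (simp add: one_enat_def)
qed

lemma dirichlet_multiplicity_eq_0:
  assumes "\<And>u x. u \<in> dirichlet_eigenspace \<Omega> \<mu> \<Longrightarrow> u x = 0"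
  shows "dirichlet_multiplicity \<Omega> \<mu> = 0"
proof -
  have "k = 0" if u: "lin_indep_family k u" "\<forall>i<k. u i \<in> dirichlet_eigenspace \<Omega> \<mu>" for k u
  proof (rule ccontr)
    assume "k \<noteq> 0"
    have "\<forall>x. (\<Sum>i<k. 1 * u i x) = 0"
      using u(2) assms by (intro allI sum.neutral) auto
    with spec[OF u(1)[unfolded lin_indep_family_def], of "\<lambda>_. 1"] have "\<forall>i<k. (1 :: real) = 0" by (rule mp)
    then show False using \<open>k \<noteq> 0\<close> by simp
  qed
  then have "dirichlet_multiplicity \<Omega> \<mu> \<le> 0"
    unfolding dirichlet_multiplicity_def by (intro SUP_least) (force simp: zero_enat_def)
  then show ?thesis by simp
qed

text \<open>Below \<open>\<kappa>\<^sub>1\<close> the count is 0, so \<open>\<kappa>\<^sub>1\<close>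
  is a lower bound of both infimum sets, and \<open>u\<^sub>1\<close> makes the set for k = 1
  nonempty. Two distinct eigenvalues up to \<open>\<kappa>\<^sub>2\<close> make the count there at
  least 2. So a lower bound for the first and an upper bound for the second eigenvalue are
  combined.\<close>

lemma fundamental_gap_le:
  assumes below: "\<And>\<mu> u x. \<mu> < \<kappa>\<^sub>1 \<Longrightarrow> u \<in> dirichlet_eigenspace \<Omega> \<mu> \<Longrightarrow> u x = 0"
    and u1: "u\<^sub>1 \<in> dirichlet_eigenspace \<Omega> \<kappa>\<^sub>1" "u\<^sub>1 x\<^sub>1 \<noteq> 0"
    and u2: "u\<^sub>2 \<in> dirichlet_eigenspace \<Omega> \<kappa>\<^sub>2" "u\<^sub>2 x\<^sub>2 \<noteq> 0" and less: "\<kappa>\<^sub>1 < \<kappa>\<^sub>2"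
  shows "fundamental_gap \<Omega> \<le> \<kappa>\<^sub>2 - \<kappa>\<^sub>1"
proof -
  have ge: "\<kappa>\<^sub>1 \<le> t" if "enat (Suc k) \<le> dirichlet_count \<Omega> t" for t k
  proof (rule ccontr)
    assume "\<not> \<kappa>\<^sub>1 \<le> t"
    then have "dirichlet_multiplicity \<Omega> \<mu> = 0" if "\<mu> \<le> t" for \<mu>
      using that by (intro dirichlet_multiplicity_eq_0 below[of \<mu>]) auto
    then have "dirichlet_count \<Omega> t \<le> 0"
      unfolding dirichlet_count_def by (intro SUP_least order_eq_refl sum.neutral) auto
    then show False using that by (simp add: enat_0_iff)
  qed
  have count: "sum (dirichlet_multiplicity \<Omega>) S \<le> dirichlet_count \<Omega> t" if "finite S" "S \<subseteq> {..t}" for S t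
    unfolding dirichlet_count_def by (rule SUP_upper) (use that in simp)
  note m = dirichlet_multiplicity_ge_1[OF u1] dirichlet_multiplicity_ge_1[OF u2]
  have 1: "enat 1 \<le> dirichlet_count \<Omega> \<kappa>\<^sub>1"
    using count[of "{\<kappa>\<^sub>1}" \<kappa>\<^sub>1] m(1) by (simp add: one_enat_def)
  have "1 + 1 \<le> sum (dirichlet_multiplicity \<Omega>) {\<kappa>\<^sub>1, \<kappa>\<^sub>2}"
    using less add_mono[OF m] by simp
  also have "\<dots> \<le> dirichlet_count \<Omega> \<kappa>\<^sub>2" using count[of "{\<kappa>\<^sub>1, \<kappa>\<^sub>2}" \<kappa>\<^sub>2] less by simp
  finally have 2: "enat 2 \<le> dirichlet_count \<Omega> \<kappa>\<^sub>2" by (simp add: one_enat_def numeral_2_eq_2)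
  have "\<kappa>\<^sub>1 \<le> dirichlet_eigenvalue \<Omega> 1"
    unfolding dirichlet_eigenvalue_def by (rule cInf_greatest) (use 1 ge[of 0] in auto)
  moreover have "dirichlet_eigenvalue \<Omega> 2 \<le> \<kappa>\<^sub>2"
    unfolding dirichlet_eigenvalue_def
    by (rule cInf_lower) (use 2 ge[of 1] in \<open>auto simp: bdd_below_def numeral_2_eq_2\<close>)
  ultimately show ?thesis by (simp add: fundamental_gap_def)
qed

subsection \<open>Convexity and diameter of boxes\<close>

text \<open>The time direction counts positive, so that points of the hyperboloid have square 1 and
  the product of two of them is \<open>cosh\<close> of their distance.\<close>

definition minkowski :: "real \<times> (real ^ 'n) \<Rightarrow> real \<times> (real ^ 'n) \<Rightarrow> real" where
  "minkowski u v = fst u * fst v - snd u \<bullet> snd v"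

definition hyperboloid :: "real ^ 'n \<Rightarrow> real \<times> (real ^ 'n)" where
  "hyperboloid x = (hyp_density x - 1, hyp_density x *\<^sub>R x)"

lemma minkowski_simps:
  "minkowski (u + v) w = minkowski u w + minkowski v w"
  "minkowski w (u + v) = minkowski w u + minkowski w v"
  "minkowski (u - v) w = minkowski u w - minkowski v w"
  "minkowski w (u - v) = minkowski w u - minkowski w v"
  "minkowski (c *\<^sub>R u) w = c * minkowski u w"
  "minkowski w (c *\<^sub>R u) = c * minkowski w u"
  by (simp_all add: minkowski_def inner_add_left inner_add_right inner_diff_left inner_diff_right algebra_simps)

lemma minkowski_commute: "minkowski u v = minkowski v u"
  by (simp add: minkowski_def inner_commute mult.commute)

lemma hyp_density_ge_2: "x \<in> hyp_space \<Longrightarrow> 2 \<le> hyp_density x"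
  using hyp_density_eqs(2)[of x] hyp_density_pos[of x] by (smt (verit) inner_ge_zero mult_nonneg_nonneg)

lemma minkowski_hyperboloid:
  assumes x: "x \<in> hyp_space" and y: "y \<in> hyp_space"
  shows "minkowski (hyperboloid x) (hyperboloid y)
    = 1 + 2 * (norm (x - y))\<^sup>2 / ((1 - (norm x)\<^sup>2) * (1 - (norm y)\<^sup>2))"
proof -
  define r where "r = hyp_density x"
  define s where "s = hyp_density y"
  have rs: "r * (x \<bullet> x) = r - 2" "s * (y \<bullet> y) = s - 2"
    using hyp_density_eqs(2) x y by (auto simp: r_def s_def)
  have "2 * (norm (x - y))\<^sup>2 / ((1 - (norm x)\<^sup>2) * (1 - (norm y)\<^sup>2)) = r * s * (norm (x - y))\<^sup>2 / 2"
    by (simp add: r_def s_def hyp_density_def)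
  also have "r * s * (norm (x - y))\<^sup>2 = s * (r * (x \<bullet> x)) + r * (s * (y \<bullet> y)) - 2 * (r * s * (x \<bullet> y))"
    unfolding power2_norm_eq_inner by (simp add: inner_diff_left inner_diff_right inner_commute algebra_simps)
  also have "\<dots> / 2 = (r - 1) * (s - 1) - 1 - r * s * (x \<bullet> y)"
    unfolding rs by (simp add: field_simps)
  finally show ?thesis by (simp add: minkowski_def hyperboloid_def r_def s_def)
qed

lemma minkowski_hyperboloid_self:
  assumes "x \<in> hyp_space"
  shows "minkowski (hyperboloid x) (hyperboloid x) = 1"
  using minkowski_hyperboloid[OF assms assms] by simp

lemma hyp_dist_facts:
  assumes x: "x \<in> hyp_space" and y: "y \<in> hyp_space"
  shows "0 \<le> hyp_dist x y" "cosh (hyp_dist x y) = minkowski (hyperboloid x) (hyperboloid y)"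
    "hyp_dist x y = 0 \<Longrightarrow> x = y"
proof -
  have p: "0 < 1 - (norm x)\<^sup>2" "0 < 1 - (norm y)\<^sup>2"
    using x y by (auto simp: hyp_space_norm abs_square_less_1)
  have ge: "1 \<le> 1 + 2 * (norm (x - y))\<^sup>2 / ((1 - (norm x)\<^sup>2) * (1 - (norm y)\<^sup>2))"
    using p by simp
  show "0 \<le> hyp_dist x y" unfolding hyp_dist_def using ge by (rule arcosh_nonneg_real)
  show "cosh (hyp_dist x y) = minkowski (hyperboloid x) (hyperboloid y)"
    unfolding hyp_dist_def minkowski_hyperboloid[OF x y] using ge by (rule cosh_arcosh_real)
  show "x = y" if "hyp_dist x y = 0"
    using that p unfolding hyp_dist_def arcosh_eq_0_iff_real[OF ge] by simp
qed

text \<open>The complement of a timelike vector is negative definite: the space part of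
  \<open>hyperboloid z\<close> is shorter than its time part, so Cauchy-Schwarz forces the time part
  of w to vanish.\<close>

lemma minkowski_lightlike_orthogonal:
  assumes z: "z \<in> hyp_space" and "minkowski w w = 0" and o: "minkowski w (hyperboloid z) = 0"
  shows "w = 0"
proof -
  define Z where "Z = hyperboloid z"
  have Z: "(snd Z) \<bullet> (snd Z) = (fst Z)\<^sup>2 - 1"
    using minkowski_hyperboloid_self[OF z] by (simp add: minkowski_def Z_def power2_eq_square)
  have w: "snd w \<bullet> snd w = (fst w)\<^sup>2" using assms(2) by (simp add: minkowski_def power2_eq_square)
  have "snd w \<bullet> snd Z = fst w * fst Z" using o by (simp add: minkowski_def Z_def)
  then have "(fst w * fst Z)\<^sup>2 \<le> (snd w \<bullet> snd w) * (snd Z \<bullet> snd Z)"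
    using Cauchy_Schwarz_ineq[of "snd w" "snd Z"] by simp
  then have "(fst w)\<^sup>2 \<le> 0" unfolding w Z by (simp add: algebra_simps power_mult_distrib)
  then have "fst w = 0" by simp
  then show ?thesis using w by (simp add: prod_eq_iff)
qed

text \<open>Equality in the triangle inequality forces z into the Minkowski cone over x and y: with
  p = d(x,z) and s = d(z,y), the vector \<open>sinh s X + sinh p Y - sinh (p + s) Z\<close> is lightlike
  and orthogonal to Z.\<close>

lemma hyp_segment_cone:
  assumes x: "x \<in> hyp_space" and y: "y \<in> hyp_space" and z: "z \<in> hyp_segment x y"
  obtains a b where "0 \<le> a" "0 \<le> b" "hyperboloid z = a *\<^sub>R hyperboloid x + b *\<^sub>R hyperboloid y"
proof -
  have zh: "z \<in> hyp_space" and eq: "hyp_dist x z + hyp_dist z y = hyp_dist x y"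
    using z by (auto simp: hyp_segment_def)
  define p where "p = hyp_dist x z"
  define s where "s = hyp_dist z y"
  define X where "X = hyperboloid x"
  define Y where "Y = hyperboloid y"
  define Z where "Z = hyperboloid z"
  have nn: "0 \<le> p" "0 \<le> s" using hyp_dist_facts(1) x y zh by (auto simp: p_def s_def)
  have m: "minkowski X X = 1" "minkowski Y Y = 1" "minkowski Z Z = 1"
    "minkowski X Z = cosh p" "minkowski Z X = cosh p" "minkowski Z Y = cosh s" "minkowski Y Z = cosh s"
    "minkowski X Y = cosh p * cosh s + sinh p * sinh s" "minkowski Y X = cosh p * cosh s + sinh p * sinh s"
    using minkowski_hyperboloid_self x y zh hyp_dist_facts(2)[OF x zh] hyp_dist_facts(2)[OF zh y]
      hyp_dist_facts(2)[OF x y] eq cosh_add[of p s]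
    by (simp_all add: X_def Y_def Z_def p_def s_def minkowski_commute)
  show ?thesis
  proof (cases "p + s = 0")
    case True
    then have "p = 0" using nn by simp
    then have "x = z" using hyp_dist_facts(3)[OF x zh] by (simp add: p_def)
    then show ?thesis using that[of 1 0] by simp
  next
    case False
    then have pos: "0 < sinh (p + s)" using nn by simp
    define W where "W = sinh s *\<^sub>R X + sinh p *\<^sub>R Y - sinh (p + s) *\<^sub>R Z"
    have sq: "(cosh p)\<^sup>2 = (sinh p)\<^sup>2 + 1" "(cosh s)\<^sup>2 = (sinh s)\<^sup>2 + 1" by (rule cosh_square_eq)+
    have "minkowski W Z = 0"
      by (simp add: W_def minkowski_simps m sinh_add algebra_simps)
    moreover have "minkowski W W = (sinh s)\<^sup>2 + (sinh p)\<^sup>2 + 2 * (sinh p)\<^sup>2 * (sinh s)\<^sup>2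
        - (sinh p)\<^sup>2 * (cosh s)\<^sup>2 - (cosh p)\<^sup>2 * (sinh s)\<^sup>2"
      by (simp add: W_def minkowski_simps m sinh_add algebra_simps power2_eq_square)
    then have "minkowski W W = 0" unfolding sq by (simp add: algebra_simps)
    ultimately have "W = 0" using minkowski_lightlike_orthogonal[OF zh] by (simp add: Z_def)
    then have "sinh (p + s) *\<^sub>R Z = sinh s *\<^sub>R X + sinh p *\<^sub>R Y" by (simp add: W_def)
    then have "(1 / sinh (p + s)) *\<^sub>R sinh (p + s) *\<^sub>R Z = (1 / sinh (p + s)) *\<^sub>R (sinh s *\<^sub>R X + sinh p *\<^sub>R Y)" by simp
    then have "Z = (sinh s / sinh (p + s)) *\<^sub>R X + (sinh p / sinh (p + s)) *\<^sub>R Y"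
      using pos by (simp add: scaleR_add_right)
    then show ?thesis
      using that[of "sinh s / sinh (p + s)" "sinh p / sinh (p + s)"] nn pos by (simp add: X_def Y_def Z_def)
  qed
qed

section \<open>Boxes in Fermi coordinates\<close>

definition hyp_box :: "(nat \<Rightarrow> 'n) \<Rightarrow> (nat \<Rightarrow> real) \<Rightarrow> (real ^ 'n::finite) set" where
  "hyp_box e \<tau> = {x \<in> hyp_space. \<forall>k<CARD('n). \<bar>hyp_Y e k x\<bar> \<le> \<tau> k}"

lemma hyp_S_eq_prod: "hyp_S e k x = (\<Prod>j<k. 1 + (hyp_Y e j x)\<^sup>2)"
  by (induction k) (simp_all add: hyp_S_Suc_mult, simp add: hyp_S_def)

lemma continuous_on_hyp_Y: "continuous_on hyp_space (hyp_Y e k)"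
proof -
  have X: "continuous_on hyp_space (hyp_X i)" for i :: 'a
    by (rule hyp_jet_continuous[OF hyp_jet_X])
  have "sqrt (hyp_S e k x) \<noteq> 0" for x using hyp_S_pos[of e k x] by simp
  moreover have "continuous_on hyp_space (hyp_S e k)"
    unfolding hyp_S_def by (intro continuous_intros X)
  ultimately show ?thesis unfolding hyp_Y_def by (intro continuous_intros X) auto
qed

context
  fixes e :: "nat \<Rightarrow> 'n::finite"
  assumes bij_e: "bij_betw e {..<CARD('n)} UNIV"
begin

lemma sum_UNIV_eq: "(\<Sum>i\<in>UNIV. f i) = (\<Sum>j<CARD('n). f (e j))" for f :: "'n \<Rightarrow> real"
  using sum.reindex_bij_betw[OF bij_e, of f] by simp

lemma hyp_S_CARD:
  assumes "x \<in> hyp_space"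
  shows "hyp_S e (CARD('n)) x = (hyp_density x - 1)\<^sup>2"
proof -
  have "(\<Sum>j<CARD('n). (hyp_X (e j) x)\<^sup>2) = (hyp_density x)\<^sup>2 * (x \<bullet> x)"
    unfolding sum_UNIV_eq[symmetric, of "\<lambda>i. (hyp_X i x)\<^sup>2"]
    by (simp add: hyp_X_def inner_vec_def sum_distrib_left power_mult_distrib power2_eq_square[of "_ $ _"])
  also have "\<dots> = hyp_density x * (hyp_density x * (x \<bullet> x))" by (simp add: power2_eq_square)
  finally show ?thesis
    unfolding hyp_density_eqs(2)[OF assms] by (simp add: hyp_S_def algebra_simps power2_eq_square)
qed

lemma hyp_S_split:
  assumes "x \<in> hyp_space" "k \<le> CARD('n)"
  shows "(hyp_density x - 1)\<^sup>2 = hyp_S e k x + (\<Sum>j=k..<CARD('n). (hyp_X (e j) x)\<^sup>2)"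
  unfolding hyp_S_CARD[OF assms(1), symmetric] hyp_S_def
  using sum.atLeastLessThan_concat[of 0 k "CARD('n)" "\<lambda>j. (hyp_X (e j) x)\<^sup>2"] assms(2)
  by (simp add: atLeast0LessThan)

text \<open>The condition \<open>X\<^sub>k\<^sup>2 \<le> t\<^sup>2 * S\<^sub>k\<close> has squares
  on both sides and does not look convex. As \<open>S\<^sub>k\<close> is the square of the time
  coordinate minus the squares \<open>X\<^sub>j\<^sup>2\<close> for j \<ge> k, moving these to the
  left leaves a weighted Euclidean norm bounded by t times the time coordinate: a convex
  cone.\<close>

lemma hyp_Y_le_iff:
  assumes x: "x \<in> hyp_space" and k: "k < CARD('n)" and t: "0 \<le> t"
  shows "\<bar>hyp_Y e k x\<bar> \<le> t \<longleftrightarrow>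
    L2_set (\<lambda>j. (if j = k then sqrt (1 + t\<^sup>2) else t) * hyp_X (e j) x) {k..<CARD('n)} \<le> t * (hyp_density x - 1)"
proof -
  let ?R = "\<Sum>j=k..<CARD('n). (hyp_X (e j) x)\<^sup>2"
  have "(\<Sum>j=k..<CARD('n). ((if j = k then sqrt (1 + t\<^sup>2) else t) * hyp_X (e j) x)\<^sup>2)
      = (\<Sum>j=k..<CARD('n). (if j = k then (hyp_X (e j) x)\<^sup>2 else 0) + t\<^sup>2 * (hyp_X (e j) x)\<^sup>2)"
    by (intro sum.cong refl) (auto simp: power_mult_distrib algebra_simps)
  also have "\<dots> = (hyp_X (e k) x)\<^sup>2 + t\<^sup>2 * ?R"
    using k by (simp add: sum.distrib sum_distrib_left)
  finally have sum: "(\<Sum>j=k..<CARD('n). ((if j = k then sqrt (1 + t\<^sup>2) else t) * hyp_X (e j) x)\<^sup>2)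
      = (hyp_X (e k) x)\<^sup>2 + t\<^sup>2 * ?R" .
  have nn: "0 \<le> t * (hyp_density x - 1)" using t hyp_density_ge_2[OF x] by simp
  have "L2_set (\<lambda>j. (if j = k then sqrt (1 + t\<^sup>2) else t) * hyp_X (e j) x) {k..<CARD('n)} \<le> t * (hyp_density x - 1)
      \<longleftrightarrow> (hyp_X (e k) x)\<^sup>2 + t\<^sup>2 * ?R \<le> (t * (hyp_density x - 1))\<^sup>2"
    unfolding L2_set_def sum using real_le_lsqrt[OF nn] sqrt_le_D by blast
  also have "\<dots> \<longleftrightarrow> (hyp_X (e k) x)\<^sup>2 \<le> t\<^sup>2 * hyp_S e k x"
    using hyp_S_split[OF x less_imp_le[OF k]] by (simp add: power_mult_distrib distrib_left)
  also have "\<dots> \<longleftrightarrow> (hyp_Y e k x)\<^sup>2 \<le> t\<^sup>2"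
    using hyp_S_pos[of e k x] by (simp add: hyp_Y_def power_divide pos_divide_le_eq)
  also have "\<dots> \<longleftrightarrow> \<bar>hyp_Y e k x\<bar> \<le> t"
    using t by (metis abs_le_square_iff abs_of_nonneg)
  finally show ?thesis by blast
qed

text \<open>On the hyperboloid a point of a segment is a nonnegative combination of the end points,
  and the cone conditions of \<open>hyp_Y_le_iff\<close> pass to such combinations by the triangle
  inequality.\<close>

lemma hyp_convex_box:
  assumes \<tau>: "\<And>k. 0 \<le> \<tau> k"
  shows "hyp_convex (hyp_box e \<tau>)"
  unfolding hyp_convex_def
proof (intro conjI ballI subsetI)
  show "\<And>x. x \<in> hyp_box e \<tau> \<Longrightarrow> x \<in> hyp_space" by (simp add: hyp_box_def)
  fix x y z assume x: "x \<in> hyp_box e \<tau>" and y: "y \<in> hyp_box e \<tau>" and z: "z \<in> hyp_segment x y"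
  have h: "x \<in> hyp_space" "y \<in> hyp_space" "z \<in> hyp_space"
    using x y z by (auto simp: hyp_box_def hyp_segment_def)
  obtain a b where ab: "0 \<le> a" "0 \<le> b" and eq: "hyperboloid z = a *\<^sub>R hyperboloid x + b *\<^sub>R hyperboloid y"
    by (rule hyp_segment_cone[OF h(1,2) z]) blast
  have eq0: "hyp_density z - 1 = a * (hyp_density x - 1) + b * (hyp_density y - 1)"
    using arg_cong[OF eq, of fst] by (simp add: hyperboloid_def)
  have eqX: "hyp_X i z = a * hyp_X i x + b * hyp_X i y" for i
    using arg_cong[OF eq, of "\<lambda>v. snd v $ i"] by (simp add: hyperboloid_def hyp_X_def)
  have "\<bar>hyp_Y e k z\<bar> \<le> \<tau> k" if k: "k < CARD('n)" for k
  proof -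
    let ?c = "\<lambda>j. if j = k then sqrt (1 + (\<tau> k)\<^sup>2) else \<tau> k"
    let ?A = "{k..<CARD('n)}"
    have le: "L2_set (\<lambda>j. ?c j * hyp_X (e j) v) ?A \<le> \<tau> k * (hyp_density v - 1)" if "v \<in> {x, y}" for v
      using hyp_Y_le_iff[OF _ k \<tau>[of k], of v] that x y h k by (auto simp: hyp_box_def)
    have "L2_set (\<lambda>j. ?c j * hyp_X (e j) z) ?A
        = L2_set (\<lambda>j. a * (?c j * hyp_X (e j) x) + b * (?c j * hyp_X (e j) y)) ?A"
      by (rule L2_set_cong) (simp_all add: eqX algebra_simps)
    also have "\<dots> \<le> L2_set (\<lambda>j. a * (?c j * hyp_X (e j) x)) ?A + L2_set (\<lambda>j. b * (?c j * hyp_X (e j) y)) ?A"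
      by (rule L2_set_triangle_ineq)
    also have "\<dots> = a * L2_set (\<lambda>j. ?c j * hyp_X (e j) x) ?A + b * L2_set (\<lambda>j. ?c j * hyp_X (e j) y) ?A"
      using ab by (simp only: L2_set_right_distrib)
    also have "\<dots> \<le> a * (\<tau> k * (hyp_density x - 1)) + b * (\<tau> k * (hyp_density y - 1))"
      using ab le[of x] le[of y] by (intro add_mono mult_left_mono) auto
    also have "\<dots> = \<tau> k * (hyp_density z - 1)" unfolding eq0 by (simp add: algebra_simps)
    finally show ?thesis using hyp_Y_le_iff[OF h(3) k \<tau>] by blast
  qed
  then show "z \<in> hyp_box e \<tau>" using h by (simp add: hyp_box_def)
qed

lemma hyp_density_le_box:
  assumes \<tau>: "(\<Prod>k<CARD('n). 1 + (\<tau> k)\<^sup>2) = C\<^sup>2" "0 \<le> C" and x: "x \<in> hyp_box e \<tau>"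
  shows "hyp_density x - 1 \<le> C"
proof -
  have h: "x \<in> hyp_space" using x by (simp add: hyp_box_def)
  have "(hyp_Y e k x)\<^sup>2 \<le> (\<tau> k)\<^sup>2" if "k < CARD('n)" for k
    using x that by (auto simp: hyp_box_def intro!: power2_le_iff_abs_le[THEN iffD2] intro: order_trans[OF abs_ge_zero])
  then have "(\<Prod>k<CARD('n). 1 + (hyp_Y e k x)\<^sup>2) \<le> (\<Prod>k<CARD('n). 1 + (\<tau> k)\<^sup>2)"
    by (intro prod_mono) auto
  then have "(hyp_density x - 1)\<^sup>2 \<le> C\<^sup>2"
    using hyp_S_CARD[OF h] by (simp add: hyp_S_eq_prod \<tau>)
  then show ?thesis using \<tau>(2) by (rule power2_le_imp_le)
qed

lemma compact_hyp_box: "compact (hyp_box e \<tau>)"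
proof -
  define C where "C = sqrt (\<Prod>k<CARD('n). 1 + (\<tau> k)\<^sup>2)"
  have C: "(\<Prod>k<CARD('n). 1 + (\<tau> k)\<^sup>2) = C\<^sup>2" "0 \<le> C"
    by (simp_all add: C_def prod_nonneg)
  \<comment> \<open>The Euclidean radius at which the density is C + 1. The box stays inside this
    smaller ball, away from the unit sphere, so closed conditions give compactness.\<close>
  define r where "r = sqrt (1 - 2 / (C + 1))"
  have r: "r < 1" using C by (simp add: r_def)
  have "norm x \<le> r" if x: "x \<in> hyp_box e \<tau>" for x
  proof -
    have h: "x \<in> hyp_space" using x by (simp add: hyp_box_def)
    have rho: "0 < hyp_density x" "hyp_density x \<le> C + 1"
      using hyp_density_pos[OF h] hyp_density_le_box[OF C x] by auto
    have "(norm x)\<^sup>2 = 1 - 2 / hyp_density x"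
      using hyp_density_eqs(2)[OF h] rho(1) by (simp add: power2_norm_eq_inner field_simps)
    also have "\<dots> \<le> 1 - 2 / (C + 1)" using rho by (simp add: divide_left_mono)
    finally show ?thesis unfolding r_def by (rule real_le_rsqrt)
  qed
  then have sub: "hyp_box e \<tau> \<subseteq> cball 0 r" by auto
  have cb: "cball 0 r \<subseteq> (hyp_space :: (real ^ 'n) set)" using r by (auto simp: hyp_space_norm)
  have "hyp_box e \<tau> = cball 0 r \<inter> (\<Inter>k\<in>{..<CARD('n)}. {x \<in> cball 0 r. \<bar>hyp_Y e k x\<bar> \<le> \<tau> k})"
    using sub cb by (auto simp: hyp_box_def)
  also have "closed \<dots>"
    by (intro closed_Int closed_INT ballI closed_cball continuous_on_closed_Collect_le continuous_intros
        continuous_on_subset[OF continuous_on_hyp_Y cb])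
  finally have "closed (hyp_box e \<tau>)" .
  then show ?thesis using sub bounded_cball bounded_subset compact_eq_bounded_closed by blast
qed

lemma interior_hyp_box:
  assumes "x \<in> hyp_space" "\<And>k. k < CARD('n) \<Longrightarrow> \<bar>hyp_Y e k x\<bar> < \<tau> k"
  shows "x \<in> interior (hyp_box e \<tau>)"
proof (rule interiorI)
  let ?U = "hyp_space \<inter> (\<Inter>k\<in>{..<CARD('n)}. hyp_space \<inter> hyp_Y e k -` {- \<tau> k<..<\<tau> k})"
  show "open ?U"
    by (intro open_Int open_INT ballI continuous_open_preimage[OF continuous_on_hyp_Y] open_hyp_space) auto
  have "- \<tau> k < hyp_Y e k x \<and> hyp_Y e k x < \<tau> k" if "k < CARD('n)" for k
    using assms(2)[OF that] by linarith
  then show "x \<in> ?U" using assms(1) by auto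
  show "?U \<subseteq> hyp_box e \<tau>"
  proof
    fix z assume z: "z \<in> ?U"
    have "\<bar>hyp_Y e k z\<bar> \<le> \<tau> k" if "k < CARD('n)" for k
    proof -
      have "z \<in> hyp_Y e k -` {- \<tau> k<..<\<tau> k}" using z that by blast
      then show ?thesis by auto
    qed
    moreover have "z \<in> hyp_space" using z by (rule IntD1)
    ultimately show "z \<in> hyp_box e \<tau>" by (simp add: hyp_box_def)
  qed
qed

text \<open>Inverse of the coordinate map: \<open>X\<^sub>k = y\<^sub>k * sqrt (\<Prod>j<k. 1 +
  y\<^sub>j\<^sup>2)\<close>, followed by the stereographic projection \<open>X / (1 + X0)\<close>
  from the hyperboloid to the ball.\<close>

lemma ex_hyp_Y:
  obtains x where "x \<in> hyp_space" "\<And>k. k < CARD('n) \<Longrightarrow> hyp_Y e k x = y k"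
proof -
  define P where "P k = (\<Prod>j<k. 1 + (y j)\<^sup>2)" for k
  define X :: "real ^ 'n" where "X = (\<chi> i. let k = inv_into {..<CARD('n)} e i in y k * sqrt (P k))"
  define X0 where "X0 = sqrt (1 + (norm X)\<^sup>2)"
  define x where "x = (1 / (1 + X0)) *\<^sub>R X"
  have P: "0 < P k" for k by (simp add: P_def prod_pos add_pos_nonneg)
  have Xe: "X $ e k = y k * sqrt (P k)" if "k < CARD('n)" for k
    using that bij_e by (simp add: X_def bij_betw_def inv_into_f_f)
  have X0: "1 \<le> X0" "X0\<^sup>2 = 1 + (norm X)\<^sup>2" by (simp_all add: X0_def)
  have "(norm x)\<^sup>2 = (norm X)\<^sup>2 / (1 + X0)\<^sup>2" using X0 by (simp add: x_def power_divide)
  also have "(norm X)\<^sup>2 = X0\<^sup>2 - 1" using X0 by simp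
  also have "X0\<^sup>2 - 1 = (X0 - 1) * (1 + X0)" by (simp add: algebra_simps power2_eq_square)
  also have "\<dots> / (1 + X0)\<^sup>2 = (X0 - 1) / (1 + X0)" using X0(1) by (simp add: power2_eq_square)
  finally have nx: "1 - (norm x)\<^sup>2 = 2 / (1 + X0)" using X0(1) by (simp add: field_simps)
  moreover have "0 < 2 / (1 + X0)" using X0(1) by simp
  ultimately have "(norm x)\<^sup>2 < 1" by linarith
  then have h: "x \<in> hyp_space" by (simp add: hyp_space_norm abs_square_less_1)
  have "hyp_density x = 1 + X0" using nx X0(1) by (simp add: hyp_density_def)
  then have X: "hyp_X i x = X $ i" for i using X0(1) by (simp add: hyp_X_def x_def)
  have "hyp_S e k x = P k" if "k \<le> CARD('n)" for k
    using that
  proof (induction k)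
    case 0
    show ?case by (simp add: hyp_S_def P_def)
  next
    case (Suc k)
    then show ?case
      using P[of k] by (simp add: hyp_S_Suc X Xe power_mult_distrib) (simp add: P_def algebra_simps)
  qed
  then have "hyp_Y e k x = y k" if "k < CARD('n)" for k
    using that P[of k] by (simp add: hyp_Y_def X Xe)
  then show ?thesis using that h by blast
qed

text \<open>The time coordinate, \<open>cosh\<close> of the distance to 0, is at most
  \<open>C = cosh (D / 2)\<close> on the box, with equality at the corners. So the box lies in the
  ball of radius D / 2 about 0, and a corner x and its opposite - x have distance D; in both cases
  \<open>C\<^sup>2 + (C\<^sup>2 - 1) = cosh D\<close> is the Minkowski product.\<close>

lemma hyp_diameter_box:
  assumes \<tau>: "\<And>k. 0 \<le> \<tau> k" and D: "0 \<le> D" "(\<Prod>k<CARD('n). 1 + (\<tau> k)\<^sup>2) = (cosh (D / 2))\<^sup>2"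
  shows "hyp_diameter (hyp_box e \<tau>) = D"
  unfolding hyp_diameter_def
proof (rule cSup_eq_maximum)
  define C where "C = cosh (D / 2)"
  have C: "1 \<le> C" "2 * C\<^sup>2 - 1 = cosh D" using cosh_double_cosh[of "D / 2"] by (auto simp: C_def cosh_real_ge_1)
  have norm_sq: "(norm (snd (hyperboloid x)))\<^sup>2 = (fst (hyperboloid x))\<^sup>2 - 1" if "x \<in> hyp_space" for x :: "real ^ 'n"
    unfolding power2_norm_eq_inner
    using minkowski_hyperboloid_self[OF that] by (simp add: minkowski_def power2_eq_square)
  obtain x where x: "x \<in> hyp_space" "\<And>k. k < CARD('n) \<Longrightarrow> hyp_Y e k x = \<tau> k"
    using ex_hyp_Y[of \<tau>] by blast
  have mx: "- x \<in> hyp_space" using x(1) by (simp add: hyp_space_norm)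
  have neg: "hyp_density (- x) = hyp_density x" "hyp_X i (- x) = - hyp_X i x" for i
    by (simp_all add: hyp_density_def hyp_X_def)
  then have "hyp_Y e k (- x) = - hyp_Y e k x" for k by (simp add: hyp_Y_def hyp_S_def)
  then have box: "x \<in> hyp_box e \<tau>" "- x \<in> hyp_box e \<tau>" using x mx \<tau> by (auto simp: hyp_box_def)
  have "(hyp_density x - 1)\<^sup>2 = C\<^sup>2"
    unfolding hyp_S_CARD[OF x(1), symmetric] hyp_S_eq_prod C_def D(2)[symmetric] by (simp add: x(2))
  then have "minkowski (hyperboloid x) (hyperboloid (- x)) = 2 * C\<^sup>2 - 1"
    using norm_sq[OF x(1)]
    by (simp add: minkowski_def hyperboloid_def neg power2_eq_square[symmetric] flip: power2_norm_eq_inner)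
  then have "cosh (hyp_dist x (- x)) = cosh D" using hyp_dist_facts(2)[OF x(1) mx] C by simp
  then have "hyp_dist x (- x) = D" using hyp_dist_facts(1)[OF x(1) mx] D(1) by simp
  then show "D \<in> (\<lambda>(x, y). hyp_dist x y) ` (hyp_box e \<tau> \<times> hyp_box e \<tau>)"
    using box by force
  fix d assume "d \<in> (\<lambda>(x, y). hyp_dist x y) ` (hyp_box e \<tau> \<times> hyp_box e \<tau>)"
  then obtain y z where yz: "y \<in> hyp_box e \<tau>" "z \<in> hyp_box e \<tau>" "d = hyp_dist y z" by auto
  then have h: "y \<in> hyp_space" "z \<in> hyp_space" by (auto simp: hyp_box_def)
  have 0: "0 \<le> fst (hyperboloid v)" "fst (hyperboloid v) \<le> C" if "v \<in> hyp_box e \<tau>" for v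
    using hyp_density_le_box[OF D(2) _ that] hyp_density_ge_2[of v] that C
    by (auto simp: hyperboloid_def C_def hyp_box_def)
  have n: "norm (snd (hyperboloid v)) \<le> sqrt (C\<^sup>2 - 1)" if v: "v \<in> hyp_box e \<tau>" for v
    using norm_sq[of v] power_mono[OF 0(2,1)[OF v], of 2] v by (intro real_le_rsqrt) (simp add: hyp_box_def)
  have "- (snd (hyperboloid y) \<bullet> snd (hyperboloid z)) \<le> norm (snd (hyperboloid y)) * norm (snd (hyperboloid z))"
    using Cauchy_Schwarz_ineq2[of "snd (hyperboloid y)" "snd (hyperboloid z)"] by (simp add: abs_le_iff)
  also have "\<dots> \<le> sqrt (C\<^sup>2 - 1) * sqrt (C\<^sup>2 - 1)" using n yz C(1) by (intro mult_mono) (auto simp: one_le_power)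
  also have "\<dots> = C\<^sup>2 - 1" using C(1) by (simp add: one_le_power)
  finally have "- (snd (hyperboloid y) \<bullet> snd (hyperboloid z)) \<le> C\<^sup>2 - 1" .
  moreover have "fst (hyperboloid y) * fst (hyperboloid z) \<le> C * C" using 0 yz C(1) by (intro mult_mono) auto
  ultimately have "cosh d \<le> cosh D"
    using hyp_dist_facts(2)[OF h] C(2) yz(3) by (simp add: minkowski_def power2_eq_square)
  then show "d \<le> D" using hyp_dist_facts(1)[OF h] D(1) yz(3) by (simp add: cosh_real_nonneg_le_iff)
qed

end

subsection \<open>The fundamental gap of thin boxes\<close>

lemma restrict_in_dirichlet_eigenspace:
  fixes \<Omega> :: "(real ^ 'n) set"
  assumes n: "2 \<le> CARD('n)" and \<Omega>: "\<Omega> \<subseteq> hyp_space"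
    and jet: "hyp_jet p g (\<lambda>x. - \<kappa> * p x)"
    and zero: "\<And>x. x \<in> \<Omega> \<Longrightarrow> x \<notin> interior \<Omega> \<Longrightarrow> p x = 0"
  shows "(\<lambda>x. if x \<in> \<Omega> then p x else 0) \<in> dirichlet_eigenspace \<Omega> \<kappa>"
proof -
  let ?u = "\<lambda>x. if x \<in> \<Omega> then p x else 0"
  have eq: "p x = ?u x" if "x \<in> interior \<Omega>" for x using that interior_subset by auto
  have U: "open (interior \<Omega>)" "interior \<Omega> \<subseteq> hyp_space" using \<Omega> interior_subset by auto
  have "continuous_on \<Omega> ?u"
    by (rule continuous_on_eq[OF continuous_on_subset[OF hyp_jet_continuous(1)[OF jet] \<Omega>]]) simp
  moreover have "Ck_on 2 ?u (interior \<Omega>)"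
    by (rule hyp_jet_Ck_on[OF jet n U eq])
  moreover have "- hyp_laplacian ?u x = \<kappa> * ?u x" if "x \<in> interior \<Omega>" for x
  proof -
    have "hyp_laplacian ?u x = - \<kappa> * p x" by (rule hyp_jet_laplacian[OF jet n U eq that])
    then show ?thesis using eq[OF that] by simp
  qed
  moreover have "?u x = 0" if "x \<notin> interior \<Omega>" for x
    using that zero by simp
  ultimately show ?thesis by (simp add: dirichlet_eigenspace_def)
qed

text \<open>The separation constants of all but the first coordinate; \<open>\<nu> j\<close> belongs to the last j coordinates.\<close>

lemma ex_separation_constants:
  assumes "0 < \<delta>" "\<delta> \<le> 1"
  obtains \<nu> :: "nat \<Rightarrow> real" where "\<nu> 0 = 0" "\<And>j. 0 \<le> \<nu> j"
    "\<And>j. ground_level (Suc j) (\<nu> j) \<delta> (\<nu> (Suc j))" "\<And>j. 1 \<le> \<nu> (Suc j) * 2 ^ Suc j * \<delta>\<^sup>2"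
proof -
  have "\<exists>\<nu>. \<forall>j. (0 \<le> \<nu> j \<and> (j = 0 \<longrightarrow> \<nu> j = 0)) \<and>
      (ground_level (Suc j) (\<nu> j) \<delta> (\<nu> (Suc j)) \<and> 1 \<le> \<nu> (Suc j) * 2 ^ Suc j * \<delta>\<^sup>2)"
  proof (rule dependent_nat_choice)
    fix x :: real and j :: nat
    assume "0 \<le> x \<and> (j = 0 \<longrightarrow> x = 0)"
    then obtain \<kappa> where "0 \<le> \<kappa>" "ground_level (Suc j) x \<delta> \<kappa>" "1 \<le> \<kappa> * 2 ^ Suc j * \<delta>\<^sup>2"
      using ex_ground_level[of x \<delta> "Suc j"] assms by blast
    then show "\<exists>y. (0 \<le> y \<and> (Suc j = 0 \<longrightarrow> y = 0)) \<and> ground_level (Suc j) x \<delta> y \<and> 1 \<le> y * 2 ^ Suc j * \<delta>\<^sup>2"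
      by blast
  qed auto
  then obtain \<nu> where "\<forall>j. (0 \<le> \<nu> j \<and> (j = 0 \<longrightarrow> \<nu> j = 0)) \<and>
      (ground_level (Suc j) (\<nu> j) \<delta> (\<nu> (Suc j)) \<and> 1 \<le> \<nu> (Suc j) * 2 ^ Suc j * \<delta>\<^sup>2)" by blast
  then show ?thesis using that[of \<nu>] by blast
qed

text \<open>Index reversal: coordinate j lives in hyperbolic dimension n - j, and the coordinates
  after it contribute \<open>\<nu> (n - Suc j)\<close>. Nothing comes after the last one, hence
  \<open>\<nu> 0 = 0\<close>. Level 0 is left open, to carry either the even or the odd
  solution.\<close>

context
  fixes e :: "nat \<Rightarrow> 'n::finite" and \<tau> \<nu> :: "nat \<Rightarrow> real"
  assumes bij_e: "bij_betw e {..<CARD('n)} UNIV" and n2: "2 \<le> CARD('n)"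
    and \<nu>_0: "\<nu> 0 = 0"
    and \<tau>_pos: "\<And>k. 0 < \<tau> k"
    and level: "\<And>j. 0 < j \<Longrightarrow> j < CARD('n) \<Longrightarrow>
      ground_level (CARD('n) - j) (\<nu> (CARD('n) - Suc j)) (\<tau> j) (\<nu> (CARD('n) - j))"
begin

lemma inj_e: "inj_on e {..<CARD('n)}"
  using bij_e by (simp add: bij_betw_def)

text \<open>The sum telescopes because \<mu> of one level is \<kappa> of the next, and only the
  constant of level 0 survives, where \<open>S\<^sub>0 = 1\<close>. With \<open>\<eta> = 0\<close>
  this yields eigenfunctions, with \<open>\<eta> > 0\<close> supersolutions.\<close>

lemma hyp_jet_product:
  assumes F: "\<And>j. j < CARD('n) \<Longrightarrow> level_sol (CARD('n) - j) (\<nu> (CARD('n) - Suc j))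
      ((if j = 0 then \<kappa> else \<nu> (CARD('n) - j)) - \<eta>) (F j)"
  shows "\<exists>g. hyp_jet (\<lambda>x. \<Prod>j<CARD('n). F j (hyp_Y e j x)) g
    (\<lambda>x. (- \<kappa> + \<eta> * (\<Sum>j<CARD('n). 1 / hyp_S e j x)) * (\<Prod>j<CARD('n). F j (hyp_Y e j x)))"
proof -
  obtain g where g: "hyp_jet (\<lambda>x. \<Prod>j<CARD('n). F j (hyp_Y e j x)) g
      (\<lambda>x. (\<Sum>j<CARD('n). \<nu> (CARD('n) - Suc j) / hyp_S e (Suc j) x
        - ((if j = 0 then \<kappa> else \<nu> (CARD('n) - j)) - \<eta>) / hyp_S e j x) * (\<Prod>j<CARD('n). F j (hyp_Y e j x)))"
    using hyp_jet_level_product[OF inj_e, of "CARD('n)" "\<lambda>j. \<nu> (CARD('n) - j)"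
        "\<lambda>j. (if j = 0 then \<kappa> else \<nu> (CARD('n) - j)) - \<eta>" F] F by blast
  have "(\<Sum>j<CARD('n). \<nu> (CARD('n) - Suc j) / hyp_S e (Suc j) x
      - ((if j = 0 then \<kappa> else \<nu> (CARD('n) - j)) - \<eta>) / hyp_S e j x)
    = - \<kappa> + \<eta> * (\<Sum>j<CARD('n). 1 / hyp_S e j x)" for x
  proof -
    define a where "a j = (if j = 0 then \<kappa> else \<nu> (CARD('n) - j)) / hyp_S e j x" for j
    have "(\<Sum>j<CARD('n). \<nu> (CARD('n) - Suc j) / hyp_S e (Suc j) x
        - ((if j = 0 then \<kappa> else \<nu> (CARD('n) - j)) - \<eta>) / hyp_S e j x)
      = (\<Sum>j<CARD('n). (a (Suc j) - a j) + \<eta> * (1 / hyp_S e j x))"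
      by (intro sum.cong refl) (simp add: a_def diff_divide_distrib)
    also have "\<dots> = (a (CARD('n)) - a 0) + \<eta> * (\<Sum>j<CARD('n). 1 / hyp_S e j x)"
      by (simp only: sum.distrib sum_lessThan_telescope sum_distrib_left)
    also have "a (CARD('n)) = 0" by (simp add: a_def \<nu>_0)
    also have "a 0 = \<kappa>" by (simp add: a_def hyp_S_def)
    finally show ?thesis by simp
  qed
  then show ?thesis using g by auto
qed

text \<open>The first factor may be the even or the odd solution; the other factors are ground
  states. On the boundary some coordinate equals \<open>\<tau> k\<close> or
  \<open>- \<tau> k\<close>, and at the point with first coordinate y and all others 0 no factor
  vanishes.\<close>

lemma ex_box_eigenfunction:
  assumes F0: "level_sol (CARD('n)) (\<nu> (CARD('n) - 1)) \<kappa> f" "f (\<tau> 0) = 0" "f (- \<tau> 0) = 0"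
    and y: "\<bar>y\<bar> < \<tau> 0" "f y \<noteq> 0"
  shows "\<exists>u\<in>dirichlet_eigenspace (hyp_box e \<tau>) \<kappa>. \<exists>x. u x \<noteq> 0"
proof -
  have "\<exists>F. \<forall>j. 0 < j \<longrightarrow> j < CARD('n) \<longrightarrow>
      level_sol (CARD('n) - j) (\<nu> (CARD('n) - Suc j)) (\<nu> (CARD('n) - j)) (F j) \<and>
      (\<forall>y. \<bar>y\<bar> < \<tau> j \<longrightarrow> 0 < F j y) \<and> F j (\<tau> j) = 0 \<and> F j (- \<tau> j) = 0"
    using level unfolding ground_level_def by (intro choice) blast
  then obtain F where F: "\<And>j. 0 < j \<Longrightarrow> j < CARD('n) \<Longrightarrow>
      level_sol (CARD('n) - j) (\<nu> (CARD('n) - Suc j)) (\<nu> (CARD('n) - j)) (F j) \<and>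
      (\<forall>y. \<bar>y\<bar> < \<tau> j \<longrightarrow> 0 < F j y) \<and> F j (\<tau> j) = 0 \<and> F j (- \<tau> j) = 0" by blast
  define G where "G = F(0 := f)"
  have G: "G j (\<tau> j) = 0" "G j (- \<tau> j) = 0" if "j < CARD('n)" for j
    using F[of j] F0 that by (cases "j = 0"; simp add: G_def)+
  let ?p = "\<lambda>x. \<Prod>j<CARD('n). G j (hyp_Y e j x)"
  have "level_sol (CARD('n) - j) (\<nu> (CARD('n) - Suc j)) ((if j = 0 then \<kappa> else \<nu> (CARD('n) - j)) - 0) (G j)"
    if "j < CARD('n)" for j
    using F[of j] F0(1) that by (cases "j = 0") (simp_all add: G_def)
  then obtain g where g: "hyp_jet ?p g (\<lambda>x. - \<kappa> * ?p x)"
    using hyp_jet_product[of \<kappa> 0 G] by auto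
  have "?p x = 0" if xb: "x \<in> hyp_box e \<tau>" "x \<notin> interior (hyp_box e \<tau>)" for x
  proof -
    have x: "x \<in> hyp_space" using xb(1) by (simp add: hyp_box_def)
    then obtain k where k: "k < CARD('n)" "\<not> \<bar>hyp_Y e k x\<bar> < \<tau> k"
      using interior_hyp_box[OF bij_e x, of \<tau>] xb(2) by blast
    moreover have "\<bar>hyp_Y e k x\<bar> \<le> \<tau> k" using xb(1) k(1) by (simp add: hyp_box_def)
    ultimately have "hyp_Y e k x = \<tau> k \<or> hyp_Y e k x = - \<tau> k" by linarith
    then have "G k (hyp_Y e k x) = 0" using G[OF k(1)] by auto
    then show ?thesis using k(1) by (intro prod_zero) auto
  qed
  then have "(\<lambda>x. if x \<in> hyp_box e \<tau> then ?p x else 0) \<in> dirichlet_eigenspace (hyp_box e \<tau>) \<kappa>"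
    by (intro restrict_in_dirichlet_eigenspace[OF n2 _ g]) (auto simp: hyp_box_def)
  moreover obtain x where x: "x \<in> hyp_space" "\<And>k. k < CARD('n) \<Longrightarrow> hyp_Y e k x = (if k = 0 then y else 0)"
    using ex_hyp_Y[OF bij_e, of "\<lambda>k. if k = 0 then y else 0"] by blast
  have "G j (hyp_Y e j x) \<noteq> 0" if "j < CARD('n)" for j
    using F[of j] \<tau>_pos[of j] y that by (cases "j = 0") (auto simp: x(2) G_def less_imp_neq[THEN not_sym])
  then have "?p x \<noteq> 0" by simp
  moreover have "\<bar>hyp_Y e k x\<bar> \<le> \<tau> k" if "k < CARD('n)" for k
    using x(2)[OF that] y \<tau>_pos[of k] by simp
  then have "x \<in> hyp_box e \<tau>" using x(1) by (simp add: hyp_box_def)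
  ultimately show ?thesis by (intro bexI exI[of _ x]) auto
qed

lemma eigenfunction_zero_below:
  assumes ground: "ground_level (CARD('n)) (\<nu> (CARD('n) - 1)) (\<tau> 0) \<kappa>" and "\<mu> < \<kappa>"
    and v: "v \<in> dirichlet_eigenspace (hyp_box e \<tau>) \<mu>"
  shows "v x = 0"
proof -
  \<comment> \<open>Each of the n terms \<open>\<eta> / S\<^sub>j\<close> is at most \<eta>, so the
    total loss is at most half the distance from \<mu> to \<kappa>. All parameters are lowered,
    since every factor must be positive up to its own end points.\<close>
  define \<eta> where "\<eta> = (\<kappa> - \<mu>) / (2 * real CARD('n))"
  have \<eta>: "0 < \<eta>" "\<mu> < \<kappa> - \<eta> * real CARD('n)" using \<open>\<mu> < \<kappa>\<close> by (simp_all add: \<eta>_def field_simps)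
  have "\<exists>F. \<forall>j. j < CARD('n) \<longrightarrow>
      level_sol (CARD('n) - j) (\<nu> (CARD('n) - Suc j)) ((if j = 0 then \<kappa> else \<nu> (CARD('n) - j)) - \<eta>) (F j) \<and>
      (\<forall>y. \<bar>y\<bar> \<le> \<tau> j \<longrightarrow> 0 < F j y)"
  proof (intro choice allI)
    fix j
    have less: "\<kappa> - \<eta> < \<kappa>" "\<nu> (CARD('n) - j) - \<eta> < \<nu> (CARD('n) - j)" using \<eta> by auto
    show "\<exists>f. j < CARD('n) \<longrightarrow>
      level_sol (CARD('n) - j) (\<nu> (CARD('n) - Suc j)) ((if j = 0 then \<kappa> else \<nu> (CARD('n) - j)) - \<eta>) f \<and>
      (\<forall>y. \<bar>y\<bar> \<le> \<tau> j \<longrightarrow> 0 < f y)"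
    proof (cases "j = 0")
      case True
      then show ?thesis using ground less(1) unfolding ground_level_def by auto
    next
      case False
      then show ?thesis using level[of j] less(2) unfolding ground_level_def by auto
    qed
  qed
  then obtain F where F: "\<And>j. j < CARD('n) \<Longrightarrow>
      level_sol (CARD('n) - j) (\<nu> (CARD('n) - Suc j)) ((if j = 0 then \<kappa> else \<nu> (CARD('n) - j)) - \<eta>) (F j)"
    "\<And>j y. j < CARD('n) \<Longrightarrow> \<bar>y\<bar> \<le> \<tau> j \<Longrightarrow> 0 < F j y" by blast
  let ?w = "\<lambda>x. \<Prod>j<CARD('n). F j (hyp_Y e j x)"
  obtain g where g: "hyp_jet ?w g (\<lambda>x. (- \<kappa> + \<eta> * (\<Sum>j<CARD('n). 1 / hyp_S e j x)) * ?w x)"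
    using hyp_jet_product[of \<kappa> \<eta> F] F(1) by blast
  show ?thesis
  proof (rule eigenfunction_zero_if_supersolution[OF n2 compact_hyp_box[OF bij_e] _ g _ _ v \<eta>(2)])
    show "hyp_box e \<tau> \<subseteq> hyp_space" by (auto simp: hyp_box_def)
    show pos: "0 < ?w x" if "x \<in> hyp_box e \<tau>" for x
      using that F(2) by (intro prod_pos) (auto simp: hyp_box_def)
    show "(- \<kappa> + \<eta> * (\<Sum>j<CARD('n). 1 / hyp_S e j x)) * ?w x \<le> - (\<kappa> - \<eta> * real CARD('n)) * ?w x"
      if "x \<in> hyp_box e \<tau>" for x
    proof (rule mult_right_mono)
      have "(\<Sum>j<CARD('n). 1 / hyp_S e j x) \<le> (\<Sum>j<CARD('n). 1)"
        using hyp_S_ge_1[of e _ x] by (intro sum_mono) (simp add: divide_le_eq_1 hyp_S_pos)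
      then have "\<eta> * (\<Sum>j<CARD('n). 1 / hyp_S e j x) \<le> \<eta> * real CARD('n)"
        using \<eta>(1) by (intro mult_left_mono) auto
      then show "- \<kappa> + \<eta> * (\<Sum>j<CARD('n). 1 / hyp_S e j x) \<le> - (\<kappa> - \<eta> * real CARD('n))" by simp
    qed (use pos[OF that] in simp)
  qed
qed

end

theorem theorem1p1:
  fixes \<epsilon> D :: real
  assumes "CARD('n::finite) \<ge> 2" and "\<epsilon> > 0" and "D > 0"
  shows "\<exists>\<Omega> :: (real ^ 'n) set.
           convex_domain \<Omega> \<and> hyp_diameter \<Omega> = D \<and> fundamental_gap \<Omega> < \<epsilon> * pi\<^sup>2 / D\<^sup>2"
proof -
  define n where "n = CARD('n)"
  have n: "2 \<le> n" using assms(1) by (simp add: n_def)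
  \<comment> \<open>Half the length D in the variable \<open>y = sinh t\<close>: the limit of T for
    an infinitely thin box.\<close>
  define \<sigma> where "\<sigma> = sinh (D / 2)"
  have \<sigma>: "0 < \<sigma>" "(cosh (D / 2))\<^sup>2 = 1 + \<sigma>\<^sup>2" using \<open>D > 0\<close> by (simp_all add: \<sigma>_def cosh_square_eq)
  have \<epsilon>': "0 < \<epsilon> * pi\<^sup>2 / D\<^sup>2" using assms by simp
  obtain M where M: "0 \<le> M" "\<And>\<mu> T. M \<le> \<mu> \<Longrightarrow> \<sigma> / 2 \<le> T \<Longrightarrow> T \<le> \<sigma> \<Longrightarrow>
    \<exists>\<kappa>\<^sub>e \<kappa>\<^sub>o h. ground_level n \<mu> T \<kappa>\<^sub>e \<and> \<kappa>\<^sub>e < \<kappa>\<^sub>o \<and> \<kappa>\<^sub>o - \<kappa>\<^sub>e < \<epsilon> * pi\<^sup>2 / D\<^sup>2 \<and>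
      level_sol n \<mu> \<kappa>\<^sub>o h \<and> h T = 0 \<and> h (- T) = 0 \<and> (\<exists>y. \<bar>y\<bar> < T \<and> h y \<noteq> 0)"
    using ex_ground_level_gap[of "\<sigma> / 2" \<sigma> "\<epsilon> * pi\<^sup>2 / D\<^sup>2" n] \<sigma>(1) \<epsilon>' by auto
  \<comment> \<open>This smallness of \<delta> keeps T at least \<open>\<sigma> / 2\<close>; the
    next one lifts \<open>\<nu> (n - 1)\<close> above M.\<close>
  have "\<forall>\<^sub>F \<delta> in at_right (0 :: real). (1 + \<delta>\<^sup>2) ^ (n - 1) < (1 + \<sigma>\<^sup>2) / (1 + (\<sigma> / 2)\<^sup>2)"
  proof (rule order_tendstoD)
    show "((\<lambda>\<delta>. (1 + \<delta>\<^sup>2) ^ (n - 1)) \<longlongrightarrow> (1 + 0\<^sup>2) ^ (n - 1)) (at_right (0 :: real))"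
      by (intro tendsto_intros)
    show "(1 + 0\<^sup>2) ^ (n - 1) < (1 + \<sigma>\<^sup>2) / (1 + (\<sigma> / 2)\<^sup>2)"
      using \<sigma>(1) by (simp add: power_divide less_divide_eq add_pos_nonneg)
  qed
  moreover have "\<forall>\<^sub>F \<delta> in at_right (0 :: real). M * 2 ^ (n - 1) * \<delta>\<^sup>2 < 1"
  proof (rule order_tendstoD)
    show "((\<lambda>\<delta>. M * 2 ^ (n - 1) * \<delta>\<^sup>2) \<longlongrightarrow> M * 2 ^ (n - 1) * 0\<^sup>2) (at_right (0 :: real))"
      by (intro tendsto_intros)
  qed simp
  moreover have "\<forall>\<^sub>F \<delta> in at_right (0 :: real). \<delta> < 1"
    by (rule order_tendstoD(2)[OF tendsto_ident_at]) simp
  moreover have "\<forall>\<^sub>F \<delta> in at_right (0 :: real). 0 < \<delta>" by (rule eventually_at_right_less)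
  ultimately have "\<forall>\<^sub>F \<delta> in at_right (0 :: real). (1 + \<delta>\<^sup>2) ^ (n - 1) < (1 + \<sigma>\<^sup>2) / (1 + (\<sigma> / 2)\<^sup>2) \<and>
      M * 2 ^ (n - 1) * \<delta>\<^sup>2 < 1 \<and> \<delta> < 1 \<and> 0 < \<delta>"
    by eventually_elim simp
  then obtain \<delta> where \<delta>: "0 < \<delta>" "\<delta> < 1" "M * 2 ^ (n - 1) * \<delta>\<^sup>2 < 1"
    "(1 + \<delta>\<^sup>2) ^ (n - 1) < (1 + \<sigma>\<^sup>2) / (1 + (\<sigma> / 2)\<^sup>2)"
    using eventually_happens'[OF trivial_limit_at_right_real] by blast
  define \<pi> where "\<pi> = (1 + \<delta>\<^sup>2) ^ (n - 1)"
  have \<pi>: "1 \<le> \<pi>" by (simp add: \<pi>_def one_le_power)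
  have p: "0 < 1 + (\<sigma> / 2)\<^sup>2" by (simp add: add_pos_nonneg)
  \<comment> \<open>Solves \<open>(1 + T\<^sup>2) * \<pi> = (cosh (D / 2))\<^sup>2\<close>, the
    condition for diameter D. Here \<pi> is the contribution of the n - 1 thin directions, not the
    circle constant.\<close>
  define T where "T = sqrt ((1 + \<sigma>\<^sup>2) / \<pi> - 1)"
  have "\<pi> * (1 + (\<sigma> / 2)\<^sup>2) < 1 + \<sigma>\<^sup>2"
    using \<delta>(4) unfolding \<pi>_def[symmetric] pos_less_divide_eq[OF p] .
  then have "(1 + (\<sigma> / 2)\<^sup>2) * \<pi> \<le> 1 + \<sigma>\<^sup>2" by (simp add: mult.commute)
  then have "1 + (\<sigma> / 2)\<^sup>2 \<le> (1 + \<sigma>\<^sup>2) / \<pi>" using \<pi> by (subst pos_le_divide_eq) auto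
  then have T_ge: "\<sigma> / 2 \<le> T" unfolding T_def by (intro real_le_rsqrt) simp
  have "(1 + \<sigma>\<^sup>2) / \<pi> \<le> (1 + \<sigma>\<^sup>2) / 1" using \<pi> by (intro divide_left_mono) auto
  then have T_le: "T \<le> \<sigma>" unfolding T_def using \<sigma>(1) by (intro real_le_lsqrt) auto
  have "0 \<le> (1 + \<sigma>\<^sup>2) / \<pi> - 1" using \<open>1 + (\<sigma> / 2)\<^sup>2 \<le> _\<close> zero_le_power2[of "\<sigma> / 2"] by linarith
  then have T_sq: "(1 + T\<^sup>2) * \<pi> = 1 + \<sigma>\<^sup>2" using \<pi> by (simp add: T_def)
  obtain \<nu> where \<nu>: "\<nu> 0 = 0" "\<And>j. 0 \<le> \<nu> j"
    "\<And>j. ground_level (Suc j) (\<nu> j) \<delta> (\<nu> (Suc j))" "\<And>j. 1 \<le> \<nu> (Suc j) * 2 ^ Suc j * \<delta>\<^sup>2"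
    using ex_separation_constants[of \<delta>] \<delta>(1,2) by auto
  \<comment> \<open>As n \<ge> 2 there is at least one thin direction, so the lower bound, available
    at successor indices only, applies to \<open>\<nu> (n - 1)\<close>.\<close>
  have "Suc (n - 2) = n - 1" using n by simp
  then have "1 \<le> \<nu> (n - 1) * (2 ^ (n - 1) * \<delta>\<^sup>2)" using \<nu>(4)[of "n - 2"] by (simp only: mult.assoc)
  moreover have "M * (2 ^ (n - 1) * \<delta>\<^sup>2) < 1" using \<delta>(3) by (simp only: mult.assoc)
  ultimately have "M * (2 ^ (n - 1) * \<delta>\<^sup>2) \<le> \<nu> (n - 1) * (2 ^ (n - 1) * \<delta>\<^sup>2)" by (rule order_trans[OF less_imp_le, rotated])
  then have M_le: "M \<le> \<nu> (n - 1)" using \<delta>(1) by (subst (asm) mult_le_cancel_right_pos) auto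
  obtain \<kappa>\<^sub>e \<kappa>\<^sub>o h where k: "ground_level n (\<nu> (n - 1)) T \<kappa>\<^sub>e" "\<kappa>\<^sub>e < \<kappa>\<^sub>o" "\<kappa>\<^sub>o - \<kappa>\<^sub>e < \<epsilon> * pi\<^sup>2 / D\<^sup>2"
    "level_sol n (\<nu> (n - 1)) \<kappa>\<^sub>o h" "h T = 0" "h (- T) = 0" "\<exists>y. \<bar>y\<bar> < T \<and> h y \<noteq> 0"
    using M(2)[OF M_le T_ge T_le] by blast
  obtain e :: "nat \<Rightarrow> 'n" where e: "bij_betw e {..<CARD('n)} UNIV"
    using ex_bij_betw_nat_finite[of "UNIV :: 'n set"] by (auto simp: atLeast0LessThan)
  define \<tau> where "\<tau> j = (if j = 0 then T else \<delta>)" for j :: nat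
  have T_pos: "0 < T" using T_ge \<sigma>(1) by simp
  have \<tau>: "0 < \<tau> j" "\<tau> 0 = T" for j using T_pos \<delta>(1) by (simp_all add: \<tau>_def)
  have level: "ground_level (CARD('n) - j) (\<nu> (CARD('n) - Suc j)) (\<tau> j) (\<nu> (CARD('n) - j))"
    if "0 < j" "j < CARD('n)" for j
    using \<nu>(3)[of "CARD('n) - Suc j"] that by (simp add: \<tau>_def Suc_diff_Suc)
  let ?\<Omega> = "hyp_box e \<tau> :: (real ^ 'n) set"
  have "(\<Prod>j<CARD('n). 1 + (\<tau> j)\<^sup>2) = (1 + T\<^sup>2) * \<pi>"
    using n prod.lessThan_Suc_shift[of "\<lambda>j. 1 + (\<tau> j)\<^sup>2" "n - 1"] by (simp add: \<tau>_def \<pi>_def n_def)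
  then have "hyp_diameter ?\<Omega> = D"
    using hyp_diameter_box[OF e less_imp_le[OF \<tau>(1)], of D] assms(3) T_sq \<sigma>(2) by simp
  moreover have "0 \<in> interior ?\<Omega>"
    by (rule interior_hyp_box[OF e]) (simp_all add: hyp_space_def hyp_Y_def hyp_X_def \<tau>)
  then have "convex_domain ?\<Omega>"
    using compact_hyp_box[OF e] hyp_convex_box[OF e less_imp_le[OF \<tau>(1)]] by (auto simp: convex_domain_def)
  moreover have "fundamental_gap ?\<Omega> < \<epsilon> * pi\<^sup>2 / D\<^sup>2"
  proof -
    note box = e assms(1) \<nu>(1) \<tau>(1) level
    obtain f where f: "level_sol n (\<nu> (n - 1)) \<kappa>\<^sub>e f" "\<And>y. \<bar>y\<bar> < T \<Longrightarrow> 0 < f y" "f T = 0" "f (- T) = 0"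
      using k(1) unfolding ground_level_def by blast
    obtain u\<^sub>e x\<^sub>e where ue: "u\<^sub>e \<in> dirichlet_eigenspace ?\<Omega> \<kappa>\<^sub>e" "u\<^sub>e x\<^sub>e \<noteq> 0"
      using ex_box_eigenfunction[OF box, of \<kappa>\<^sub>e f 0] f(1,3,4) f(2)[of 0] T_pos by (auto simp: n_def \<tau>)
    obtain y where "\<bar>y\<bar> < T" "h y \<noteq> 0" using k(7) by blast
    then have "\<exists>u\<in>dirichlet_eigenspace ?\<Omega> \<kappa>\<^sub>o. \<exists>x. u x \<noteq> 0"
      using ex_box_eigenfunction[OF box, of \<kappa>\<^sub>o h y] k(4-6) by (simp add: n_def \<tau>)
    then obtain u\<^sub>o x\<^sub>o where uo: "u\<^sub>o \<in> dirichlet_eigenspace ?\<Omega> \<kappa>\<^sub>o" "u\<^sub>o x\<^sub>o \<noteq> 0" by blast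
    have zero: "u x = 0" if "\<mu> < \<kappa>\<^sub>e" "u \<in> dirichlet_eigenspace ?\<Omega> \<mu>" for \<mu> u x
      using eigenfunction_zero_below[OF box, of \<kappa>\<^sub>e \<mu> u] k(1) that by (simp add: n_def \<tau>)
    have "fundamental_gap ?\<Omega> \<le> \<kappa>\<^sub>o - \<kappa>\<^sub>e"
      by (rule fundamental_gap_le[OF _ ue uo k(2)]) (rule zero)
    then show ?thesis using k(3) by simp
  qed
  ultimately show ?thesis by blast
qed

end
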